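(* For $c\in(0,\frac34)$ and the sequence $\{k_n\}_{n\in\mathbb{N}}$ defined by $k_n:=\lfloor c\log n\rfloor$, one has, as $n\to\infty$, $$p_{k_n}^{(n)}=\frac{\sigma(\alpha_* )}{\sqrt{2\pi}}\left(\frac1{\alpha_*}+\frac1{\alpha_*+1}\right)\frac{K(\alpha_* )}{\Gamma(\alpha_* )}\binom{\alpha_*+1}{2}^{-k_n}\frac{n^{\alpha_*-1}}{\sqrt{k_n}}\,(1+o(1)),$$ where $$\alpha_*:=c-\frac12+\frac12\sqrt{4c^2+1}>0\qquad\text{and}\qquad\sigma(\alpha_* ):=\left(\frac1{\alpha_*^2}+\frac1{(\alpha_*+1)^2}\right)^{-1/2}>0.$$
   Context: Let $T\subset\mathbb{R}^2$ be the triangle with vertices $(0,0)$, $\mathbf{v}_1=(1,0)$, $\mathbf{v}_2=(0,1)$. For $n\ge 0$ let $\mathbf{X}_1,\dots,\mathbf{X}_n$ be independent uniformly distributed random points in $T$ and $T_n:=\operatorname{conv}\{\mathbf{v}_1,\mathbf{v}_2,\mathbf{X}_1,\dots,\mathbf{X}_n\}$. Let $f_0(T_n)$ be the number of vertices of $T_n$ (including $\mathbf{v}_1,\mathbf{v}_2$) and $p_k^{(n)}:=\mathbb{P}(f_0(T_n)=k+2)$ for $k\in\{0,\dots,n\}$. Here $K(\alpha):=\frac{\Gamma(1+2\alpha)}{\Gamma(1+\alpha)\Gamma(2+\alpha)}$, and $\binom{\alpha+1}{2}=\frac{\alpha(\alpha+1)}{2}$ for real $\alpha$. *)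

theory Defs
  imports "HOL-Probability.Probability" "HOL-Library.Landau_Symbols"
begin

definition std_triangle :: "(real \<times> real) set" where
  "std_triangle = convex hull {(0, 0), (1, 0), (0, 1)}"

text \<open>The number of vertices of a polytope, a vertex being an extreme point.\<close>

definition f0 :: "(real \<times> real) set \<Rightarrow> nat" where
  "f0 P = card {v. v extreme_point_of P}"

definition random_hull :: "(nat \<Rightarrow> 'a \<Rightarrow> real \<times> real) \<Rightarrow> nat \<Rightarrow> 'a \<Rightarrow> (real \<times> real) set" where
  "random_hull X n \<omega> = convex hull ({(1, 0), (0, 1)} \<union> (\<lambda>i. X i \<omega>) ` {1..n})"

text \<open>Independence includes Borel measurability of each \<open>X i\<close>.\<close>

definition iid_uniform_points ::
    "'a measure \<Rightarrow> (nat \<Rightarrow> 'a \<Rightarrow> real \<times> real) \<Rightarrow> nat \<Rightarrow> bool" where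
  "iid_uniform_points M X n \<longleftrightarrow>
     prob_space M \<and>
     prob_space.indep_vars M (\<lambda>_. borel) X {1..n} \<and>
     (\<forall>i\<in>{1..n}. distr M borel (X i) = uniform_measure lborel std_triangle)"

definition vertex_prob :: "'a measure \<Rightarrow> (nat \<Rightarrow> 'a \<Rightarrow> real \<times> real) \<Rightarrow> nat \<Rightarrow> nat \<Rightarrow> real" where
  "vertex_prob M X n k = measure M {\<omega> \<in> space M. f0 (random_hull X n \<omega>) = k + 2}"

definition K :: "real \<Rightarrow> real" where
  "K \<alpha> = Gamma (1 + 2 * \<alpha>) / (Gamma (1 + \<alpha>) * Gamma (2 + \<alpha>))"

definition alpha_star :: "real \<Rightarrow> real" where
  "alpha_star c = c - 1 / 2 + 1 / 2 * sqrt (4 * c\<^sup>2 + 1)"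

definition sigma_star :: "real \<Rightarrow> real" where
  "sigma_star \<alpha> = (1 / \<alpha>\<^sup>2 + 1 / (\<alpha> + 1)\<^sup>2) powr (- 1 / 2)"

lemma gchoose_two: "(\<alpha> + 1) gchoose 2 = \<alpha> * (\<alpha> + 1) / (2 :: real)"
  by (simp add: gbinomial_prod_rev numeral_2_eq_2 algebra_simps)

end

theory Submission
  imports Defs "HOL-Real_Asymp.Real_Asymp"
begin

text \<open>
  The vertices of the hull other than the two corners form a convex chain, and such a chain can be
  peeled from the corner \<open>(1, 0)\<close>. Let \<open>p\<close> be the vertex next to \<open>(1, 0)\<close>. All other points lie
  above the ray from \<open>(1, 0)\<close> through \<open>p\<close>, and among them only those matter for the rest of the chain
  that lie beyond the segment from \<open>p\<close> to \<open>(0, 1)\<close> (\<open>f0_chain_step\<close>). The region beyond this segment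
  is an affine image of the whole triangle in which \<open>p\<close> plays the part of \<open>(1, 0)\<close>; affine maps preserve
  numbers of vertices and uniform distributions. Integration over \<open>p\<close> therefore yields a recursion for the
  probability \<open>p\<^sub>k(n)\<close> of \<open>k\<close> vertices besides the corners,
  \<open>p\<^sub>k\<^sub>+\<^sub>1(n) = 2 / (n (n + 1)) (\<Sum>m<n. (n - m) p\<^sub>k(m))\<close>,
  and \<open>vertex_prob_eq_chain_prob\<close> identifies the vertex probabilities with its solution.

  For the generating functions \<open>G\<^sub>n(t) = (\<Sum>k. p\<^sub>k(n) t^k)\<close> the recursion says that
  \<open>F(x) = (\<Sum>n. G\<^sub>n(t) x^n)\<close> solves \<open>(1 - x)\<^sup>2 (x F'' + 2 F') = 2 t F\<close>. If \<open>2 t = a (a + 1)\<close>, the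
  solution is the product of \<open>1 - x\<close> to the power \<open>- a\<close> and the hypergeometric series with upper parameters
  \<open>- a\<close> and \<open>1 - a\<close> and lower parameter \<open>2\<close>, so \<open>G\<^sub>n(t)\<close> is an explicit convolution
  (\<open>chain_gf_eq_conv_coef\<close>). The power has coefficients asymptotic to \<open>n powr (a - 1) / Gamma a\<close>, and for
  \<open>a > 0\<close> the hypergeometric series converges absolutely at \<open>1\<close>, where Gauss's formula gives the value \<open>K a\<close>.
  Hence \<open>G\<^sub>n(t)\<close> is asymptotic to \<open>K a / Gamma a * n powr (a - 1)\<close>. This remains true when \<open>a\<close> varies
  along a sequence of complex numbers with a positive limit (\<open>conv_coef_tendsto\<close>).

  The rest is a saddle point argument. The number \<open>p\<^sub>k(n) t^k\<close> is a Fourier coefficient of the function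
  \<open>\<theta> \<mapsto> G\<^sub>n(t e^(\<i>\<theta>))\<close> for every \<open>t > 0\<close>. Along this circle the root \<open>a(\<theta>)\<close> of \<open>a (a + 1) = 2 t e^(\<i>\<theta>)\<close>
  expands as \<open>\<alpha> + \<i> c \<theta> - v \<theta>\<^sup>2 / 2\<close> with \<open>c = \<alpha> (\<alpha> + 1) / (2 \<alpha> + 1)\<close>, so that for \<open>k\<close> close to \<open>c ln n\<close> the
  linear phase cancels and the integrand is a Gaussian on the scale \<open>\<theta> = \<phi> / sqrt (ln n)\<close>. The real part
  of \<open>a(\<theta>)\<close> drops quadratically below \<open>\<alpha>\<close> on the whole circle (\<open>Re_saddle_root_le\<close>), which supplies an integrable
  majorant (\<open>norm_chain_gf_le\<close>), and dominated convergence gives \<open>chain_prob_local_limit\<close>. Solving the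
  equation for \<open>c\<close> gives \<open>\<alpha> = alpha_star c\<close>, and then \<open>v = c^3 / (sigma_star \<alpha>)\<^sup>2\<close>.
\<close>

section \<open>Extreme points and the peeling of a convex chain\<close>

lemma extreme_point_of_convex_hull_finite:
  fixes C :: "'a :: euclidean_space set"
  assumes "finite C"
  shows "v extreme_point_of (convex hull C) \<longleftrightarrow> v \<in> C \<and> v \<notin> convex hull (C - {v})"
proof
  assume v: "v extreme_point_of (convex hull C)"
  have vC: "v \<in> C" using v by (rule extreme_point_of_convex_hull)
  have "convex (convex hull C - {v})"
    using v by (simp add: extreme_point_of_stillconvex)
  hence "convex hull (C - {v}) \<subseteq> convex hull C - {v}"
    using hull_subset[of C convex] by (intro hull_minimal) auto
  thus "v \<in> C \<and> v \<notin> convex hull (C - {v})" using vC by auto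
next
  assume v: "v \<in> C \<and> v \<notin> convex hull (C - {v})"
  with extreme_point_of_convex_hull_insert[of "C - {v}" v] assms
  show "v extreme_point_of (convex hull C)" by (simp add: insert_absorb)
qed

text \<open>
  Seen from \<open>w\<close>, the point \<open>u\<close> of the hull lies in front of \<open>e\<close>. If \<open>e\<close> were on a segment from \<open>w\<close> to
  some \<open>z\<close> in the hull, then \<open>e\<close> would lie between \<open>u\<close> and \<open>z\<close> and hence in the hull itself.
\<close>

lemma notin_convex_hull_insert_shielded:
  fixes w e u :: "'a :: real_vector"
  assumes e: "e \<notin> convex hull D" and u: "u \<in> convex hull D"
    and us: "u = w + s *\<^sub>R (e - w)" "0 < s" "s \<le> 1" and we: "w \<noteq> e"
  shows "e \<notin> convex hull (insert w D)"
proof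
  assume "e \<in> convex hull (insert w D)"
  moreover have "D \<noteq> {}" using u by auto
  ultimately obtain p q z where pq: "p \<ge> 0" "q \<ge> 0" "p + q = 1" and z: "z \<in> convex hull D"
    and e_eq: "e = p *\<^sub>R w + q *\<^sub>R z"
    by (auto simp: convex_hull_insert)
  have s1: "s < 1" using us e u by (cases "s = 1") auto
  have q0: "q > 0" using pq we e_eq by (cases "q = 0") auto
  have q1: "q \<le> 1" using pq by simp
  have p: "p = 1 - q" using pq by simp
  have "s * q \<le> s * 1" using q1 us by (intro mult_left_mono) auto
  hence den: "1 - s * q > 0" using s1 by simp
  \<comment> \<open>\<open>e\<close> lies between \<open>u\<close> and \<open>z\<close> on the ray from \<open>w\<close>; solve for its barycentric weights\<close>
  define m where "m = (1 - q) / (1 - s * q)"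
  have m0: "m \<ge> 0" using den q1 by (simp add: m_def)
  have "1 - q \<le> 1 - s * q" using s1 q0 by simp
  hence m1: "m \<le> 1" using den by (simp add: m_def)
  have ew: "e - w = q *\<^sub>R (z - w)"
    by (simp add: e_eq p algebra_simps)
  have m_eq: "(m * s + (1 - m) / q) = 1"
    using den q0 by (simp add: m_def divide_simps) (simp add: algebra_simps)
  have zw: "z - w = (1 / q) *\<^sub>R (e - w)" using ew q0 by simp
  have "m *\<^sub>R u + (1 - m) *\<^sub>R z = w + m *\<^sub>R (u - w) + (1 - m) *\<^sub>R (z - w)"
    by (simp add: algebra_simps)
  also have "\<dots> = w + (m * s + (1 - m) / q) *\<^sub>R (e - w)"
    by (simp add: us zw scaleR_left_distrib)
  also have "\<dots> = e" using m_eq by simp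
  finally have "e = m *\<^sub>R u + (1 - m) *\<^sub>R z" ..
  hence "e \<in> convex hull D"
    using convexD[OF convex_convex_hull u z, of m "1 - m"] m0 m1 by simp
  with e show False by simp
qed

abbreviation (input) chain :: "(real \<times> real) set \<Rightarrow> (real \<times> real) set" where
  "chain S \<equiv> {(1, 0), (0, 1)} \<union> S"

definition triangle :: "(real \<times> real) set" where
  "triangle = {(x, y). 0 \<le> x \<and> 0 \<le> y \<and> x + y \<le> 1}"

lemma std_triangle_eq: "std_triangle = triangle"
proof
  have "convex triangle"
  proof (rule convexI)
    fix p q :: "real \<times> real" and u v :: real
    assume *: "p \<in> triangle" "q \<in> triangle" "0 \<le> u" "0 \<le> v" "u + v = 1"
    have "u * (fst p + snd p) + v * (fst q + snd q) \<le> u * 1 + v * 1"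
      using * by (intro add_mono mult_left_mono) (auto simp: triangle_def)
    moreover have "0 \<le> u * fst p + v * fst q" "0 \<le> u * snd p + v * snd q"
      using * by (auto simp: triangle_def)
    ultimately show "u *\<^sub>R p + v *\<^sub>R q \<in> triangle"
      using * by (simp add: triangle_def case_prod_beta distrib_left)
  qed
  thus "std_triangle \<subseteq> triangle"
    unfolding std_triangle_def by (intro hull_minimal) (auto simp: triangle_def)
next
  show "triangle \<subseteq> std_triangle"
  proof
    fix p assume "p \<in> triangle"
    then obtain x y where p: "p = (x, y)" "0 \<le> x" "0 \<le> y" "x + y \<le> 1" by (auto simp: triangle_def)
    have "p = (1 - x - y) *\<^sub>R (0, 0) + x *\<^sub>R (1, 0) + y *\<^sub>R (0, 1)" by (simp add: p)
    thus "p \<in> std_triangle" unfolding std_triangle_def convex_hull_3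
      using p by (intro CollectI exI[of _ "1 - x - y"] exI[of _ x] exI[of _ y]) auto
  qed
qed

text \<open>
  The height at which the ray from \<open>(1, 0)\<close> through \<open>p\<close> meets the side on the second coordinate axis.
\<close>

definition slope :: "real \<times> real \<Rightarrow> real" where
  "slope p = snd p / (1 - fst p)"

definition above_ray :: "real \<Rightarrow> (real \<times> real) set" where
  "above_ray h = {(u, v) \<in> triangle. h * (1 - u) < v}"

text \<open>
  The affine map that sends \<open>p\<close> to \<open>(1, 0)\<close>, fixes \<open>(0, 1)\<close> and sends \<open>(0, slope p)\<close> to the origin.
\<close>

definition to_triangle :: "real \<times> real \<Rightarrow> real \<times> real \<Rightarrow> real \<times> real" where
  "to_triangle p = (\<lambda>(u, v). (u / fst p, (v - slope p * (1 - u)) / (1 - slope p)))"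

definition beyond :: "real \<times> real \<Rightarrow> (real \<times> real) set" where
  "beyond p = {z \<in> above_ray (slope p). to_triangle p z \<in> triangle}"

definition int_triangle :: "(real \<times> real) set" where
  "int_triangle = {(x, y). 0 < x \<and> 0 < y \<and> x + y < 1}"

lemma slope_int_triangle:
  assumes "p \<in> int_triangle" shows "0 < slope p" "slope p < 1" "snd p = slope p * (1 - fst p)"
  using assms by (auto simp: int_triangle_def slope_def field_simps)

lemma in_convex_halfspace:
  fixes a b c :: real
  assumes "\<And>z. z \<in> S \<Longrightarrow> a * fst z + b * snd z > c" "z \<in> convex hull S"
  shows "a * fst z + b * snd z > c"
proof -
  have "convex {z. (a, b) \<bullet> z > c}" by (rule convex_halfspace_gt)
  hence "convex hull S \<subseteq> {z. (a, b) \<bullet> z > c}"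
    using assms(1) by (intro hull_minimal) (auto simp: inner_prod_def)
  thus ?thesis using assms(2) by (auto simp: inner_prod_def)
qed

text \<open>
  The first coordinate \<open>u\<close> together with the height \<open>b\<close> above the ray, scaled so that \<open>b = 1\<close> at \<open>(0, 1)\<close>.
\<close>

lemma above_ray_coordinates:
  assumes p: "p \<in> int_triangle" and z: "z \<in> above_ray (slope p)"
  obtains u b where "z = (u, slope p * (1 - u) + b * (1 - slope p))" "to_triangle p z = (u / fst p, b)"
    "0 \<le> u" "0 < b" "u + b \<le> 1"
proof -
  define h where "h = slope p"
  have h: "0 < h" "h < 1" using slope_int_triangle[OF p] by (auto simp: h_def)
  obtain u v where zuv: "z = (u, v)" by force
  define b where "b = (v - h * (1 - u)) / (1 - h)"
  have uv: "h * (1 - u) < v" "0 \<le> u" "u + v \<le> 1" using z by (auto simp: above_ray_def triangle_def zuv h_def)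
  have b: "b > 0" using uv h by (simp add: b_def)
  have vb: "v = h * (1 - u) + b * (1 - h)" using h by (simp add: b_def)
  have "v - h * (1 - u) \<le> (1 - u) * (1 - h)" using uv by (simp add: algebra_simps)
  hence ub: "u + b \<le> 1" using h by (simp add: b_def field_simps)
  have "to_triangle p z = (u / fst p, b)" by (simp add: to_triangle_def zuv b_def h_def)
  with that[of u b] vb b ub uv(2) show thesis by (simp add: zuv h_def)
qed

text \<open>
  A point above the ray that is not beyond \<open>p\<close> lies in the triangle with corners \<open>(1, 0)\<close>, \<open>p\<close> and
  \<open>(0, 1)\<close> and does not contribute to the hull. It remains to see that adding the corner \<open>(1, 0)\<close> to \<open>C\<close>
  destroys no extreme point. The points \<open>p\<close> and \<open>(0, 1)\<close> are exposed by linear functionals; every other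
  point of \<open>C\<close> is shielded from \<open>(1, 0)\<close> by the segment from \<open>p\<close> to \<open>(0, 1)\<close>.
\<close>

lemma vertices_peel:
  assumes fin: "finite S" and p: "p \<in> int_triangle" and S: "S \<subseteq> above_ray (slope p)"
  defines "C \<equiv> {p, (0, 1)} \<union> (S \<inter> beyond p)"
  shows "{v. v extreme_point_of (convex hull (chain (insert p S)))}
       = insert (1, 0) {v. v extreme_point_of (convex hull C)}"
    and "\<not> (1, 0) extreme_point_of (convex hull C)"
proof -
  define h where "h = slope p"
  obtain x y where pxy: "p = (x, y)" by force
  have xy: "0 < x" "0 < y" "x + y < 1" using p by (auto simp: pxy int_triangle_def)
  have h: "0 < h" "h < 1" "y = h * (1 - x)"
    using slope_int_triangle[OF p] by (auto simp: h_def pxy)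
  have [simp]: "finite C" using fin by (simp add: C_def)
  have Ssub: "S \<inter> beyond p \<subseteq> above_ray h" using S by (auto simp: h_def)
  have hull_eq: "convex hull (chain (insert p S)) = convex hull (insert (1, 0) C)" (is "?L = ?R")
  proof
    show "?R \<subseteq> ?L" by (intro hull_mono) (auto simp: C_def)
    have "z \<in> convex hull (insert (1, 0) C)" if z: "z \<in> S" "z \<notin> beyond p" for z
    proof -
      obtain u b where zub: "z = (u, h * (1 - u) + b * (1 - h))" "to_triangle p z = (u / x, b)"
        and uv: "0 \<le> u" and b: "b > 0" and ub: "u + b \<le> 1"
        using above_ray_coordinates[OF p, of z] z S unfolding h_def pxy fst_conv by blast
      have 3: "u / x + b > 1" using zub z S uv b xy by (auto simp: beyond_def triangle_def)
      hence 4: "u > x * (1 - b)" using xy by (simp add: field_simps)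
      \<comment> \<open>barycentric coordinates of \<open>z\<close> with respect to \<open>(1, 0)\<close> and \<open>p\<close>; that of \<open>(0, 1)\<close> is \<open>b\<close>\<close>
      define c1 where "c1 = (u - x * (1 - b)) / (1 - x)"
      define c2 where "c2 = ((1 - b) - u) / (1 - x)"
      have c: "c1 \<ge> 0" "c2 \<ge> 0" using 4 ub xy by (auto simp: c1_def c2_def)
      have cs: "c1 + c2 = 1 - b" using xy by (simp add: c1_def c2_def add_divide_distrib[symmetric])
                                   (simp add: divide_simps, simp add: algebra_simps)
      have cx: "c1 + c2 * x = u" using xy by (simp add: c1_def c2_def divide_simps) (simp add: algebra_simps)
      have "c2 * y + b = h * (1 - u) + b * (1 - h)"
      proof -
        have "c2 * y = h * (c2 - c2 * x)" by (simp only: h(3)) (simp add: algebra_simps)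
        also have "c2 - c2 * x = (1 - b) - u" using cs cx by simp
        finally show ?thesis by (simp add: algebra_simps)
      qed
      hence "z = c1 *\<^sub>R (1, 0) + c2 *\<^sub>R p + b *\<^sub>R (0, 1)" using cx by (simp add: zub pxy)
      hence "z \<in> convex hull {(1, 0), p, (0, 1)}"
        unfolding convex_hull_3 using c b cs
        by (intro CollectI exI[of _ c1] exI[of _ c2] exI[of _ b]) auto
      thus ?thesis using hull_mono[of "{(1, 0), p, (0, 1)}" "insert (1, 0) C"] by (auto simp: C_def)
    qed
    hence "chain (insert p S) \<subseteq> convex hull (insert (1, 0) C)"
      using hull_subset[of "insert (1, 0) C" convex] by (auto simp: C_def)
    thus "?L \<subseteq> ?R" by (intro hull_minimal) auto
  qed
  have Cprop: "z = p \<or> z = (0, 1) \<or> (z \<in> triangle \<and> snd z > h * (1 - fst z))" if "z \<in> C" for z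
    using that Ssub by (auto simp: C_def above_ray_def)
  have fst1: "fst z < 1" if "z \<in> C" for z
  proof -
    have "fst z < 1" if "z \<in> triangle" "snd z > h * (1 - fst z)"
      using that by (cases "fst z = 1") (auto simp: triangle_def)
    thus ?thesis using Cprop[OF \<open>z \<in> C\<close>] xy by (auto simp: pxy)
  qed
  have v1_notin: "(1, 0) \<notin> convex hull C"
    using fst1 in_convex_halfspace[of C "-1" "-1" 0 "(1, 0)"] by auto
  have eq: "z \<notin> convex hull (C - {z}) \<longleftrightarrow> z \<notin> convex hull (insert (1, 0) (C - {z}))" if z: "z \<in> C" for z
  proof
    assume "z \<notin> convex hull (insert (1, 0) (C - {z}))"
    thus "z \<notin> convex hull (C - {z})" using hull_mono[of "C - {z}" "insert (1, 0) (C - {z})" convex] by auto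
  next
    assume zn: "z \<notin> convex hull (C - {z})"
    consider "z = (0, 1)" | "z = p" | "z \<noteq> p" "z \<noteq> (0, 1)" by blast
    thus "z \<notin> convex hull (insert (1, 0) (C - {z}))"
    proof cases
      case 1
      have "snd e < 1" if "e \<in> insert (1, 0) (C - {z})" for e
        using that xy 1 Cprop[of e] by (cases e) (auto simp: triangle_def pxy)
      hence "0 * fst z + (-1) * snd z > -1" if "z \<in> convex hull (insert (1, 0) (C - {z}))"
        by (intro in_convex_halfspace[OF _ that]) simp
      thus ?thesis using 1 by auto
    next
      case 2
      have *: "h * fst e + 1 * snd e > h" if "e \<in> C - {z}" for e
        using that xy 2 Cprop[of e] h by (cases e) (auto simp: triangle_def pxy algebra_simps)
      show ?thesis
      proof
        assume zh: "z \<in> convex hull (insert (1, 0) (C - {z}))"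
        have "(0, 1) \<in> C - {z}" using 2 xy by (simp add: C_def pxy)
        hence "C - {z} \<noteq> {}" by blast
        with zh obtain a b e where ab: "a \<ge> 0" "b \<ge> 0" "a + b = 1" and e: "e \<in> convex hull (C - {z})"
          and z_eq: "z = a *\<^sub>R (1, 0) + b *\<^sub>R e" unfolding convex_hull_insert[OF \<open>C - {z} \<noteq> {}\<close>] by blast
        have e': "h * fst e + snd e > h" using in_convex_halfspace[of "C - {z}" h h 1 e] * e by simp
        have "h * fst z + snd z = a * h + b * (h * fst e + snd e)"
          by (simp add: z_eq algebra_simps)
        moreover have "h * fst z + snd z = h * (a + b)"
          using h ab by (simp add: 2 pxy algebra_simps)
        ultimately have "b * (h * fst e + snd e - h) = 0" by (simp add: algebra_simps)
        hence "b = 0" using e' by auto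
        thus False using z_eq ab 2 xy by (simp add: pxy)
      qed
    next
      case 3
      hence zS: "z \<in> S \<inter> beyond p" using z by (auto simp: C_def)
      obtain u b where zub: "z = (u, h * (1 - u) + b * (1 - h))" "to_triangle p z = (u / x, b)"
        and uv: "0 \<le> u" and b: "b > 0" and ub: "u + b \<le> 1"
        using above_ray_coordinates[OF p, of z] zS S unfolding h_def pxy fst_conv by blast
      have 3: "u / x + b \<le> 1" using zS zub by (auto simp: beyond_def triangle_def)
      hence 4: "u + x * b \<le> x" using xy by (simp add: field_simps)
      define d where "d = 1 - u - x * b"
      have d: "d \<ge> 1 - x" "d > 0" using 4 xy by (auto simp: d_def)
      \<comment> \<open>the segment from \<open>(1, 0)\<close> to \<open>z\<close> crosses the one from \<open>p\<close> to \<open>(0, 1)\<close> at the parameters \<open>s\<close> and \<open>t\<close>\<close>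
      define s where "s = (1 - x) / d"
      have s: "0 < s" "s \<le> 1" using d xy by (auto simp: s_def)
      define t where "t = s * b"
      have t0: "t \<ge> 0" using s b by (simp add: t_def)
      have "(1 - x) * b \<le> d" using ub by (simp add: d_def algebra_simps)
      hence t1: "t \<le> 1" using d by (simp add: t_def s_def)
      have sd: "s * d = 1 - x" using d by (simp add: s_def)
      have e1: "1 + s * (u - 1) = (1 - t) * x"
        using sd unfolding d_def t_def by (simp add: algebra_simps)
      have e2: "s * (h * (1 - u) + b * (1 - h)) = (1 - t) * y + t"
      proof -
        have "s * (h * (1 - u) + b * (1 - h)) = h * (s * (1 - u)) + t * (1 - h)" by (simp add: t_def algebra_simps)
        also have "s * (1 - u) = 1 - (1 - t) * x" using e1 by (simp add: algebra_simps)
        finally show ?thesis by (simp add: h(3) algebra_simps)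
      qed
      have *: "(1, 0) + s *\<^sub>R (z - (1, 0)) = (1 - t) *\<^sub>R p + t *\<^sub>R (0, 1)"
        using e1 e2 by (simp add: zub pxy)
      have "(1 - t) *\<^sub>R p + t *\<^sub>R (0, 1) \<in> convex hull (C - {z})"
        using 3 \<open>z \<noteq> p\<close> \<open>z \<noteq> (0, 1)\<close> t0 t1
        by (intro convexD[OF convex_convex_hull] hull_inc) (auto simp: C_def)
      moreover have "(1, 0) \<noteq> z" using v1_notin z hull_inc[of z C convex] by auto
      ultimately show ?thesis
        using notin_convex_hull_insert_shielded[OF zn, of _ "(1, 0)" s] * s by metis
    qed
  qed
  have notin: "(1, 0) \<notin> C" using v1_notin hull_inc by metis
  have "v extreme_point_of (convex hull (insert (1, 0) C)) \<longleftrightarrow> v = (1, 0) \<or> v extreme_point_of (convex hull C)" for v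
  proof (cases "v = (1, 0)")
    case True
    thus ?thesis using v1_notin notin by (simp add: extreme_point_of_convex_hull_finite)
  next
    case False
    hence "insert (1, 0) C - {v} = insert (1, 0) (C - {v})" by auto
    thus ?thesis using False eq[of v] by (auto simp: extreme_point_of_convex_hull_finite)
  qed
  thus "{v. v extreme_point_of (convex hull (chain (insert p S)))}
       = insert (1, 0) {v. v extreme_point_of (convex hull C)}"
    unfolding hull_eq by blast
  show "\<not> (1, 0) extreme_point_of (convex hull C)"
    using v1_notin extreme_point_of_convex_hull_finite[of C "(1,0)"] hull_inc[of "(1,0)" C convex] by auto
qed

lemma inj_to_triangle:
  assumes "p \<in> int_triangle" shows "inj (to_triangle p)"
  using assms slope_int_triangle[OF assms]
  by (auto simp: inj_on_def to_triangle_def int_triangle_def)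

lemma to_triangle_corners:
  assumes "p \<in> int_triangle" shows "to_triangle p p = (1, 0)" "to_triangle p (0, 1) = (0, 1)"
  using assms slope_int_triangle[OF assms]
  by (auto simp: to_triangle_def int_triangle_def case_prod_beta)

lemma to_triangle_affine: "linear (\<lambda>z. to_triangle p z - to_triangle p 0)"
  by (auto intro!: linearI simp: to_triangle_def case_prod_beta add_divide_distrib diff_divide_distrib algebra_simps)

lemma convex_hull_to_triangle: "convex hull (to_triangle p ` S) = to_triangle p ` (convex hull S)"
proof -
  have *: "to_triangle p ` A = (\<lambda>z. to_triangle p 0 + z) ` (\<lambda>z. to_triangle p z - to_triangle p 0) ` A" for A
    by (simp add: image_image)
  show ?thesis
    by (simp only: * convex_hull_translation convex_hull_linear_image[OF to_triangle_affine])
qed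

lemma extreme_points_affine_image:
  fixes f :: "'a :: euclidean_space \<Rightarrow> 'b :: euclidean_space"
  assumes "inj f" "finite C" "\<And>A. convex hull (f ` A) = f ` (convex hull A)"
  shows "{v. v extreme_point_of (convex hull (f ` C))} = f ` {v. v extreme_point_of (convex hull C)}"
proof -
  have diff: "f ` C - {f v} = f ` (C - {v})" for v using assms(1) by (auto simp: inj_def)
  moreover have "finite (f ` C)" using assms by simp
  ultimately have "{v. v extreme_point_of (convex hull (f ` C))} = {v \<in> f ` C. v \<notin> convex hull (f ` C - {v})}"
    by (simp add: extreme_point_of_convex_hull_finite)
  also have "\<dots> = f ` {v \<in> C. v \<notin> convex hull (C - {v})}"
    using diff assms(1) by (auto simp: assms(3) inj_image_mem_iff)
  finally show ?thesis using assms(2) by (simp add: extreme_point_of_convex_hull_finite)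
qed

text \<open>
  Peeling removes the vertex \<open>(1, 0)\<close> and no other; the affine map turns what is left into a hull of the
  original form.
\<close>

lemma f0_chain_step:
  assumes fin: "finite S" and p: "p \<in> int_triangle" and S: "S \<subseteq> above_ray (slope p)"
  shows "f0 (convex hull (chain (insert p S)))
    = Suc (f0 (convex hull (chain (to_triangle p ` (S \<inter> beyond p)))))"
proof -
  define C where "C = {p, (0, 1)} \<union> (S \<inter> beyond p)"
  have [simp]: "finite C" using fin by (simp add: C_def)
  have img: "to_triangle p ` C = chain (to_triangle p ` (S \<inter> beyond p))"
    using to_triangle_corners[OF p] by (auto simp: C_def)
  have "finite {v. v extreme_point_of (convex hull C)}"
    by (rule finite_subset[OF _ \<open>finite C\<close>]) (auto dest: extreme_point_of_convex_hull)
  hence "f0 (convex hull (chain (insert p S))) = Suc (card {v. v extreme_point_of (convex hull C)})"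
    using vertices_peel[OF assms, folded C_def] by (simp add: f0_def)
  also have "card {v. v extreme_point_of (convex hull C)} = f0 (convex hull (to_triangle p ` C))"
    unfolding f0_def
    by (subst extreme_points_affine_image)
       (auto simp: inj_to_triangle p convex_hull_to_triangle intro!: card_image[symmetric] inj_on_subset[OF inj_to_triangle[OF p]])
  finally show ?thesis by (simp only: img)
qed

section \<open>Measurability of the number of vertices\<close>

text \<open>
  The directions that strictly separate a point from finitely many others form an open set. Hence a
  countable dense set of directions detects all extreme points, which makes extremality a measurable
  condition on the points.
\<close>

lemma extreme_point_iff_exposed_by_dense:
  fixes C :: "'a :: euclidean_space set"
  assumes fin: "finite C" and D: "\<And>U. open U \<Longrightarrow> U \<noteq> {} \<Longrightarrow> \<exists>d\<in>D. d \<in> U"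
  shows "v extreme_point_of (convex hull C) \<longleftrightarrow> v \<in> C \<and> (\<exists>d\<in>D. \<forall>w\<in>C. w \<noteq> v \<longrightarrow> d \<bullet> w < d \<bullet> v)"
proof -
  have "v \<notin> convex hull (C - {v}) \<longleftrightarrow> (\<exists>d\<in>D. \<forall>w\<in>C. w \<noteq> v \<longrightarrow> d \<bullet> w < d \<bullet> v)"
  proof
    assume "v \<notin> convex hull (C - {v})"
    moreover have "closed (convex hull (C - {v}))"
      using fin by (intro compact_imp_closed finite_imp_compact_convex_hull) auto
    ultimately obtain a b where ab: "a \<bullet> v < b" "\<And>x. x \<in> convex hull (C - {v}) \<Longrightarrow> a \<bullet> x > b"
      using separating_hyperplane_closed_point[of "convex hull (C - {v})" v] by auto
    define U where "U = (\<Inter>w\<in>C - {v}. {d. d \<bullet> w < d \<bullet> v})"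
    have "open U" unfolding U_def using fin
      by (intro open_INT) (auto intro!: open_Collect_less continuous_intros)
    moreover have "- a \<in> U"
      using ab hull_inc[of _ "C - {v}" convex] by (fastforce simp: U_def)
    ultimately obtain d where "d \<in> D" "d \<in> U" using D by blast
    thus "\<exists>d\<in>D. \<forall>w\<in>C. w \<noteq> v \<longrightarrow> d \<bullet> w < d \<bullet> v" by (auto simp: U_def)
  next
    assume "\<exists>d\<in>D. \<forall>w\<in>C. w \<noteq> v \<longrightarrow> d \<bullet> w < d \<bullet> v"
    then obtain d where d: "\<forall>w\<in>C. w \<noteq> v \<longrightarrow> d \<bullet> w < d \<bullet> v" by blast
    have "convex hull (C - {v}) \<subseteq> {w. d \<bullet> w < d \<bullet> v}"
      using d by (intro hull_minimal convex_halfspace_lt) auto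
    thus "v \<notin> convex hull (C - {v})" by auto
  qed
  thus ?thesis unfolding extreme_point_of_convex_hull_finite[OF fin] by (rule conj_cong[OF refl])
qed

text \<open>
  Coinciding points are one vertex, so each point is represented by its first index.
\<close>

lemma card_Collect_image_eq_card_first_indices:
  fixes y :: "nat \<Rightarrow> 'b"
  shows "card {v \<in> y ` L. P v} = card {l \<in> L. P (y l) \<and> (\<forall>m\<in>L. m < l \<longrightarrow> y m \<noteq> y l)}" (is "_ = card ?S")
proof (rule bij_betw_same_card[symmetric, of y], unfold bij_betw_def, intro conjI)
  show "inj_on y ?S"
  proof (rule inj_onI, rule ccontr)
    fix l m assume *: "l \<in> ?S"
      "m \<in> ?S" "y l = y m" "l \<noteq> m"
    from \<open>l \<noteq> m\<close> have "l < m \<or> m < l" by linarith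
    with * show False by auto
  qed
  show "y ` ?S = {v \<in> y ` L. P v}"
  proof safe
    fix l assume l: "l \<in> L" "P (y l)"
    define m where "m = (LEAST m. m \<in> L \<and> y m = y l)"
    have m: "m \<in> L \<and> y m = y l" unfolding m_def by (rule LeastI[of _ l]) (use l in auto)
    have "y j \<noteq> y l" if "j \<in> L" "j < m" for j
      using not_less_Least[of j "\<lambda>m. m \<in> L \<and> y m = y l"] that by (auto simp: m_def)
    thus "y l \<in> y ` ?S"
      using m l by (intro image_eqI[of _ _ m]) auto
  qed auto
qed

lemma measurable_f0_convex_hull:
  fixes y :: "nat \<Rightarrow> 'a \<Rightarrow> real \<times> real"
  assumes fin: "finite L" and y: "\<And>l. l \<in> L \<Longrightarrow> y l \<in> borel_measurable M"
  shows "(\<lambda>\<omega>. f0 (convex hull ((\<lambda>l. y l \<omega>) ` L))) \<in> measurable M (count_space UNIV)"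
proof -
  obtain D :: "(real \<times> real) set" where D: "countable D" "\<And>U. open U \<Longrightarrow> U \<noteq> {} \<Longrightarrow> \<exists>d\<in>D. d \<in> U"
    by (rule countable_dense_setE) blast
  define T where "T \<omega> = {l \<in> L. (\<exists>d\<in>D. \<forall>m\<in>L. y m \<omega> \<noteq> y l \<omega> \<longrightarrow> d \<bullet> y m \<omega> < d \<bullet> y l \<omega>) \<and>
                                (\<forall>m\<in>L. m < l \<longrightarrow> y m \<omega> \<noteq> y l \<omega>)}" for \<omega>
  have eq: "f0 (convex hull ((\<lambda>l. y l \<omega>) ` L)) = card (T \<omega>)" for \<omega>
    unfolding f0_def T_def using fin D(2)
    by (subst card_Collect_image_eq_card_first_indices[symmetric])
       (simp add: extreme_point_iff_exposed_by_dense[of "(\<lambda>l. y l \<omega>) ` L" D])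
  have "{\<omega> \<in> space M. l \<in> T \<omega>} \<in> sets M" for l
  proof (cases "l \<in> L")
    case True
    note [measurable] = y D(1) fin
    have "Measurable.pred M (\<lambda>\<omega>. y m \<omega> = y l \<omega>)" "Measurable.pred M (\<lambda>\<omega>. d \<bullet> y m \<omega> < d \<bullet> y l \<omega>)" if "m \<in> L" for m d
      using y[OF that] y[OF True] by measurable
    hence "Measurable.pred M (\<lambda>\<omega>. \<forall>m\<in>L. y m \<omega> \<noteq> y l \<omega> \<longrightarrow> d \<bullet> y m \<omega> < d \<bullet> y l \<omega>)"
      "Measurable.pred M (\<lambda>\<omega>. \<forall>m\<in>L. m < l \<longrightarrow> y m \<omega> \<noteq> y l \<omega>)" for d
      by (intro pred_intros_finite pred_intros_logic fin; simp)+
    note preds = this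
    let ?p = "\<lambda>d \<omega>. \<forall>m\<in>L. y m \<omega> \<noteq> y l \<omega> \<longrightarrow> d \<bullet> y m \<omega> < d \<bullet> y l \<omega>"
    have "(\<Union>d\<in>D. {\<omega> \<in> space M. ?p d \<omega>}) \<in> sets M"
      using preds(1) by (intro sets.countable_UN'' D(1)) (simp add: pred_def)
    also have "(\<Union>d\<in>D. {\<omega> \<in> space M. ?p d \<omega>}) =
        {\<omega> \<in> space M. \<exists>d\<in>D. ?p d \<omega>}" by blast
    finally have ex: "\<dots> \<in> sets M" .
    from sets.sets_Collect_conj[OF preds(2)[unfolded pred_def] ex]
    show ?thesis unfolding T_def using True by simp
  qed (simp add: T_def)
  hence "(\<lambda>\<omega>. card (T \<omega>)) \<in> measurable M (count_space UNIV)" by (rule measurable_card)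
  thus ?thesis by (simp add: eq)
qed

lemma measurable_f0_chain:
  fixes x :: "nat \<Rightarrow> 'a \<Rightarrow> real \<times> real"
  assumes fin: "finite J" and x: "\<And>i. i \<in> J \<Longrightarrow> x i \<in> borel_measurable M"
  shows "(\<lambda>\<omega>. f0 (convex hull (chain ((\<lambda>i. x i \<omega>) ` J)))) \<in> measurable M (count_space UNIV)"
proof -
  define y where "y l = (if l = 0 then (\<lambda>_. (1, 0)) else if l = 1 then (\<lambda>_. (0, 1)) else x (l - 2))" for l
  define L where "L = {0, 1} \<union> (\<lambda>i. i + 2) ` J"
  have "chain ((\<lambda>i. x i \<omega>) ` J) = (\<lambda>l. y l \<omega>) ` L" for \<omega>
    by (force simp: y_def L_def image_Un image_image)
  moreover have "(\<lambda>\<omega>. f0 (convex hull ((\<lambda>l. y l \<omega>) ` L))) \<in> measurable M (count_space UNIV)"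
    using fin x by (intro measurable_f0_convex_hull) (auto simp: y_def L_def)
  ultimately show ?thesis by simp
qed

lemma f0_chain_ge_2:
  assumes "finite S" "S \<subseteq> triangle"
  shows "f0 (convex hull (chain S)) \<ge> 2"
proof -
  let ?E = "{v. v extreme_point_of (convex hull (chain S))}"
  have halves: "v extreme_point_of (convex hull (chain S))"
    if v: "v \<in> {(1, 0), (0, 1)}" for v
  proof -
    obtain a b :: real where ab: "v = (a, b)" by force
    have "z \<in> triangle" if "z \<in> chain S" for z using that assms by (auto simp: triangle_def)
    hence lt: "a * fst z + b * snd z < 1" if "z \<in> chain S" "z \<noteq> v" for z
      using that v by (cases z) (force simp: ab triangle_def)
    have "(- a) * fst z + (- b) * snd z > -1" if "z \<in> convex hull (chain S - {v})" for z
    proof (rule in_convex_halfspace[OF _ that])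
      fix w assume "w \<in> chain S - {v}"
      thus "(- a) * fst w + (- b) * snd w > -1" using lt[of w] by simp
    qed
    hence "v \<notin> convex hull (chain S - {v})" using v by (force simp: ab)
    moreover have "v \<in> chain S" using v by blast
    ultimately show ?thesis using assms(1) by (simp add: extreme_point_of_convex_hull_finite)
  qed
  have "{(1, 0), (0, 1)} \<subseteq> ?E" using halves by auto
  moreover have "finite ?E"
    by (rule finite_subset[of _ "chain S"]) (use assms in \<open>auto dest: extreme_point_of_convex_hull\<close>)
  ultimately show ?thesis unfolding f0_def using card_mono[of ?E "{(1, 0), (0, 1)}"] by simp
qed

lemma f0_chain_empty: "f0 (convex hull (chain {})) = 2"
proof -
  have "{v. v extreme_point_of (convex hull (chain {}))} = {(1, 0), (0, 1)}"
    by (auto simp: extreme_point_of_convex_hull_2 simp del: convex_hull_2)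
  thus ?thesis by (simp add: f0_def)
qed

section \<open>The uniform distribution on the triangle\<close>

abbreviation unif :: "(real \<times> real) measure" where
  "unif \<equiv> uniform_measure lborel std_triangle"

lemma borel_measurable_fst_snd [measurable]:
  "fst \<in> borel_measurable (borel :: (real \<times> real) measure)"
  "snd \<in> borel_measurable (borel :: (real \<times> real) measure)"
  by (simp_all add: borel_prod[symmetric])

lemma sets_triangle [measurable]: "triangle \<in> sets borel" "int_triangle \<in> sets borel"
proof -
  have "triangle = {p \<in> space (borel \<Otimes>\<^sub>M borel). 0 \<le> fst p \<and> 0 \<le> snd p \<and> fst p + snd p \<le> 1}"
    by (auto simp: triangle_def space_pair_measure)
  also have "\<dots> \<in> sets (borel \<Otimes>\<^sub>M borel)" by measurable
  finally show "triangle \<in> sets borel" unfolding borel_prod .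
  have "int_triangle = {p \<in> space (borel \<Otimes>\<^sub>M borel). 0 < fst p \<and> 0 < snd p \<and> fst p + snd p < 1}"
    by (auto simp: int_triangle_def space_pair_measure)
  also have "\<dots> \<in> sets (borel \<Otimes>\<^sub>M borel)" by measurable
  finally show "int_triangle \<in> sets borel" unfolding borel_prod .
qed

lemma measurable_slope [measurable]: "slope \<in> borel_measurable borel"
  unfolding slope_def borel_prod[symmetric] by measurable

lemma measurable_to_triangle [measurable]: "to_triangle p \<in> borel_measurable borel"
  unfolding to_triangle_def case_prod_beta borel_prod[symmetric] by measurable

lemma sets_above_ray [measurable]: "above_ray h \<in> sets borel"
proof -
  have "{p \<in> space (borel \<Otimes>\<^sub>M borel). h * (1 - fst p) < snd p} \<in> sets (borel \<Otimes>\<^sub>M borel)"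
    by measurable
  hence "triangle \<inter> {p. h * (1 - fst p) < snd p} \<in> sets borel"
    unfolding borel_prod by (intro sets.Int sets_triangle) simp
  moreover have "above_ray h = triangle \<inter> {p. h * (1 - fst p) < snd p}" by (auto simp: above_ray_def)
  ultimately show ?thesis by simp
qed

lemma sets_beyond [measurable]: "beyond p \<in> sets borel"
proof -
  have "beyond p = above_ray (slope p) \<inter> (to_triangle p -` triangle \<inter> space borel)" by (auto simp: beyond_def)
  thus ?thesis by simp
qed

text \<open>
  Fubini's theorem and the one-dimensional substitution rule in each coordinate. The affine maps that occur
  below are all triangular.
\<close>

lemma emeasure_lborel_triangular_map:
  fixes A :: "(real \<times> real) set"
  assumes [measurable]: "A \<in> sets borel" and sr: "s > 0" "r > 0"
  shows "emeasure lborel A = ennreal (s * r) * emeasure lborel {z. (s * fst z, t + q * fst z + r * snd z) \<in> A}"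
proof -
  have em: "emeasure lborel B = (\<integral>\<^sup>+u. \<integral>\<^sup>+v. indicator B (u, v) \<partial>lborel \<partial>lborel)"
    if [measurable]: "B \<in> sets borel" for B :: "(real \<times> real) set"
  proof -
    have "emeasure lborel B = (\<integral>\<^sup>+z. indicator B z \<partial>(lborel \<Otimes>\<^sub>M lborel))"
      unfolding lborel_prod by simp
    also have "\<dots> = (\<integral>\<^sup>+u. \<integral>\<^sup>+v. indicator B (u, v) \<partial>lborel \<partial>lborel)"
      by (subst lborel.nn_integral_fst[symmetric]) (simp_all add: lborel_prod)
    finally show ?thesis .
  qed
  let ?B = "{z. (s * fst z, t + q * fst z + r * snd z) \<in> A}"
  have [measurable]: "?B \<in> sets borel"
  proof -
    have "(\<lambda>z. (s * fst z, t + q * fst z + r * snd z)) -` A \<inter> space borel \<in> sets (borel :: (real \<times> real) measure)"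
      unfolding borel_prod[symmetric]
      by (rule measurable_sets[of _ _ "borel \<Otimes>\<^sub>M borel"], simp) (simp only: borel_prod assms(1))
    thus ?thesis by (simp add: vimage_def)
  qed
  have "emeasure lborel A = (\<integral>\<^sup>+u. \<integral>\<^sup>+v. indicator A (u, v) \<partial>lborel \<partial>lborel)" by (rule em) fact
  also have "\<dots> = ennreal s * (\<integral>\<^sup>+u. \<integral>\<^sup>+v. indicator A (s * u, v) \<partial>lborel \<partial>lborel)"
    using sr by (subst nn_integral_real_affine[where c = s and t = 0]) simp_all
  also have "\<dots> = ennreal s * (\<integral>\<^sup>+u. ennreal r * (\<integral>\<^sup>+v. indicator A (s * u, (t + q * u) + r * v) \<partial>lborel) \<partial>lborel)"
  proof (intro arg_cong2[of _ _ _ _ "(*)"] refl nn_integral_cong)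
    fix u :: real
    show "(\<integral>\<^sup>+v. indicator A (s * u, v) \<partial>lborel) = ennreal r * (\<integral>\<^sup>+v. indicator A (s * u, (t + q * u) + r * v) \<partial>lborel)"
      using sr by (subst nn_integral_real_affine[where c = r and t = "t + q * u"]) simp_all
  qed
  also have "\<dots> = ennreal s * (ennreal r * (\<integral>\<^sup>+u. (\<integral>\<^sup>+v. indicator ?B (u, v) \<partial>lborel) \<partial>lborel))"
    by (subst nn_integral_cmult) (simp_all add: indicator_def)
  also have "\<dots> = ennreal (s * r) * emeasure lborel ?B"
    using sr by (subst em) (simp_all add: ennreal_mult mult.assoc)
  finally show ?thesis .
qed

lemma emeasure_lborel_axis:
  fixes A :: "(real \<times> real) set"
  assumes [measurable]: "A \<in> sets borel"
  shows "emeasure lborel {z \<in> A. snd z \<noteq> 0} = emeasure lborel A"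
proof (rule emeasure_eq_AE)
  have "emeasure (lborel \<Otimes>\<^sub>M lborel) ((UNIV :: real set) \<times> {0::real}) = emeasure lborel (UNIV :: real set) * emeasure lborel {0::real}"
    by (rule lborel.emeasure_pair_measure_Times) auto
  hence "UNIV \<times> {0} \<in> null_sets (lborel :: (real \<times> real) measure)"
    by (intro null_setsI) (simp_all add: lborel_prod borel_closed closed_Times)
  from AE_not_in[OF this] show "AE x in lborel. x \<in> {z \<in> A. snd z \<noteq> 0} \<longleftrightarrow> x \<in> A"
    by eventually_elim auto
qed simp_all

lemma nn_integral_Beta_nat:
  "(\<integral>\<^sup>+t. indicator {0<..<1} t * ennreal (t ^ a * (1 - t) ^ b) \<partial>lborel)
     = ennreal (fact a * fact b / fact (a + b + 1))"
proof (subst mult.commute, rule nn_integral_has_integral_lebesgue')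
  have "((\<lambda>t. t powr (real (Suc a) - 1) * (1 - t) powr (real (Suc b) - 1)) has_integral Beta (real (Suc a)) (real (Suc b))) {0<..<1}"
    using has_integral_Beta_real[of "Suc a" "Suc b"] by (simp add: has_integral_Icc_iff_Ioo)
  moreover have "Beta (real (Suc a)) (real (Suc b)) = fact a * fact b / fact (a + b + 1)"
    using Gamma_fact[of a, where 'a = real] Gamma_fact[of b, where 'a = real] Gamma_fact[of "a + b + 1", where 'a = real]
    by (simp add: Beta_def add_ac)
  ultimately have "((\<lambda>t::real. t ^ a * (1 - t) ^ b) has_integral fact a * fact b / fact (a + b + 1)) {0<..<1}"
    by (subst (asm) has_integral_cong[where g = "\<lambda>t. t ^ a * (1 - t) ^ b"])
       (simp_all add: powr_realpow)
  thus "((\<lambda>t::real. t ^ a * (1 - t) ^ b) has_integral fact a * fact b / fact (a + b + 1)) {0<..<1}" .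
qed auto

text \<open>
  In the coordinates \<open>x = fst p\<close> and \<open>h = slope p\<close> the area element of the triangle is \<open>(1 - x) dh dx\<close>, so the
  integral is a product of two Beta integrals.
\<close>

lemma nn_integral_lborel_strip:
  "(\<integral>\<^sup>+p. indicator int_triangle p * ennreal (fst p ^ a * (1 - fst p) ^ b * (1 - slope p) ^ N) \<partial>lborel)
     = ennreal (1 / (N + 1) * (fact a * fact (b + 1) / fact (a + b + 2)))"
proof -
  let ?f = "\<lambda>p. indicator int_triangle p * ennreal (fst p ^ a * (1 - fst p) ^ b * (1 - slope p) ^ N)"
  have "(\<integral>\<^sup>+p. ?f p \<partial>lborel) = (\<integral>\<^sup>+p. ?f p \<partial>(lborel \<Otimes>\<^sub>M lborel))"
    unfolding lborel_prod ..
  also have "\<dots> = (\<integral>\<^sup>+x. \<integral>\<^sup>+y. ?f (x, y) \<partial>lborel \<partial>lborel)"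
    by (subst lborel.nn_integral_fst[symmetric]) (simp_all add: lborel_prod)
  also have "\<dots> = (\<integral>\<^sup>+x. ennreal (1 / (N + 1)) * (indicator {0<..<1} x * ennreal (x ^ a * (1 - x) ^ (b + 1))) \<partial>lborel)"
  proof (rule nn_integral_cong)
    fix x :: real
    show "(\<integral>\<^sup>+y. ?f (x, y) \<partial>lborel) = ennreal (1 / (N + 1)) * (indicator {0<..<1} x * ennreal (x ^ a * (1 - x) ^ (b + 1)))"
    proof (cases "x \<in> {0<..<1}")
      case False
      hence "(x, y) \<notin> int_triangle" for y by (auto simp: int_triangle_def)
      thus ?thesis using False by simp
    next
      case True
      hence x: "0 < x" "x < 1" by auto
      have "(\<integral>\<^sup>+y. ?f (x, y) \<partial>lborel) = ennreal (1 - x) * (\<integral>\<^sup>+t. ?f (x, 0 + (1 - x) * t) \<partial>lborel)"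
        using x by (subst nn_integral_real_affine[where c = "1 - x" and t = 0]) simp_all
      also have "(\<integral>\<^sup>+t. ?f (x, 0 + (1 - x) * t) \<partial>lborel) =
          (\<integral>\<^sup>+t. ennreal (x ^ a * (1 - x) ^ b) * (indicator {0<..<1} t * ennreal (t ^ 0 * (1 - t) ^ N)) \<partial>lborel)"
      proof (rule nn_integral_cong)
        fix t :: real
        have "(x, (1 - x) * t) \<in> int_triangle \<longleftrightarrow> t \<in> {0<..<1}"
        proof -
          have "x + (1 - x) * t < 1 \<longleftrightarrow> (1 - x) * t < (1 - x) * 1" by auto
          also have "\<dots> \<longleftrightarrow> t < 1" using x by (subst mult_less_cancel_left_pos) auto
          finally show ?thesis using x by (auto simp: int_triangle_def zero_less_mult_iff)
        qed
        thus "?f (x, 0 + (1 - x) * t) = ennreal (x ^ a * (1 - x) ^ b) * (indicator {0<..<1} t * ennreal (t ^ 0 * (1 - t) ^ N))"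
          using x by (auto simp: slope_def indicator_def simp flip: ennreal_mult)
      qed
      also have "\<dots> = ennreal (x ^ a * (1 - x) ^ b) * ennreal (1 / (N + 1))"
        by (subst nn_integral_cmult) (simp_all only: nn_integral_Beta_nat, simp_all)
      finally show ?thesis using x by (simp add: ennreal_mult[symmetric] mult_ac)
    qed
  qed
  also have "\<dots> = ennreal (1 / (N + 1)) * ennreal (fact a * fact (b + 1) / fact (a + (b + 1) + 1))"
    by (subst nn_integral_cmult) (simp_all only: nn_integral_Beta_nat, simp_all)
  finally show ?thesis by (simp add: ennreal_mult[symmetric])
qed


lemma sets_unif [measurable_cong]: "sets unif = sets borel" by simp

lemma emeasure_triangle: "emeasure lborel triangle = ennreal (1 / 2)"
proof -
  have "emeasure lborel triangle = (\<integral>\<^sup>+p. indicator triangle p \<partial>(lborel \<Otimes>\<^sub>M lborel))"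
    unfolding lborel_prod by simp
  also have "\<dots> = (\<integral>\<^sup>+x. \<integral>\<^sup>+y. indicator triangle (x, y) \<partial>lborel \<partial>lborel)"
    by (subst lborel.nn_integral_fst[symmetric]) (simp_all add: lborel_prod)
  also have "\<dots> = (\<integral>\<^sup>+x. indicator {0<..<1} x * ennreal (x ^ 0 * (1 - x) ^ 1) \<partial>lborel)"
  proof (rule nn_integral_cong_AE)
    have "AE x in lborel. x \<noteq> (0::real)" "AE x in lborel. x \<noteq> (1::real)"
      by (rule AE_lborel_singleton)+
    thus "AE x in lborel. (\<integral>\<^sup>+y. indicator triangle (x, y) \<partial>lborel) = indicator {0<..<1} x * ennreal (x ^ 0 * (1 - x) ^ 1)"
    proof eventually_elim
      fix x :: real assume x: "x \<noteq> 0" "x \<noteq> 1"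
      show "(\<integral>\<^sup>+y. indicator triangle (x, y) \<partial>lborel) = indicator {0<..<1} x * ennreal (x ^ 0 * (1 - x) ^ 1)"
      proof (cases "x \<in> {0<..<1}")
        case True
        hence "(\<integral>\<^sup>+y. indicator triangle (x, y) \<partial>lborel) = (\<integral>\<^sup>+y. indicator {0..1 - x} y \<partial>lborel)"
          by (intro nn_integral_cong) (auto simp: triangle_def indicator_def)
        thus ?thesis using True by simp
      next
        case False
        hence "(x, y) \<notin> triangle" for y using x by (auto simp: triangle_def)
        thus ?thesis using False by simp
      qed
    qed
  qed
  also have "\<dots> = ennreal (1 / 2)"
    by (subst nn_integral_Beta_nat) (simp add: numeral_2_eq_2)
  finally show ?thesis .
qed

lemma ennreal_divide_half: "x / ennreal (1 / 2) = 2 * x"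
  unfolding divide_ennreal_def by (subst inverse_ennreal) (simp_all add: mult.commute)

lemma prob_space_unif: "prob_space unif"
  by (rule prob_space_uniform_measure) (simp_all add: std_triangle_eq emeasure_triangle ennreal_eq_0_iff del: ennreal_half)

lemma emeasure_unif:
  assumes "B \<in> sets borel" "B \<subseteq> triangle"
  shows "emeasure unif B = 2 * emeasure lborel B"
  using assms
  by (subst emeasure_uniform_measure) (simp_all add: std_triangle_eq emeasure_triangle ennreal_divide_half Int_absorb1 del: ennreal_half)

lemma emeasure_unif_Int_triangle:
  assumes "B \<in> sets borel"
  shows "emeasure unif (triangle \<inter> B) = emeasure unif B"
  using assms by (simp add: std_triangle_eq Int_assoc[symmetric])

lemma nn_integral_unif:
  assumes [measurable]: "f \<in> borel_measurable borel" and "\<And>x. x \<notin> triangle \<Longrightarrow> f x = 0"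
  shows "(\<integral>\<^sup>+x. f x \<partial>unif) = 2 * (\<integral>\<^sup>+x. f x \<partial>lborel)"
proof -
  have "(\<integral>\<^sup>+x. f x \<partial>unif) = 2 * (\<integral>\<^sup>+x. f x * indicator triangle x \<partial>lborel)"
    by (subst nn_integral_uniform_measure)
       (simp_all add: std_triangle_eq emeasure_triangle ennreal_divide_half del: ennreal_half)
  also have "(\<integral>\<^sup>+x. f x * indicator triangle x \<partial>lborel) = (\<integral>\<^sup>+x. f x \<partial>lborel)"
    by (rule nn_integral_cong) (use assms(2) in \<open>auto simp: indicator_def\<close>)
  finally show ?thesis .
qed

text \<open>
  The map \<open>to_triangle p\<close> takes the region beyond \<open>p\<close> to the triangle, up to a null set, with a constant
  Jacobian. Thus the image of a uniform point that is conditioned to lie beyond \<open>p\<close> is again uniform.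
\<close>

lemma emeasure_unif_beyond:
  assumes p: "p \<in> int_triangle" and A [measurable]: "A \<in> sets borel"
  shows "emeasure unif (beyond p \<inter> to_triangle p -` A) = ennreal (fst p * (1 - slope p)) * emeasure unif A"
proof -
  define x h where "x = fst p" and "h = slope p"
  have x: "0 < x" "x < 1" using p by (auto simp: x_def int_triangle_def)
  have h: "0 < h" "h < 1" using slope_int_triangle[OF p] by (auto simp: h_def)
  let ?B = "beyond p \<inter> to_triangle p -` A"
  have "to_triangle p -` A \<inter> space borel \<in> sets borel" by (rule measurable_sets[OF measurable_to_triangle A])
  hence B: "?B \<in> sets borel" by simp
  have "(x * a, h + (- x * h) * a + (1 - h) * b) \<in> ?B \<longleftrightarrow> (a, b) \<in> triangle \<inter> A \<and> b \<noteq> 0" for a b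
  proof -
    define u v where "u = x * a" and "v = h + (- x * h) * a + (1 - h) * b"
    have v: "v - h * (1 - u) = (1 - h) * b" by (simp add: u_def v_def algebra_simps)
    have ab: "to_triangle p (u, v) = (a, b)"
      using x h v by (simp add: to_triangle_def x_def[symmetric] h_def[symmetric]) (simp add: u_def)
    have "h * (1 - u) < v \<longleftrightarrow> 0 < (1 - h) * b" using v by linarith
    hence above_ray: "h * (1 - u) < v \<longleftrightarrow> b > 0" using h by (simp add: zero_less_mult_iff)
    have "(u, v) \<in> triangle" if "(a, b) \<in> triangle" "b > 0"
    proof -
      have a: "0 \<le> a" "a + b \<le> 1" using that by (auto simp: triangle_def)
      have "x * a \<le> 1 * 1" using x a that by (intro mult_mono) auto
      hence "0 \<le> h * (1 - u)" using h by (simp add: u_def)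
      with that above_ray have "0 \<le> v" by linarith
      moreover have "u + v \<le> 1"
      proof -
        have "(1 - h) * (x * a + b) \<le> (1 - h) * 1"
          using x a h that mult_right_mono[of x 1 a] by (intro mult_left_mono) auto
        thus ?thesis by (simp add: u_def v_def algebra_simps)
      qed
      ultimately show ?thesis using x a by (simp add: triangle_def u_def)
    qed
    moreover have "(u, v) \<in> ?B \<longleftrightarrow> (u, v) \<in> triangle \<and> b > 0 \<and> (a, b) \<in> triangle \<and> (a, b) \<in> A"
      unfolding beyond_def above_ray_def using ab above_ray by (auto simp: h_def)
    moreover have "(a, b) \<in> triangle \<Longrightarrow> b > 0 \<longleftrightarrow> b \<noteq> 0" by (auto simp: triangle_def)
    ultimately show ?thesis unfolding u_def v_def by blast
  qed
  hence eq: "{z. (x * fst z, h + (- x * h) * fst z + (1 - h) * snd z) \<in> ?B} = {z \<in> triangle \<inter> A. snd z \<noteq> 0}"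
    by auto
  have "emeasure unif ?B = 2 * emeasure lborel ?B"
    by (rule emeasure_unif[OF B]) (auto simp: beyond_def above_ray_def)
  also have "emeasure lborel ?B = ennreal (x * (1 - h)) * emeasure lborel {z \<in> triangle \<inter> A. snd z \<noteq> 0}"
    using emeasure_lborel_triangular_map[OF B, of x "1 - h" h "- x * h"] x h unfolding eq by simp
  also have "emeasure lborel {z \<in> triangle \<inter> A. snd z \<noteq> 0} = emeasure lborel (triangle \<inter> A)"
    by (rule emeasure_lborel_axis) simp
  also have "2 * (ennreal (x * (1 - h)) * emeasure lborel (triangle \<inter> A)) = ennreal (x * (1 - h)) * emeasure unif A"
    by (subst emeasure_unif_Int_triangle[symmetric], simp, subst emeasure_unif) (simp_all add: mult.left_commute)
  finally show ?thesis by (simp add: x_def h_def)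
qed

lemma emeasure_unif_above_ray:
  assumes h: "0 \<le> h" "h < 1"
  shows "emeasure unif (above_ray h) = ennreal (1 - h)"
proof -
  have "(1 * a, h + (- h) * a + (1 - h) * b) \<in> above_ray h \<longleftrightarrow> (a, b) \<in> triangle \<and> b \<noteq> 0" for a b
  proof -
    have v: "h + (- h) * a + (1 - h) * b - h * (1 - a) = (1 - h) * b" by (simp add: algebra_simps)
    hence "h * (1 - a) < h + (- h) * a + (1 - h) * b \<longleftrightarrow> 0 < (1 - h) * b" by linarith
    hence above_ray: "h * (1 - a) < h + (- h) * a + (1 - h) * b \<longleftrightarrow> b > 0" using h by (simp add: zero_less_mult_iff)
    have "a + (h + (- h) * a + (1 - h) * b) \<le> 1 \<longleftrightarrow> (1 - h) * (a + b) \<le> (1 - h) * 1"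
      by (simp add: algebra_simps)
    also have "\<dots> \<longleftrightarrow> a + b \<le> 1" using h by (subst mult_le_cancel_left_pos) auto
    finally have le: "a + (h + (- h) * a + (1 - h) * b) \<le> 1 \<longleftrightarrow> a + b \<le> 1" .
    have "0 \<le> h + (- h) * a + (1 - h) * b" if "a + b \<le> 1" "b > 0"
    proof -
      have "0 \<le> h * (1 - a)" using that h by (intro mult_nonneg_nonneg) auto
      with that above_ray show ?thesis by linarith
    qed
    thus ?thesis unfolding above_ray_def triangle_def using above_ray le by auto
  qed
  hence eq: "{z. (1 * fst z, h + (- h) * fst z + (1 - h) * snd z) \<in> above_ray h} = {z \<in> triangle. snd z \<noteq> 0}"
    by auto
  have "emeasure unif (above_ray h) = 2 * emeasure lborel (above_ray h)"
    by (rule emeasure_unif) (auto simp: above_ray_def)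
  also have "emeasure lborel (above_ray h) = ennreal (1 - h) * emeasure lborel {z \<in> triangle. snd z \<noteq> 0}"
    using emeasure_lborel_triangular_map[of "above_ray h" 1 "1 - h" h "- h"] h unfolding eq by simp
  also have "emeasure lborel {z \<in> triangle. snd z \<noteq> 0} = ennreal (1 / 2)"
    by (subst emeasure_lborel_axis) (simp_all add: emeasure_triangle del: ennreal_half)
  also have "2 * (ennreal (1 - h) * ennreal (1 / 2)) = ennreal (1 - h)"
    using h by (simp add: ennreal_mult[symmetric] ennreal_numeral[symmetric] del: ennreal_half ennreal_numeral)
  finally show ?thesis .
qed

lemma emeasure_unif_above_ray_diff_beyond:
  assumes p: "p \<in> int_triangle"
  shows "emeasure unif (above_ray (slope p) - beyond p) = ennreal ((1 - fst p) * (1 - slope p))"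
proof -
  have h: "0 < slope p" "slope p < 1" using slope_int_triangle[OF p] by auto
  have x: "0 < fst p" "fst p < 1" using p by (auto simp: int_triangle_def)
  interpret prob_space unif by (rule prob_space_unif)
  have "emeasure unif (beyond p) = ennreal (fst p * (1 - slope p)) * emeasure unif UNIV"
    using emeasure_unif_beyond[OF p, of UNIV] by simp
  also have "emeasure unif UNIV = 1" using emeasure_space_1 by simp
  finally have b: "emeasure unif (beyond p) = ennreal (fst p * (1 - slope p))" by simp
  have "emeasure unif (above_ray (slope p) - beyond p) = emeasure unif (above_ray (slope p)) - emeasure unif (beyond p)"
    by (rule emeasure_Diff) (auto simp: b beyond_def)
  also have "\<dots> = ennreal (1 - slope p - fst p * (1 - slope p))"
    using h x by (simp add: b emeasure_unif_above_ray ennreal_minus)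
  finally show ?thesis by (simp add: algebra_simps)
qed

section \<open>The recursion for the number of vertices\<close>

abbreviation sample :: "nat set \<Rightarrow> (nat \<Rightarrow> real \<times> real) measure" where
  "sample J \<equiv> Pi\<^sub>M J (\<lambda>_. unif)"

interpretation unif: prob_space unif by (rule prob_space_unif)
interpretation unifs: product_sigma_finite "\<lambda>_::nat. unif" by unfold_locales

text \<open>
  A property of a single uniform point carries over to independent samples because the pushed forward and
  rescaled measure agrees with the product measure on boxes.
\<close>

lemma emeasure_PiM_rescale:
  assumes fin: "finite I" and T [measurable]: "T \<in> borel_measurable borel" and B [measurable]: "B \<in> sets borel"
    and c: "c > 0" and scale: "\<And>A. A \<in> sets borel \<Longrightarrow> emeasure unif (B \<inter> T -` A) = ennreal c * emeasure unif A"
    and Q: "Q \<in> sets (sample I)"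
  shows "emeasure (sample I) {y \<in> space (sample I). (\<forall>i\<in>I. y i \<in> B) \<and> (\<lambda>i\<in>I. T (y i)) \<in> Q} = ennreal c ^ card I * emeasure (sample I) Q"
proof -
  define S where "S = (\<lambda>y. \<lambda>i\<in>I. T (y i))"
  have S [measurable]: "S \<in> measurable (sample I) (sample I)" unfolding S_def by measurable
  have PB: "Pi\<^sub>E I (\<lambda>_. B) \<in> sets (sample I)" by (rule sets_PiM_I_finite[OF fin]) simp
  define D where "D = distr (density (sample I) (indicator (Pi\<^sub>E I (\<lambda>_. B)))) (sample I) S"
  have D: "emeasure D A = emeasure (sample I) (Pi\<^sub>E I (\<lambda>_. B) \<inter> (S -` A \<inter> space (sample I)))" if "A \<in> sets (sample I)" for A
  proof -
    have "emeasure D A = emeasure (density (sample I) (indicator (Pi\<^sub>E I (\<lambda>_. B)))) (S -` A \<inter> space (sample I))"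
      unfolding D_def using that by (subst emeasure_distr) simp_all
    also have "\<dots> = emeasure (sample I) (Pi\<^sub>E I (\<lambda>_. B) \<inter> (S -` A \<inter> space (sample I)))"
      by (rule emeasure_restricted[OF PB measurable_sets[OF S that]])
    finally show ?thesis .
  qed
  have c0: "ennreal c ^ card I \<noteq> 0" "ennreal c ^ card I \<noteq> \<infinity>"
    using c by (simp_all add: ennreal_power)
  have inv: "ennreal c ^ card I * inverse (ennreal c ^ card I) = 1" using c0
    by (simp only: divide_ennreal_def[symmetric]) (simp add: ennreal_divide_self less_top)
  have "scale_measure (inverse (ennreal c ^ card I)) D = sample I"
  proof (rule unifs.PiM_eqI[OF fin])
    show "sets (scale_measure (inverse (ennreal c ^ card I)) D) = sets (sample I)" by (simp add: D_def)
    fix A assume A: "\<And>i. i \<in> I \<Longrightarrow> A i \<in> sets unif"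
    have TA: "T -` A i \<in> sets borel" if "i \<in> I" for i
      using measurable_sets[OF T, of "A i"] A[OF that] by simp
    have "emeasure D (Pi\<^sub>E I A) = emeasure (sample I) (Pi\<^sub>E I (\<lambda>_. B) \<inter> (S -` Pi\<^sub>E I A \<inter> space (sample I)))"
      by (intro D sets_PiM_I_finite[OF fin] A)
    also have "Pi\<^sub>E I (\<lambda>_. B) \<inter> (S -` Pi\<^sub>E I A \<inter> space (sample I)) = Pi\<^sub>E I (\<lambda>i. B \<inter> T -` A i)"
      by (auto simp: S_def space_PiM PiE_def Pi_def)
    also have "emeasure (sample I) \<dots> = (\<Prod>i\<in>I. emeasure unif (B \<inter> T -` A i))"
      using TA by (intro unifs.emeasure_PiM[OF fin]) auto
    also have "\<dots> = (\<Prod>i\<in>I. ennreal c * emeasure unif (A i))"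
      using A by (intro prod.cong refl scale) simp
    also have "\<dots> = ennreal c ^ card I * (\<Prod>i\<in>I. emeasure unif (A i))"
      by (simp only: prod.distrib prod_constant)
    finally have "emeasure (scale_measure (inverse (ennreal c ^ card I)) D) (Pi\<^sub>E I A) =
        inverse (ennreal c ^ card I) * (ennreal c ^ card I * (\<Prod>i\<in>I. emeasure unif (A i)))"
      by (simp only: emeasure_scale_measure)
    also have "\<dots> = (ennreal c ^ card I * inverse (ennreal c ^ card I)) * (\<Prod>i\<in>I. emeasure unif (A i))"
      by (simp only: mult_ac)
    finally show "emeasure (scale_measure (inverse (ennreal c ^ card I)) D) (Pi\<^sub>E I A) = (\<Prod>i\<in>I. emeasure unif (A i))"
      by (simp only: inv mult_1)
  qed
  hence "emeasure (sample I) Q = inverse (ennreal c ^ card I) * emeasure D Q"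
    using emeasure_scale_measure[of "inverse (ennreal c ^ card I)" D Q] by simp
  hence "ennreal c ^ card I * emeasure (sample I) Q = (ennreal c ^ card I * inverse (ennreal c ^ card I)) * emeasure D Q"
    by (simp only: mult.assoc)
  also note inv
  also have "1 * emeasure D Q = emeasure (sample I) (Pi\<^sub>E I (\<lambda>_. B) \<inter> (S -` Q \<inter> space (sample I)))"
    by (simp only: D[OF Q] mult_1)
  also have "Pi\<^sub>E I (\<lambda>_. B) \<inter> (S -` Q \<inter> space (sample I)) = {y \<in> space (sample I). (\<forall>i\<in>I. y i \<in> B) \<and> (\<lambda>i\<in>I. T (y i)) \<in> Q}"
    by (auto simp: S_def space_PiM PiE_def Pi_def)
  finally show ?thesis ..
qed

definition hull_size :: "(real \<times> real) set \<Rightarrow> nat" where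
  "hull_size S = f0 (convex hull (chain S))"

lemma measurable_hull_size [measurable]:
  fixes x :: "nat \<Rightarrow> 'a \<Rightarrow> real \<times> real"
  assumes "finite J" "\<And>i. i \<in> J \<Longrightarrow> x i \<in> borel_measurable M"
  shows "(\<lambda>\<omega>. hull_size ((\<lambda>i. x i \<omega>) ` J)) \<in> measurable M (count_space UNIV)"
  unfolding hull_size_def by (rule measurable_f0_chain[OF assms])

text \<open>
  Decompose by the set \<open>I\<close> of indices whose points lie beyond \<open>p\<close>. The other points contribute just a
  factor, and the images of the points with index in \<open>I\<close> are again an independent uniform sample.
\<close>

lemma emeasure_thinning:
  assumes fin: "finite J" and p: "p \<in> int_triangle"
  shows "emeasure (sample J) {y \<in> space (sample J). (\<forall>j\<in>J. y j \<in> above_ray (slope p)) \<and> hull_size (to_triangle p ` (y ` J \<inter> beyond p)) = m}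
     = (\<Sum>I\<in>Pow J. ennreal (fst p * (1 - slope p)) ^ card I * ennreal ((1 - fst p) * (1 - slope p)) ^ card (J - I)
          * emeasure (sample I) {y \<in> space (sample I). hull_size (y ` I) = m})"
proof -
  have h: "0 < slope p" "slope p < 1" using slope_int_triangle[OF p] by auto
  have x: "0 < fst p" "fst p < 1" using p by (auto simp: int_triangle_def)
  define Q where "Q I = {y \<in> space (sample I). hull_size (y ` I) = m}" for I
  have QS: "Q I \<in> sets (sample I)" if "finite I" for I
    unfolding Q_def using that by measurable
  define A where "A I = {y \<in> space (sample I). (\<forall>j\<in>I. y j \<in> beyond p) \<and> (\<lambda>j\<in>I. to_triangle p (y j)) \<in> Q I}" for I
  have AS: "A I \<in> sets (sample I)" if "finite I" for I
  proof -
    have "(\<lambda>y. \<lambda>j\<in>I. to_triangle p (y j)) -` Q I \<inter> space (sample I) \<in> sets (sample I)"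
      by (rule measurable_sets[OF _ QS[OF that]]) measurable
    moreover have "Pi\<^sub>E I (\<lambda>_. beyond p) \<in> sets (sample I)" by (rule sets_PiM_I_finite[OF that]) simp
    moreover have "A I = Pi\<^sub>E I (\<lambda>_. beyond p) \<inter> ((\<lambda>y. \<lambda>j\<in>I. to_triangle p (y j)) -` Q I \<inter> space (sample I))"
      by (auto simp: A_def space_PiM PiE_def Pi_def)
    ultimately show ?thesis by auto
  qed
  define C where "C I = Pi\<^sub>E I (\<lambda>_. above_ray (slope p) - beyond p)" for I :: "nat set"
  have CS: "C I \<in> sets (sample I)" if "finite I" for I
    unfolding C_def by (rule sets_PiM_I_finite[OF that]) simp
  define E where "E I = {y \<in> space (sample J). restrict y I \<in> A I \<and> restrict y (J - I) \<in> C (J - I)}" for I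
  have ES: "E I \<in> sets (sample J)" if "I \<subseteq> J" for I
  proof -
    have finI: "finite I" "finite (J - I)" using that fin finite_subset by auto
    have "(\<lambda>y. restrict y I) -` A I \<inter> space (sample J) \<in> sets (sample J)"
      by (rule measurable_sets[OF measurable_restrict_subset[OF that] AS[OF finI(1)]])
    moreover have "(\<lambda>y. restrict y (J - I)) -` C (J - I) \<inter> space (sample J) \<in> sets (sample J)"
      by (rule measurable_sets[OF measurable_restrict_subset[OF Diff_subset] CS[OF finI(2)]])
    moreover have "E I = ((\<lambda>y. restrict y I) -` A I \<inter> space (sample J)) \<inter> ((\<lambda>y. restrict y (J - I)) -` C (J - I) \<inter> space (sample J))"
      by (auto simp: E_def)
    ultimately show ?thesis by auto
  qed
  have emE: "emeasure (sample J) (E I) = ennreal (fst p * (1 - slope p)) ^ card I * ennreal ((1 - fst p) * (1 - slope p)) ^ card (J - I)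
          * emeasure (sample I) (Q I)" if "I \<subseteq> J" for I
  proof -
    have finI: "finite I" "finite (J - I)" using that fin finite_subset by auto
    have IJ: "I \<union> (J - I) = J" using that by auto
    have "emeasure (sample J) (E I) = emeasure (distr (sample I \<Otimes>\<^sub>M sample (J - I)) (sample (I \<union> (J - I))) (merge I (J - I))) (E I)"
      using unifs.distr_merge[of I "J - I"] finI IJ by simp
    also have "\<dots> = emeasure (sample I \<Otimes>\<^sub>M sample (J - I)) (merge I (J - I) -` E I \<inter> space (sample I \<Otimes>\<^sub>M sample (J - I)))"
      using ES[OF that] IJ by (intro emeasure_distr measurable_merge) simp
    also have "merge I (J - I) -` E I \<inter> space (sample I \<Otimes>\<^sub>M sample (J - I)) = A I \<times> C (J - I)"
    proof -
      have "merge I (J - I) (a, b) \<in> E I \<longleftrightarrow> a \<in> A I \<and> b \<in> C (J - I)"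
        if ab: "a \<in> space (sample I)" "b \<in> space (sample (J - I))" for a b
      proof -
        have "restrict (merge I (J - I) (a, b)) I = a" "restrict (merge I (J - I) (a, b)) (J - I) = b"
          using ab by (simp_all add: space_PiM PiE_restrict)
        moreover have "merge I (J - I) (a, b) \<in> space (sample J)"
          using ab IJ by (auto simp: space_PiM PiE_def Pi_def extensional_def merge_def)
        ultimately show ?thesis by (simp add: E_def)
      qed
      moreover have "A I \<subseteq> space (sample I)" "C (J - I) \<subseteq> space (sample (J - I))"
        by (rule sets.sets_into_space[OF AS[OF finI(1)]], rule sets.sets_into_space[OF CS[OF finI(2)]])
      ultimately show ?thesis unfolding space_pair_measure by blast
    qed
    also have "emeasure (sample I \<Otimes>\<^sub>M sample (J - I)) (A I \<times> C (J - I)) = emeasure (sample I) (A I) * emeasure (sample (J - I)) (C (J - I))"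
    proof -
      interpret K: prob_space "sample (J - I)" by (rule prob_space_PiM) (rule prob_space_unif)
      show ?thesis by (rule K.emeasure_pair_measure_Times[OF AS[OF finI(1)] CS[OF finI(2)]])
    qed
    also have "emeasure (sample (J - I)) (C (J - I)) = ennreal ((1 - fst p) * (1 - slope p)) ^ card (J - I)"
      unfolding C_def by (subst unifs.emeasure_PiM[OF finI(2)]) (simp_all add: emeasure_unif_above_ray_diff_beyond[OF p])
    also have "emeasure (sample I) (A I) = ennreal (fst p * (1 - slope p)) ^ card I * emeasure (sample I) (Q I)"
      unfolding A_def using h x
      by (intro emeasure_PiM_rescale[OF finI(1) _ _ _ _ QS[OF finI(1)]] emeasure_unif_beyond[OF p]) auto
    finally show ?thesis by (simp add: mult_ac)
  qed
  have inE: "y \<in> E I \<longleftrightarrow> y \<in> space (sample J) \<and> (\<forall>j\<in>I. y j \<in> beyond p) \<and> (\<forall>j\<in>J - I. y j \<in> above_ray (slope p) - beyond p)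
              \<and> hull_size (to_triangle p ` (y ` I)) = m" if "I \<subseteq> J" for I y
  proof -
    have "(\<lambda>j. if j \<in> I then to_triangle p (y j) else undefined) ` I = to_triangle p ` y ` I" by (auto simp: image_image)
    thus ?thesis using that by (auto simp: E_def A_def C_def Q_def space_PiM PiE_def Pi_def restrict_def extensional_def)
  qed
  have "{y \<in> space (sample J). (\<forall>j\<in>J. y j \<in> above_ray (slope p)) \<and> hull_size (to_triangle p ` (y ` J \<inter> beyond p)) = m} = (\<Union>I\<in>Pow J. E I)"
  proof (intro equalityI subsetI)
    fix y assume y: "y \<in> {y \<in> space (sample J). (\<forall>j\<in>J. y j \<in> above_ray (slope p)) \<and> hull_size (to_triangle p ` (y ` J \<inter> beyond p)) = m}"
    define I where "I = {j \<in> J. y j \<in> beyond p}"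
    have "y ` I = y ` J \<inter> beyond p" by (auto simp: I_def)
    hence "y \<in> E I" using y by (subst inE) (auto simp: I_def)
    thus "y \<in> (\<Union>I\<in>Pow J. E I)" by (auto simp: I_def)
  next
    fix y assume "y \<in> (\<Union>I\<in>Pow J. E I)"
    then obtain I where I: "I \<subseteq> J" "y \<in> E I" by auto
    hence "y ` I = y ` J \<inter> beyond p" using inE[OF I(1)] by blast
    thus "y \<in> {y \<in> space (sample J). (\<forall>j\<in>J. y j \<in> above_ray (slope p)) \<and> hull_size (to_triangle p ` (y ` J \<inter> beyond p)) = m}"
      using I inE[OF I(1), of y] by (auto simp: beyond_def)
  qed
  also have "emeasure (sample J) \<dots> = (\<Sum>I\<in>Pow J. emeasure (sample J) (E I))"
  proof (rule sum_emeasure[symmetric])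
    show "disjoint_family_on E (Pow J)"
    proof (unfold disjoint_family_on_def, intro ballI impI)
      fix I I' assume I: "I \<in> Pow J" "I' \<in> Pow J" "I \<noteq> I'"
      have "I = {j \<in> J. y j \<in> beyond p}" if "y \<in> E I" "I \<in> Pow J" for I y
        using inE[of I y] that by auto
      thus "E I \<inter> E I' = {}" using I by blast
    qed
  qed (use ES fin in auto)
  also have "\<dots> = (\<Sum>I\<in>Pow J. ennreal (fst p * (1 - slope p)) ^ card I * ennreal ((1 - fst p) * (1 - slope p)) ^ card (J - I)
          * emeasure (sample I) (Q I))"
    by (intro sum.cong refl emE) auto
  finally show ?thesis unfolding Q_def .
qed


text \<open>
  Because of the strict inequalities the events for different \<open>i\<close> are disjoint. Ties and boundary points are
  left out, but this loses only a null set, as the probabilities in \<open>emeasure_first_vertex\<close> show.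
\<close>

abbreviation first_point :: "nat \<Rightarrow> nat set \<Rightarrow> (nat \<Rightarrow> real \<times> real) \<Rightarrow> bool" where
  "first_point i J y \<equiv> y i \<in> int_triangle \<and> (\<forall>j\<in>J. y j \<in> above_ray (slope (y i)))"

text \<open>
  Here \<open>y i\<close> is the vertex that follows \<open>(1, 0)\<close>. Fubini's theorem singles out this point, and the peeling
  step rewrites the number of vertices for each of its values.
\<close>

lemma emeasure_sample_insert_first:
  assumes fin: "finite J" and i: "i \<notin> J"
  shows "emeasure (sample (insert i J)) {y \<in> space (sample (insert i J)). first_point i J y \<and> hull_size (y ` insert i J) \<in> A}
     = (\<integral>\<^sup>+p. indicator int_triangle p * emeasure (sample J) {y \<in> space (sample J). (\<forall>j\<in>J. y j \<in> above_ray (slope p)) \<and>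
          Suc (hull_size (to_triangle p ` (y ` J \<inter> beyond p))) \<in> A} \<partial>unif)"
proof -
  let ?E = "{y \<in> space (sample (insert i J)). first_point i J y \<and> hull_size (y ` insert i J) \<in> A}"
  have comp: "(\<lambda>y. y l) \<in> borel_measurable (sample (insert i J))" if "l \<in> insert i J" for l
    using measurable_component_singleton[OF that, of "\<lambda>_. unif"] by (simp cong: measurable_cong_sets)
  have [measurable]: "Measurable.pred (sample (insert i J)) (\<lambda>y. y i \<in> int_triangle)"
    using measurable_sets[OF comp[of i] sets_triangle(2)] by (simp add: pred_def vimage_def Int_def conj_commute)
  have [measurable]: "(\<lambda>y. hull_size (y ` insert i J)) \<in> measurable (sample (insert i J)) (count_space UNIV)"
    by (rule measurable_hull_size) (use fin comp in auto)
  have [measurable]: "Measurable.pred (sample (insert i J)) (\<lambda>y. y j \<in> above_ray (slope (y i)))" if "j \<in> J" for j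
  proof -
    have eq: "y j \<in> above_ray (slope (y i)) \<longleftrightarrow> y j \<in> triangle \<and> slope (y i) * (1 - fst (y j)) < snd (y j)" for y
      by (auto simp: above_ray_def case_prod_beta)
    have "(\<lambda>y. y j) \<in> borel_measurable (sample (insert i J))" "(\<lambda>y. y i) \<in> borel_measurable (sample (insert i J))"
      using that comp by blast+
    note [measurable] = this measurable_compose[OF this(1) borel_measurable_fst_snd(1)]
      measurable_compose[OF this(1) borel_measurable_fst_snd(2)] measurable_compose[OF this(2) measurable_slope]
    have "Measurable.pred (sample (insert i J)) (\<lambda>y. y j \<in> triangle \<and> slope (y i) * (1 - fst (y j)) < snd (y j))"
      by measurable
    thus ?thesis by (simp add: eq)
  qed
  have E [measurable]: "?E \<in> sets (sample (insert i J))" using fin by measurable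
  have "emeasure (sample (insert i J)) ?E = (\<integral>\<^sup>+y. indicator ?E y \<partial>sample (insert i J))"
    by (rule nn_integral_indicator[OF E, symmetric])
  also have "\<dots> = (\<integral>\<^sup>+p. (\<integral>\<^sup>+y. indicator ?E (y(i := p)) \<partial>sample J) \<partial>unif)"
    by (rule unifs.product_nn_integral_insert_rev[OF fin i]) (rule borel_measurable_indicator[OF E])
  also have "\<dots> = (\<integral>\<^sup>+p. indicator int_triangle p * emeasure (sample J) {y \<in> space (sample J). (\<forall>j\<in>J. y j \<in> above_ray (slope p)) \<and>
          Suc (hull_size (to_triangle p ` (y ` J \<inter> beyond p))) \<in> A} \<partial>unif)"
  proof (rule nn_integral_cong)
    fix p :: "real \<times> real"
    let ?S = "{y \<in> space (sample J). (\<forall>j\<in>J. y j \<in> above_ray (slope p)) \<and> Suc (hull_size (to_triangle p ` (y ` J \<inter> beyond p))) \<in> A}"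
    have upd: "y(i := p) \<in> ?E \<longleftrightarrow> p \<in> int_triangle \<and> y \<in> ?S" if y: "y \<in> space (sample J)" for y
    proof -
      have 1: "(y(i := p)) ` insert i J = insert p (y ` J)" using i by auto
      have 2: "y(i := p) \<in> space (sample (insert i J))" using y i by (auto simp: space_PiM PiE_def extensional_def)
      have 3: "(\<forall>j\<in>J. (y(i := p)) j \<in> above_ray (slope ((y(i := p)) i))) \<longleftrightarrow> (\<forall>j\<in>J. y j \<in> above_ray (slope p))"
        using i by auto
      have 4: "hull_size (insert p (y ` J)) = Suc (hull_size (to_triangle p ` (y ` J \<inter> beyond p)))"
        if "p \<in> int_triangle" "\<forall>j\<in>J. y j \<in> above_ray (slope p)"
        unfolding hull_size_def using that fin by (intro f0_chain_step) auto
      show ?thesis unfolding mem_Collect_eq 1 3 using y 2 4 by (metis fun_upd_same)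
    qed
    show "(\<integral>\<^sup>+y. indicator ?E (y(i := p)) \<partial>sample J) = indicator int_triangle p * emeasure (sample J) ?S"
    proof (cases "p \<in> int_triangle")
      case True
      have "p \<in> space unif" by simp
      hence "(\<lambda>y. y(i := p)) -` ?E \<inter> space (sample J) \<in> sets (sample J)"
        by (intro measurable_sets[OF _ E]) measurable
      also have "(\<lambda>y. y(i := p)) -` ?E \<inter> space (sample J) = ?S" using upd True by blast
      finally have "?S \<in> sets (sample J)" .
      moreover have "(\<integral>\<^sup>+y. indicator ?E (y(i := p)) \<partial>sample J) = (\<integral>\<^sup>+y. indicator ?S y \<partial>sample J)"
        using upd True by (intro nn_integral_cong) (simp add: indicator_def)
      ultimately show ?thesis using True by simp
    next
      case False
      have "(\<integral>\<^sup>+y. indicator ?E (y(i := p)) \<partial>sample J) = (\<integral>\<^sup>+y. 0 \<partial>sample J)"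
        using upd False by (intro nn_integral_cong) (simp add: indicator_def)
      thus ?thesis using False by simp
    qed
  qed
  finally show ?thesis .
qed

lemma nn_integral_unif_strip:
  "(\<integral>\<^sup>+p. indicator int_triangle p * ennreal (fst p ^ a * (1 - fst p) ^ b * (1 - slope p) ^ N) \<partial>unif)
     = ennreal (2 / (N + 1) * (fact a * fact (b + 1) / fact (a + b + 2)))"
proof -
  let ?f = "\<lambda>p. indicator int_triangle p * ennreal (fst p ^ a * (1 - fst p) ^ b * (1 - slope p) ^ N)"
  have sub: "p \<in> int_triangle \<Longrightarrow> p \<in> triangle" for p by (auto simp: triangle_def int_triangle_def)
  have "(\<integral>\<^sup>+p. ?f p \<partial>unif) = 2 * (\<integral>\<^sup>+p. ?f p \<partial>lborel)"
  proof (rule nn_integral_unif)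
    show "?f p = 0" if "p \<notin> triangle" for p
    proof -
      have "p \<notin> int_triangle" using that sub by blast
      thus ?thesis by simp
    qed
  qed measurable
  also have "\<dots> = ennreal 2 * ennreal (1 / (N + 1) * (fact a * fact (b + 1) / fact (a + b + 2)))"
    by (subst nn_integral_lborel_strip) (simp add: add_ac)
  also have "\<dots> = ennreal (2 * (1 / (N + 1) * (fact a * fact (b + 1) / fact (a + b + 2))))"
    by (rule ennreal_mult[symmetric]) auto
  finally show ?thesis by simp
qed

text \<open>
  The summation index \<open>m\<close> stands for the number of points beyond the vertex that follows \<open>(1, 0)\<close>.
  For \<open>n = 0\<close> the sum is empty and the value is \<open>0\<close>.
\<close>

primrec chain_prob :: "nat \<Rightarrow> nat \<Rightarrow> real" where
  "chain_prob 0 n = (if n = 0 then 1 else 0)"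
| "chain_prob (Suc k) n = 2 / (real n * (real n + 1)) * (\<Sum>m<n. (real n - real m) * chain_prob k m)"

lemma chain_prob_nonneg: "chain_prob k n \<ge> 0"
  by (induction k arbitrary: n) (auto intro!: mult_nonneg_nonneg sum_nonneg divide_nonneg_nonneg)

lemma sum_Pow_card:
  fixes f :: "nat \<Rightarrow> real"
  assumes "finite J"
  shows "(\<Sum>I\<in>Pow J. f (card I)) = (\<Sum>m\<le>card J. real (card J choose m) * f m)"
proof -
  have "(\<Sum>I\<in>Pow J. f (card I)) = (\<Sum>m\<in>{..card J}. \<Sum>I | I \<in> Pow J \<and> card I = m. f (card I))"
    using assms by (intro sum.group[symmetric]) (auto intro: card_mono)
  also have "\<dots> = (\<Sum>m\<le>card J. real (card J choose m) * f m)"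
  proof (rule sum.cong)
    fix m
    have "(\<Sum>I | I \<in> Pow J \<and> card I = m. f (card I)) = (\<Sum>I | I \<subseteq> J \<and> card I = m. f m)"
      by (rule sum.cong) auto
    thus "(\<Sum>I | I \<in> Pow J \<and> card I = m. f (card I)) = real (card J choose m) * f m"
      by (simp add: n_subsets[OF assms])
  qed simp
  finally show ?thesis .
qed

text \<open>
  Given that \<open>m\<close> of the \<open>N\<close> remaining points lie beyond \<open>p\<close>, the integral over \<open>p\<close> is a Beta integral,
  and its factorials cancel against the \<open>N choose m\<close> choices of these points.
\<close>

lemma emeasure_first_vertex_count:
  assumes fin: "finite J" and i: "i \<notin> J"
    and IH: "\<And>I. I \<subseteq> J \<Longrightarrow> emeasure (sample I) {y \<in> space (sample I). hull_size (y ` I) = k + 2} = ennreal (chain_prob k (card I))"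
  shows "emeasure (sample (insert i J)) {y \<in> space (sample (insert i J)). first_point i J y \<and> hull_size (y ` insert i J) = Suc k + 2}
     = ennreal (chain_prob (Suc k) (Suc (card J)) / Suc (card J))"
proof -
  define N where "N = card J"
  let ?w = "\<lambda>I p. indicator int_triangle p * ennreal (fst p ^ card I * (1 - fst p) ^ (N - card I) * (1 - slope p) ^ N)"
  let ?g = "\<lambda>p. indicator int_triangle p * emeasure (sample J) {y \<in> space (sample J). (\<forall>j\<in>J. y j \<in> above_ray (slope p)) \<and>
          hull_size (to_triangle p ` (y ` J \<inter> beyond p)) = k + 2}"
  let ?q = "\<lambda>m. 2 / (N + 1) * (fact m * fact (N - m + 1) / fact (N + 2))"
  have cardI: "card I \<le> N" "card (J - I) = N - card I" if "I \<subseteq> J" for I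
    using that fin finite_subset[OF that fin] by (auto simp: N_def card_mono card_Diff_subset)
  have "emeasure (sample (insert i J)) {y \<in> space (sample (insert i J)). first_point i J y \<and> hull_size (y ` insert i J) = Suc k + 2}
     = (\<integral>\<^sup>+p. ?g p \<partial>unif)"
    using emeasure_sample_insert_first[OF fin i, of "{Suc k + 2}"] by simp
  also have "\<dots> = (\<integral>\<^sup>+p. (\<Sum>I\<in>Pow J. ennreal (chain_prob k (card I)) * ?w I p) \<partial>unif)"
  proof (rule nn_integral_cong)
    fix p
    show "?g p =
      (\<Sum>I\<in>Pow J. ennreal (chain_prob k (card I)) * ?w I p)"
    proof (cases "p \<in> int_triangle")
      case True
      have h: "0 < slope p" "slope p < 1" using slope_int_triangle[OF True] by auto
      have x: "0 < fst p" "fst p < 1" using True by (auto simp: int_triangle_def)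
      have "ennreal (fst p * (1 - slope p)) ^ card I * ennreal ((1 - fst p) * (1 - slope p)) ^ card (J - I) * emeasure (sample I) {y \<in> space (sample I). hull_size (y ` I) = k + 2}
         = ennreal (chain_prob k (card I)) * ennreal (fst p ^ card I * (1 - fst p) ^ (N - card I) * (1 - slope p) ^ N)"
        if "I \<subseteq> J" for I
      proof -
        have "(1 - slope p) ^ card I * (1 - slope p) ^ (N - card I) = (1 - slope p) ^ N"
          using cardI[OF that] by (simp add: power_add[symmetric])
        hence "(fst p * (1 - slope p)) ^ card I * ((1 - fst p) * (1 - slope p)) ^ (N - card I) = fst p ^ card I * (1 - fst p) ^ (N - card I) * (1 - slope p) ^ N"
          by (simp add: power_mult_distrib mult_ac)
        moreover have "ennreal (fst p * (1 - slope p)) ^ card I * ennreal ((1 - fst p) * (1 - slope p)) ^ card (J - I) =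
            ennreal ((fst p * (1 - slope p)) ^ card I * ((1 - fst p) * (1 - slope p)) ^ (N - card I))"
          unfolding cardI(2)[OF that] using h x
          by (subst (1 2) ennreal_power) (auto intro!: ennreal_mult[symmetric])
        ultimately show ?thesis unfolding IH[OF that] by (simp only: mult.commute)
      qed
      thus ?thesis using True by (simp add: emeasure_thinning[OF fin True])
    qed simp
  qed
  also have "\<dots> = (\<Sum>I\<in>Pow J. \<integral>\<^sup>+p. ennreal (chain_prob k (card I)) * ?w I p \<partial>unif)"
    by (rule nn_integral_sum) measurable
  also have "\<dots> = (\<Sum>I\<in>Pow J. ennreal (chain_prob k (card I) * ?q (card I)))"
  proof (rule sum.cong)
    fix I assume "I \<in> Pow J"
    hence *: "card I + (N - card I) + 2 = N + 2" using cardI by auto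
    show "(\<integral>\<^sup>+p. ennreal (chain_prob k (card I)) * ?w I p \<partial>unif)
      = ennreal (chain_prob k (card I) * ?q (card I))"
      by (subst nn_integral_cmult, measurable, subst nn_integral_unif_strip)
         (simp only: *, subst ennreal_mult[symmetric], simp_all add: chain_prob_nonneg)
  qed simp
  also have "\<dots> = ennreal (\<Sum>I\<in>Pow J. chain_prob k (card I) * ?q (card I))"
    by (rule sum_ennreal) (auto intro!: mult_nonneg_nonneg chain_prob_nonneg divide_nonneg_nonneg)
  also have "(\<Sum>I\<in>Pow J. chain_prob k (card I) * ?q (card I))
      = (\<Sum>m\<le>N. real (N choose m) * (chain_prob k m * ?q m))"
    unfolding N_def by (rule sum_Pow_card[OF fin])
  also have "\<dots> = (\<Sum>m<Suc N. 2 / ((real N + 1)\<^sup>2 * (real N + 2)) * ((real (Suc N) - real m) * chain_prob k m))"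
  proof (rule sum.cong)
    fix m assume "m \<in> {..<Suc N}"
    hence m: "m \<le> N" by simp
    have f: "fact (N - m + 1) = (real N - real m + 1) * fact (N - m)" using m by (simp add: of_nat_diff)
    have c: "real (N choose m) = fact N / (fact m * fact (N - m))" by (rule binomial_fact[OF m])
    have g: "fact (N + 2) = (real N + 2) * ((real N + 1) * fact N)" by (simp add: numeral_2_eq_2 algebra_simps)
    show "real (N choose m) * (chain_prob k m * ?q m) =
      2 / ((real N + 1)\<^sup>2 * (real N + 2)) * ((real (Suc N) - real m) * chain_prob k m)"
      unfolding c f g by (simp add: divide_simps power2_eq_square) (simp add: algebra_simps)
  qed auto
  also have "\<dots> = chain_prob (Suc k) (Suc N) / Suc N"
  proof -
    define S where "S = (\<Sum>m<Suc N. (real (Suc N) - real m) * chain_prob k m)"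
    have "2 / ((real N + 1)\<^sup>2 * (real N + 2)) * S = 2 / (real (Suc N) * (real (Suc N) + 1)) * S / Suc N"
      by (simp add: power2_eq_square divide_simps) (simp add: algebra_simps)
    thus ?thesis unfolding chain_prob.simps S_def sum_distrib_left .
  qed
  finally show ?thesis by (simp add: N_def)
qed

text \<open>
  Given the point \<open>p\<close> with index \<open>i\<close>, each other point lies above the ray with probability \<open>1 - slope p\<close>. Since
  these probabilities add up to one over all \<open>i\<close>, ties are negligible.
\<close>

lemma emeasure_first_vertex:
  assumes fin: "finite J" and i: "i \<notin> J"
  shows "emeasure (sample (insert i J)) {y \<in> space (sample (insert i J)). first_point i J y}
     = ennreal (1 / Suc (card J))"
proof -
  have "emeasure (sample (insert i J)) {y \<in> space (sample (insert i J)). first_point i J y}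
     = (\<integral>\<^sup>+p. indicator int_triangle p * emeasure (sample J) {y \<in> space (sample J). \<forall>j\<in>J. y j \<in> above_ray (slope p)} \<partial>unif)"
    using emeasure_sample_insert_first[OF fin i, of UNIV] by simp
  also have "\<dots> = (\<integral>\<^sup>+p. indicator int_triangle p * ennreal (fst p ^ 0 * (1 - fst p) ^ 0 * (1 - slope p) ^ card J) \<partial>unif)"
  proof (rule nn_integral_cong)
    fix p
    show "indicator int_triangle p * emeasure (sample J) {y \<in> space (sample J). \<forall>j\<in>J. y j \<in> above_ray (slope p)} =
      indicator int_triangle p * ennreal (fst p ^ 0 * (1 - fst p) ^ 0 * (1 - slope p) ^ card J)"
    proof (cases "p \<in> int_triangle")
      case True
      have h: "0 < slope p" "slope p < 1" using slope_int_triangle[OF True] by auto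
      have "{y \<in> space (sample J). \<forall>j\<in>J. y j \<in> above_ray (slope p)} = Pi\<^sub>E J (\<lambda>_. above_ray (slope p))"
        by (auto simp: space_PiM PiE_def Pi_def)
      hence "emeasure (sample J) {y \<in> space (sample J). \<forall>j\<in>J. y j \<in> above_ray (slope p)} = (\<Prod>j\<in>J. ennreal (1 - slope p))"
        using h emeasure_unif_above_ray[of "slope p"] by (simp only: unifs.emeasure_PiM[OF fin sets_above_ray[folded sets_unif]] less_imp_le)
      thus ?thesis using h by (simp add: ennreal_power)
    qed simp
  qed
  also have "\<dots> = ennreal (1 / Suc (card J))"
    by (subst nn_integral_unif_strip) (simp add: numeral_2_eq_2 divide_simps)
  finally show ?thesis .
qed

lemma emeasure_first_vertex_only_corners:
  assumes fin: "finite J" and i: "i \<notin> J"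
  shows "emeasure (sample (insert i J)) {y \<in> space (sample (insert i J)). first_point i J y \<and> hull_size (y ` insert i J) = 2} = 0"
proof -
  have "Suc (hull_size (to_triangle p ` (y ` J \<inter> beyond p))) \<noteq> 2" for p y
  proof -
    have "to_triangle p ` (y ` J \<inter> beyond p) \<subseteq> triangle" by (auto simp: beyond_def)
    hence "hull_size (to_triangle p ` (y ` J \<inter> beyond p)) \<ge> 2"
      unfolding hull_size_def using fin by (intro f0_chain_ge_2) auto
    thus ?thesis by simp
  qed
  thus ?thesis using emeasure_sample_insert_first[OF fin i, of "{2}"] by simp
qed

lemma slope_less_of_above_ray:
  assumes "p \<in> int_triangle" "p \<in> above_ray h" shows "h < slope p"
proof -
  have "fst p < 1" "h * (1 - fst p) < snd p" using assms by (auto simp: int_triangle_def above_ray_def)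
  thus ?thesis by (simp add: slope_def pos_less_divide_eq)
qed

text \<open>
  The induction runs over all finite index sets at once, since thinning leads to arbitrary subsets of the
  given one.
\<close>

theorem emeasure_hull_size_eq_chain_prob:
  assumes "finite J"
  shows "emeasure (sample J) {y \<in> space (sample J). hull_size (y ` J) = k + 2} = ennreal (chain_prob k (card J))"
  using assms
proof (induction k arbitrary: J)
  fix k J
  assume fin: "finite (J :: nat set)"
  interpret J: prob_space "sample J" by (rule prob_space_PiM) (rule prob_space_unif)
  have nonempty: "emeasure (sample J) {y \<in> space (sample J). hull_size (y ` J) = k + 2} = of_nat (card J) * ennreal q"
    if ne: "J \<noteq> {}" and q: "\<And>i. i \<in> J \<Longrightarrow> emeasure (sample J) {y \<in> space (sample J). first_point i (J - {i}) y \<and> hull_size (y ` J) = k + 2} = ennreal q" for k q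
  proof -
    define n where "n = card J"
    have n: "n > 0" using fin ne by (simp add: n_def card_gt_0_iff)
    define E where "E i = {y \<in> space (sample J). first_point i (J - {i}) y}" for i
    have E: "emeasure (sample J) (E i) = ennreal (1 / n)" if "i \<in> J" for i
    proof -
      have "insert i (J - {i}) = J" "Suc (card (J - {i})) = n" using that fin n by (auto simp: n_def)
      thus ?thesis using emeasure_first_vertex[of "J - {i}" i] fin by (simp add: E_def)
    qed
    \<comment> \<open>sets outside the \<open>\<sigma>\<close>-algebra have measure \<open>0\<close>, so measurability can be read off from \<open>E\<close>\<close>
    have ES: "E i \<in> sets (sample J)" if "i \<in> J" for i
      using E[OF that] n by (intro emeasure_neq_0_sets) (simp add: ennreal_eq_0_iff)
    have disj: "disjoint_family_on E J"
      unfolding disjoint_family_on_def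
    proof (intro ballI impI, rule ccontr)
      fix i j assume ij: "i \<in> J" "j \<in> J" "i \<noteq> j" "E i \<inter> E j \<noteq> {}"
      then obtain y where "y \<in> E i" "y \<in> E j" by blast
      hence "slope (y i) < slope (y j)" "slope (y j) < slope (y i)"
        using ij by (auto simp: E_def intro!: slope_less_of_above_ray)
      thus False by simp
    qed
    have "emeasure (sample J) (\<Union>i\<in>J. E i) = (\<Sum>i\<in>J. emeasure (sample J) (E i))"
      using ES disj fin by (intro sum_emeasure[symmetric]) auto
    also have "\<dots> = ennreal 1" using n E by (simp add: n_def[symmetric] ennreal_of_nat_eq_real_of_nat ennreal_mult[symmetric])
    finally have "AE y in sample J. y \<in> (\<Union>i\<in>J. E i)"
      using ES fin by (subst J.AE_in_set_eq_1) (auto simp: J.emeasure_eq_measure)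
    moreover have Q: "{y \<in> space (sample J). hull_size (y ` J) = k + 2} \<in> sets (sample J)"
    proof -
      have "(\<lambda>y. hull_size (y ` J)) \<in> measurable (sample J) (count_space UNIV)"
        by (rule measurable_hull_size[OF fin]) (use measurable_component_singleton[of _ J "\<lambda>_. unif"] in \<open>simp cong: measurable_cong_sets\<close>)
      thus ?thesis by measurable
    qed
    ultimately have "emeasure (sample J) {y \<in> space (sample J). hull_size (y ` J) = k + 2} =
        emeasure (sample J) (\<Union>i\<in>J. E i \<inter> {y \<in> space (sample J). hull_size (y ` J) = k + 2})"
      using ES fin by (intro emeasure_eq_AE) (auto elim!: eventually_mono)
    also have "\<dots> = (\<Sum>i\<in>J. emeasure (sample J) (E i \<inter> {y \<in> space (sample J). hull_size (y ` J) = k + 2}))"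
      using ES Q disj fin by (intro sum_emeasure[symmetric]) (auto simp: disjoint_family_on_def)
    also have "\<dots> = (\<Sum>i\<in>J. ennreal q)"
    proof (rule sum.cong)
      fix i assume "i \<in> J"
      have "E i \<inter> {y \<in> space (sample J). hull_size (y ` J) = k + 2} = {y \<in> space (sample J). first_point i (J - {i}) y \<and> hull_size (y ` J) = k + 2}" by (auto simp: E_def)
      thus "emeasure (sample J) (E i \<inter> {y \<in> space (sample J). hull_size (y ` J) = k + 2}) = ennreal q" using q[OF \<open>i \<in> J\<close>] by simp
    qed simp
    finally show ?thesis by simp
  qed
  have ins: "insert i (J - {i}) = J" "Suc (card (J - {i})) = card J" if "i \<in> J" for i
    using that card_Suc_Diff1[OF fin that] by auto
  {
    show "emeasure (sample J) {y \<in> space (sample J). hull_size (y ` J) = 0 + 2} = ennreal (chain_prob 0 (card J))"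
    proof (cases "J = {}")
      case True
      hence "{y \<in> space (sample J). hull_size (y ` J) = 0 + 2} = space (sample J)" by (simp add: hull_size_def f0_chain_empty[simplified])
      thus ?thesis using True J.emeasure_space_1 by simp
    next
      case False
      have "emeasure (sample J) {y \<in> space (sample J). first_point i (J - {i}) y \<and> hull_size (y ` J) = 0 + 2} = ennreal 0" if "i \<in> J" for i
        unfolding add_0 ennreal_0
        by (rule emeasure_first_vertex_only_corners[of "J - {i}" i, unfolded ins[OF that]]) (use fin in auto)
      from nonempty[OF False this] show ?thesis using fin False by simp
    qed
  next
    assume IH: "\<And>J. finite J \<Longrightarrow> emeasure (sample J) {y \<in> space (sample J). hull_size (y ` J) = k + 2} = ennreal (chain_prob k (card J))"
    show "emeasure (sample J) {y \<in> space (sample J). hull_size (y ` J) = Suc k + 2} = ennreal (chain_prob (Suc k) (card J))"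
    proof (cases "J = {}")
      case True
      thus ?thesis by (simp add: hull_size_def f0_chain_empty[simplified])
    next
      case False
      have "emeasure (sample J) {y \<in> space (sample J). first_point i (J - {i}) y \<and> hull_size (y ` J) = Suc k + 2} = ennreal (chain_prob (Suc k) (card J) / card J)" if "i \<in> J" for i
      proof -
        have "emeasure (sample I) {y \<in> space (sample I). hull_size (y ` I) = k + 2} = ennreal (chain_prob k (card I))" if "I \<subseteq> J - {i}" for I
          using IH finite_subset[OF that] fin by blast
        thus ?thesis
          by (intro emeasure_first_vertex_count[of "J - {i}" i, unfolded ins[OF that]]) (use fin in auto)
      qed
      from nonempty[OF False this] show ?thesis using fin False
        by (simp add: ennreal_of_nat_eq_real_of_nat ennreal_mult[symmetric] chain_prob_nonneg card_gt_0_iff del: chain_prob.simps)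
    qed
  }
qed

theorem vertex_prob_eq_chain_prob:
  assumes iid: "iid_uniform_points M X n" and n: "n > 0"
  shows "vertex_prob M X n k = chain_prob k n"
proof -
  interpret prob_space M using iid by (simp add: iid_uniform_points_def)
  have ind: "indep_vars (\<lambda>_. borel) X {1..n}" and dist: "\<And>i. i \<in> {1..n} \<Longrightarrow> distr M borel (X i) = unif"
    using iid by (auto simp: iid_uniform_points_def)
  have rv: "X i \<in> borel_measurable M" if "i \<in> {1..n}" for i
    using ind that by (auto simp: indep_vars_def)
  define Y where "Y = (\<lambda>\<omega>. \<lambda>i\<in>{1..n}. X i \<omega>)"
  have "distr M (Pi\<^sub>M {1..n} (\<lambda>_. borel)) Y = Pi\<^sub>M {1..n} (\<lambda>i. distr M borel (X i))"
    unfolding Y_def using indep_vars_iff_distr_eq_PiM'[where I = "{1..n}" and M' = "\<lambda>_. borel" and X = X] ind rv n by simp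
  also have "\<dots> = sample {1..n}" using dist by (intro PiM_cong) auto
  finally have D: "distr M (Pi\<^sub>M {1..n} (\<lambda>_. borel)) Y = sample {1..n}" .
  have sets_eq: "sets (sample {1..n}) = sets (Pi\<^sub>M {1..n} (\<lambda>_. borel))" by (intro sets_PiM_cong) auto
  have space_eq: "space (sample {1..n}) = space (Pi\<^sub>M {1..n} (\<lambda>_. borel))" using sets_eq by (rule sets_eq_imp_space_eq)
  have Y: "Y \<in> measurable M (Pi\<^sub>M {1..n} (\<lambda>_. borel))" unfolding Y_def using rv by (intro measurable_restrict)
  let ?Q = "{y \<in> space (sample {1..n}). hull_size (y ` {1..n}) = k + 2}"
  have "?Q \<in> sets (sample {1..n})"
  proof -
    have "(\<lambda>y. hull_size (y ` {1..n})) \<in> measurable (sample {1..n}) (count_space UNIV)"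
      by (rule measurable_hull_size) (use measurable_component_singleton[of _ "{1..n}" "\<lambda>_. unif"] in \<open>auto cong: measurable_cong_sets\<close>)
    thus ?thesis by measurable
  qed
  hence "emeasure (sample {1..n}) ?Q = emeasure M (Y -` ?Q \<inter> space M)"
    unfolding D[symmetric] by (subst emeasure_distr[OF Y]) (simp_all add: D sets_eq)
  also have "Y -` ?Q \<inter> space M = {\<omega> \<in> space M. f0 (random_hull X n \<omega>) = k + 2}"
  proof -
    have "Y \<omega> \<in> space (sample {1..n})" if "\<omega> \<in> space M" for \<omega>
      unfolding space_eq by (rule measurable_space[OF Y that])
    moreover have "hull_size (Y \<omega> ` {1..n}) = f0 (random_hull X n \<omega>)" for \<omega>
    proof -
      have "Y \<omega> ` {1..n} = (\<lambda>i. X i \<omega>) ` {1..n}" by (auto simp: Y_def)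
      thus ?thesis by (simp only: hull_size_def random_hull_def)
    qed
    ultimately show ?thesis by auto
  qed
  finally have "emeasure M {\<omega> \<in> space M. f0 (random_hull X n \<omega>) = k + 2} = ennreal (chain_prob k n)"
    using emeasure_hull_size_eq_chain_prob[of "{1..n}" k] by simp
  thus ?thesis unfolding vertex_prob_def by (simp add: measure_def chain_prob_nonneg)
qed

section \<open>The generating function of the vertex number\<close>

lemma chain_prob_eq_0: "n < k \<Longrightarrow> chain_prob k n = 0"
proof (induction k arbitrary: n)
  case (Suc k)
  hence "chain_prob k m = 0" if "m < n" for m using that by simp
  thus ?case by simp
qed simp

definition chain_gf :: "nat \<Rightarrow> complex \<Rightarrow> complex" where
  "chain_gf n t = (\<Sum>k\<le>n. of_real (chain_prob k n) * t ^ k)"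

lemma chain_gf_0: "chain_gf 0 t = 1"
  by (simp add: chain_gf_def)

lemma chain_gf_rec:
  assumes "n > 0"
  shows "of_nat n * of_nat (Suc n) * chain_gf n t = 2 * t * (\<Sum>m<n. of_nat (n - m) * chain_gf m t)"
proof -
  have gf: "chain_gf m t = (\<Sum>k<n. of_real (chain_prob k m) * t ^ k)" if "m < n" for m
    unfolding chain_gf_def using that by (intro sum.mono_neutral_left) (auto simp: chain_prob_eq_0)
  obtain n' where n': "n = Suc n'" using assms gr0_implies_Suc by blast
  have "chain_gf n t = (\<Sum>k\<le>n'. of_real (chain_prob (Suc k) n) * t ^ Suc k)"
    unfolding chain_gf_def n' sum.atMost_Suc_shift by simp
  hence "of_nat n * of_nat (Suc n) * chain_gf n t = (\<Sum>k\<le>n'. (of_nat n * of_nat (Suc n) * of_real (chain_prob (Suc k) n)) * t ^ Suc k)"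
    by (simp add: sum_distrib_left mult_ac)
  also have "\<dots> = (\<Sum>k\<le>n'. (2 * (\<Sum>m<n. of_nat (n - m) * of_real (chain_prob k m))) * t ^ Suc k)"
  proof (rule sum.cong[OF refl])
    fix k
    have "real n * real (Suc n) * chain_prob (Suc k) n = 2 * (\<Sum>m<n. (real n - real m) * chain_prob k m)"
    proof -
      have "x * (2 / x * S) = 2 * S" if "x \<noteq> 0" for x S :: real using that by simp
      moreover have "real n * (real n + 1) \<noteq> 0" "real (Suc n) = real n + 1" using assms by auto
      ultimately show ?thesis by (simp only: chain_prob.simps)
    qed
    also have "(\<Sum>m<n. (real n - real m) * chain_prob k m) = (\<Sum>m<n. real (n - m) * chain_prob k m)"
      by (intro sum.cong) (auto simp: of_nat_diff)
    finally have "complex_of_real (real n * real (Suc n) * chain_prob (Suc k) n) = of_real (2 * (\<Sum>m<n. real (n - m) * chain_prob k m))"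
      by (simp only:)
    hence "of_nat n * of_nat (Suc n) * complex_of_real (chain_prob (Suc k) n) = 2 * (\<Sum>m<n. of_nat (n - m) * of_real (chain_prob k m))"
      by (simp del: chain_prob.simps)
    thus "of_nat n * of_nat (Suc n) * complex_of_real (chain_prob (Suc k) n) * t ^ Suc k =
        2 * (\<Sum>m<n. of_nat (n - m) * of_real (chain_prob k m)) * t ^ Suc k" by (simp only:)
  qed
  also have "\<dots> = (\<Sum>k\<le>n'. \<Sum>m<n. 2 * t * (of_nat (n - m) * (of_real (chain_prob k m) * t ^ k)))"
    by (simp only: sum_distrib_left sum_distrib_right mult_ac power_Suc)
  also have "\<dots> = (\<Sum>m<n. \<Sum>k\<le>n'. 2 * t * (of_nat (n - m) * (of_real (chain_prob k m) * t ^ k)))"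
    by (rule sum.swap)
  also have "\<dots> = (\<Sum>m<n. 2 * t * (of_nat (n - m) * chain_gf m t))"
    by (intro sum.cong refl) (simp add: gf n' lessThan_Suc_atMost sum_distrib_left)
  finally show ?thesis by (simp add: sum_distrib_left mult_ac)
qed

text \<open>
  Coefficients of the hypergeometric series with upper parameters \<open>- a\<close>, \<open>1 - a\<close> and lower parameter \<open>2\<close>.
\<close>

definition hyp_coef :: "complex \<Rightarrow> nat \<Rightarrow> complex" where
  "hyp_coef a j = pochhammer (- a) j * pochhammer (1 - a) j / (fact j * fact (Suc j))"

text \<open>
  Coefficients of \<open>1 - x\<close> to the power \<open>- a\<close>.
\<close>

definition pow_coef :: "complex \<Rightarrow> nat \<Rightarrow> complex" where
  "pow_coef a m = pochhammer a m / fact m"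

definition conv_coef :: "complex \<Rightarrow> nat \<Rightarrow> complex" where
  "conv_coef a n = (\<Sum>j\<le>n. hyp_coef a j * pow_coef a (n - j))"

lemma pow_coef_Suc: "of_nat (Suc m) * pow_coef a (Suc m) = (a + of_nat m) * pow_coef a m"
  by (simp add: pow_coef_def pochhammer_rec' divide_simps del: of_nat_Suc)

lemma hyp_coef_Suc: "of_nat (Suc n) * of_nat (Suc (Suc n)) * hyp_coef a (Suc n) = (of_nat n - a) * (of_nat n + 1 - a) * hyp_coef a n"
proof -
  have f: "fact (Suc n) = of_nat (Suc n) * (fact n :: complex)" "fact (Suc (Suc n)) = of_nat (Suc (Suc n)) * (fact (Suc n) :: complex)"
    by (simp_all only: fact_Suc)
  have "of_nat (Suc n) * of_nat (Suc (Suc n)) * hyp_coef a (Suc n) =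
     of_nat (Suc n) * of_nat (Suc (Suc n)) * ((- a + of_nat n) * pochhammer (- a) n * ((1 - a + of_nat n) * pochhammer (1 - a) n)) /
       (of_nat (Suc n) * fact n * (of_nat (Suc (Suc n)) * fact (Suc n)))"
    unfolding hyp_coef_def pochhammer_rec' f by (simp only: times_divide_eq_right mult_ac)
  also have "\<dots> = (- a + of_nat n) * pochhammer (- a) n * ((1 - a + of_nat n) * pochhammer (1 - a) n) / (fact n * fact (Suc n))"
    by (simp add: divide_simps del: of_nat_Suc fact_Suc)
  finally show ?thesis by (simp add: hyp_coef_def algebra_simps)
qed

text \<open>
  The substitution that takes the hypergeometric equation for \<open>B\<close> to the equation for \<open>B P\<close> when
  \<open>P\<close> is a power of \<open>1 - x\<close>. The primes are mere names here.
\<close>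

lemma ode_product_identity:
  fixes x u A B B' B'' P P' P'' :: "'a :: comm_ring_1"
  assumes u: "u = 1 - x" and P': "u * P' = A * P" and P'': "u * P'' = (1 + A) * P'"
    and B: "x * u * B'' + (2 - (2 - 2 * A) * x) * B' + A * (1 - A) * B = 0"
  shows "u\<^sup>2 * (x * (B'' * P + 2 * B' * P' + B * P'') + 2 * (B' * P + B * P')) = A * (A + 1) * (B * P)"
proof -
  have "u * u * P'' = (1 + A) * (u * P')" using P'' by (metis mult.assoc mult.left_commute)
  hence uu: "u * u * P'' = (1 + A) * (A * P)" by (simp only: P')
  have "u\<^sup>2 * (x * (B'' * P + 2 * B' * P' + B * P'') + 2 * (B' * P + B * P')) =
      u * P * (x * u * B'') + 2 * x * u * B' * (u * P') + x * B * (u * u * P'') + 2 * u * u * B' * P + 2 * u * B * (u * P')"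
    by (simp add: power2_eq_square algebra_simps)
  also have "\<dots> = u * P * (x * u * B'' + (2 * x * A + 2 * u) * B') + (x * (1 + A) * A + 2 * u * A) * (B * P)"
    unfolding uu P' by (simp add: algebra_simps)
  also have "x * u * B'' + (2 * x * A + 2 * u) * B' = - (A * (1 - A) * B)"
    using B by (simp add: u algebra_simps eq_neg_iff_add_eq_0)
  also have "u * P * (- (A * (1 - A) * B)) + (x * (1 + A) * A + 2 * u * A) * (B * P) = A * (A + 1) * (B * P)"
    by (simp add: u algebra_simps)
  finally show ?thesis .
qed

lemma fps_ode:
  fixes a :: complex
  defines "F \<equiv> Abs_fps (conv_coef a)"
  shows "(1 - fps_X)\<^sup>2 * (fps_X * fps_deriv (fps_deriv F) + 2 * fps_deriv F) = fps_const (a * (a + 1)) * F"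
proof -
  define P where "P = Abs_fps (pow_coef a)"
  define B where "B = Abs_fps (hyp_coef a)"
  have F: "F = B * P"
    by (simp add: fps_eq_iff F_def P_def B_def fps_mult_nth conv_coef_def atMost_atLeast0)
  have P1: "(1 - fps_X) * fps_deriv P = fps_const a * P"
  proof (rule fps_ext)
    fix n
    have "fps_nth ((1 - fps_X) * fps_deriv P) n = of_nat (Suc n) * pow_coef a (Suc n) - of_nat n * pow_coef a n"
      by (cases n) (simp_all add: ring_distribs P_def)
    thus "fps_nth ((1 - fps_X) * fps_deriv P) n = fps_nth (fps_const a * P) n"
      unfolding pow_coef_Suc by (simp add: P_def algebra_simps)
  qed
  have "fps_deriv ((1 - fps_X) * fps_deriv P) = fps_deriv (fps_const a * P)" by (simp only: P1)
  hence P2: "(1 - fps_X) * fps_deriv (fps_deriv P) = (1 + fps_const a) * fps_deriv P"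
    by (simp add: algebra_simps)
  have B1: "fps_X * (1 - fps_X) * fps_deriv (fps_deriv B) + (2 - (2 - 2 * fps_const a) * fps_X) * fps_deriv B
      + fps_const a * (1 - fps_const a) * B = 0"
  proof (rule fps_ext)
    fix n
    have c: "fps_const a * (1 - fps_const a) = fps_const (a * (1 - a))"
      by (simp add: fps_const_sub[symmetric] fps_const_mult[symmetric] del: fps_const_mult fps_const_sub)
    have c2: "(2 - 2 * fps_const a) = fps_const (2 - 2 * a)"
      by (simp add: fps_const_sub[symmetric] fps_const_mult[symmetric] numeral_fps_const del: fps_const_mult fps_const_sub)
    have "(fps_X * (1 - fps_X) * fps_deriv (fps_deriv B) + (2 - (2 - 2 * fps_const a) * fps_X) * fps_deriv B
      + fps_const a * (1 - fps_const a) * B) = fps_X * fps_deriv (fps_deriv B) - fps_X * (fps_X * fps_deriv (fps_deriv B))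
        + fps_const 2 * fps_deriv B - fps_const (2 - 2 * a) * (fps_X * fps_deriv B) + fps_const (a * (1 - a)) * B"
      unfolding c c2 by (simp add: algebra_simps numeral_fps_const)
    also have "fps_nth \<dots> n = of_nat (Suc n) * of_nat (Suc (Suc n)) * hyp_coef a (Suc n) - (of_nat n - a) * (of_nat n + 1 - a) * hyp_coef a n"
      by (cases n; cases "n - 1") (simp_all add: B_def algebra_simps)
    also have "\<dots> = 0" unfolding hyp_coef_Suc by simp
    finally show "fps_nth (fps_X * (1 - fps_X) * fps_deriv (fps_deriv B) + (2 - (2 - 2 * fps_const a) * fps_X) * fps_deriv B
      + fps_const a * (1 - fps_const a) * B) n = fps_nth 0 n" by simp
  qed
  have dF: "fps_deriv F = fps_deriv B * P + B * fps_deriv P" by (simp add: F)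
  have ddF: "fps_deriv (fps_deriv F) = fps_deriv (fps_deriv B) * P + 2 * fps_deriv B * fps_deriv P + B * fps_deriv (fps_deriv P)"
    by (simp add: dF algebra_simps)
  have c: "fps_const (a * (a + 1)) = fps_const a * (fps_const a + 1)"
    by (simp add: fps_const_add[symmetric] fps_const_mult[symmetric] del: fps_const_mult fps_const_add)
  from ode_product_identity[OF refl P1 P2 B1] show ?thesis
    unfolding F[symmetric] by (subst ddF, subst dF, subst c)
qed

lemma conv_coef_step:
  "of_nat (Suc n) * of_nat (Suc (Suc n)) * conv_coef a (Suc n) - 2 * (of_nat n * of_nat (Suc n) * conv_coef a n)
     + of_nat (n - 1) * of_nat n * conv_coef a (n - 1) = a * (a + 1) * conv_coef a n"
proof -
  define F where "F = Abs_fps (conv_coef a)"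
  define H where "H = fps_X * fps_deriv (fps_deriv F) + 2 * fps_deriv F"
  have H: "fps_nth H n = of_nat (Suc n) * of_nat (Suc (Suc n)) * conv_coef a (Suc n)" for n
    unfolding H_def numeral_fps_const by (cases n) (simp_all add: F_def algebra_simps)
  have "(1 - fps_X)\<^sup>2 * H = H - fps_const 2 * (fps_X * H) + fps_X * (fps_X * H)"
    by (simp add: power2_eq_square algebra_simps numeral_fps_const[symmetric])
  hence "fps_nth (H - fps_const 2 * (fps_X * H) + fps_X * (fps_X * H)) n = fps_nth (fps_const (a * (a + 1)) * F) n"
    using fps_ode[of a, folded F_def, folded H_def] by simp
  hence eq: "fps_nth H n - 2 * (if n = 0 then 0 else fps_nth H (n - 1))
      + (if n = 0 then 0 else if n = 1 then 0 else fps_nth H (n - 2)) = a * (a + 1) * fps_nth F n"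
    by (cases "n \<le> 1") (auto simp: numeral_2_eq_2 le_Suc_eq)
  consider "n = 0" | "n = 1" | m where "n = Suc (Suc m)"
    by (metis One_nat_def not0_implies_Suc)
  thus ?thesis using eq by cases (simp_all add: H F_def del: of_nat_Suc)
qed

lemma conv_coef_0: "conv_coef a 0 = 1"
  by (simp add: conv_coef_def hyp_coef_def pow_coef_def)

text \<open>
  The differential equation prescribes the second differences of \<open>n (n + 1) conv_coef a n\<close>. Summing them
  once gives this formula, and summing twice gives the recursion of the generating function.
\<close>

lemma conv_coef_diff:
  "of_nat (Suc n) * of_nat (Suc (Suc n)) * conv_coef a (Suc n) - of_nat n * of_nat (Suc n) * conv_coef a n
     = a * (a + 1) * (\<Sum>m\<le>n. conv_coef a m)"
proof (induction n)
  case 0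
  show ?case using conv_coef_step[of 0 a] by simp
next
  case (Suc n)
  have "of_nat (Suc (Suc n)) * of_nat (Suc (Suc (Suc n))) * conv_coef a (Suc (Suc n)) - of_nat (Suc n) * of_nat (Suc (Suc n)) * conv_coef a (Suc n)
    = (of_nat (Suc n) * of_nat (Suc (Suc n)) * conv_coef a (Suc n) - of_nat n * of_nat (Suc n) * conv_coef a n) + a * (a + 1) * conv_coef a (Suc n)"
    unfolding conv_coef_step[of "Suc n" a, symmetric] by simp
  thus ?case unfolding Suc.IH by (simp add: distrib_left)
qed

lemma conv_coef_rec:
  "of_nat n * of_nat (Suc n) * conv_coef a n = a * (a + 1) * (\<Sum>m<n. of_nat (n - m) * conv_coef a m)"
proof (induction n)
  case (Suc n)
  have "(\<Sum>m<Suc n. of_nat (Suc n - m) * conv_coef a m) = (\<Sum>m<Suc n. of_nat (n - m) * conv_coef a m + conv_coef a m)"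
    by (intro sum.cong refl) (auto simp: Suc_diff_le algebra_simps)
  also have "\<dots> = (\<Sum>m<n. of_nat (n - m) * conv_coef a m) + (\<Sum>m\<le>n. conv_coef a m)"
    by (simp add: sum.distrib lessThan_Suc_atMost[symmetric])
  finally have eq: "(\<Sum>m<Suc n. of_nat (Suc n - m) * conv_coef a m) = (\<Sum>m<n. of_nat (n - m) * conv_coef a m) + (\<Sum>m\<le>n. conv_coef a m)" .
  show ?case unfolding eq distrib_left[of "a * (a + 1)"] Suc.IH[symmetric] conv_coef_diff[of n a, symmetric] by simp
qed simp

text \<open>
  Both sides satisfy the same recursion.
\<close>

theorem chain_gf_eq_conv_coef:
  assumes "a * (a + 1) = 2 * t"
  shows "chain_gf n t = conv_coef a n"
proof (induction n rule: less_induct)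
  case (less n)
  show ?case
  proof (cases "n = 0")
    case False
    have "of_nat n * of_nat (Suc n) * chain_gf n t = of_nat n * of_nat (Suc n) * conv_coef a n"
      unfolding chain_gf_rec[OF False[THEN neq0_conv[THEN iffD1]]] conv_coef_rec assms
      using less.IH by (intro arg_cong2[of _ _ _ _ "(*)"] refl sum.cong) auto
    thus ?thesis using False by (simp del: of_nat_Suc)
  qed (simp add: chain_gf_0 conv_coef_0)
qed

section \<open>Bounds for the generating function\<close>

lemma norm_one_plus_le_exp: "norm (1 + w) \<le> exp (Re w + (norm w)\<^sup>2 / 2)" for w :: complex
proof -
  have "(norm (1 + w))\<^sup>2 = 1 + (2 * Re w + (norm w)\<^sup>2)"
    by (simp add: cmod_power2) (simp add: power2_eq_square algebra_simps)
  also have "\<dots> \<le> exp (2 * Re w + (norm w)\<^sup>2)" by (rule exp_ge_add_one_self)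
  also have "\<dots> = (exp (Re w + (norm w)\<^sup>2 / 2))\<^sup>2" by (subst exp_double[symmetric]) (simp add: algebra_simps)
  finally show ?thesis by (rule power2_le_imp_le) simp
qed


lemma harm_le_ln: "n > 0 \<Longrightarrow> harm n \<le> 1 + ln (real n)"
proof (induction n rule: nat_induct_non_zero)
  case (Suc n)
  have "ln (1 - 1 / (real n + 1)) \<le> - (1 / (real n + 1))"
    using ln_add_one_self_le_self2[of "- (1 / (real n + 1))"] Suc by simp
  moreover have "1 - 1 / (real n + 1) = real n / (real n + 1)" by (simp add: field_simps)
  ultimately have "1 / (real n + 1) \<le> ln (real n + 1) - ln (real n)" using Suc by (simp add: ln_div)
  moreover have "harm (Suc n) = harm n + 1 / (real n + 1)"
    unfolding harm_Suc inverse_eq_divide of_nat_Suc by (simp only: add.commute[of 1])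
  moreover have "real (Suc n) = real n + 1" by simp
  ultimately show ?case using Suc.IH by (simp only:)
qed (simp add: harm_expand)

lemma harm_bounds: "ln (real n + 1) \<le> harm n" "harm n \<le> 1 + ln (real n + 1)"
proof -
  show "ln (real n + 1) \<le> harm n" by (rule ln_le_harm)
  show "harm n \<le> 1 + ln (real n + 1)"
  proof (cases "n = 0")
    case False
    have "harm n \<le> 1 + ln (real n)" using False by (intro harm_le_ln) simp
    also have "ln (real n) \<le> ln (real n + 1)" using False by simp
    finally show ?thesis by simp
  qed (simp add: harm_expand)
qed

lemma sum_inverse_squares_le: "(\<Sum>i=1..n. 1 / (real i)\<^sup>2) \<le> 2"
proof -
  have "n > 0 \<Longrightarrow> (\<Sum>i=1..n. 1 / (real i)\<^sup>2) \<le> 2 - 1 / real n"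
  proof (induction n rule: nat_induct_non_zero)
    case (Suc n)
    have "1 / (real (Suc n))\<^sup>2 \<le> 1 / real n - 1 / real (Suc n)"
    proof -
      have "1 / real n - 1 / real (Suc n) = 1 / (real n * real (Suc n))" using Suc by (simp add: field_simps)
      moreover have "1 / (real (Suc n))\<^sup>2 \<le> 1 / (real n * real (Suc n))"
        using Suc unfolding power2_eq_square by (intro divide_left_mono mult_right_mono mult_pos_pos) auto
      ultimately show ?thesis by (simp only:)
    qed
    thus ?case using Suc by simp
  qed simp
  thus ?thesis by (cases "n = 0") (auto intro: order_trans)
qed

lemma pochhammer_div_fact_eq_prod:
  "pochhammer (1 + z) m / fact m = (\<Prod>i=1..m. 1 + z / of_nat i)" for z :: complex
proof (induction m)
  case (Suc m)
  have "pochhammer (1 + z) (Suc m) / fact (Suc m) = pochhammer (1 + z) m / fact m * ((of_nat (Suc m) + z) / of_nat (Suc m))"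
    by (simp add: pochhammer_rec' field_simps del: of_nat_Suc) (simp add: algebra_simps)
  also have "(of_nat (Suc m) + z) / of_nat (Suc m) = 1 + z / of_nat (Suc m)"
    by (simp add: divide_simps del: of_nat_Suc)
  finally show ?case by (simp add: Suc.IH)
qed simp

lemma Re_mult_harm_le: "Re z * harm m \<le> norm z + Re z * ln (real m + 1)"
proof -
  have "Re z * (harm m - ln (real m + 1)) \<le> \<bar>Re z\<bar> * 1"
    using harm_bounds[of m] by (intro mult_mono) auto
  moreover have "Re z * (harm m - ln (real m + 1)) = Re z * harm m - Re z * ln (real m + 1)"
    by (rule right_diff_distrib)
  ultimately show ?thesis using abs_Re_le_cmod[of z] by linarith
qed

text \<open>
  The real part of \<open>z / i\<close> sums to a harmonic number, and the quadratic terms are summable; this is why the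
  products below are comparable to powers.
\<close>

lemma norm_one_plus_div_nat_le:
  "norm (1 + z / of_nat i) \<le> exp (Re z * (1 / real i) + (norm z)\<^sup>2 / 2 * (1 / (real i)\<^sup>2))" for z :: complex
proof -
  have "Re (z / of_nat i) = Re z * (1 / real i)" "(norm (z / of_nat i))\<^sup>2 / 2 = (norm z)\<^sup>2 / 2 * (1 / (real i)\<^sup>2)"
    by (simp_all add: norm_divide Re_divide_of_nat power_divide)
  with norm_one_plus_le_exp[of "z / of_nat i"] show ?thesis by (simp only:)
qed

lemma prod_norm_one_plus_le:
  "(\<Prod>i=1..m. norm (1 + z / of_nat i)) \<le> exp (Re z * harm m + (norm z)\<^sup>2 / 2 * (\<Sum>i=1..m. 1 / (real i)\<^sup>2))" for z :: complex
proof -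
  have "(\<Prod>i=1..m. norm (1 + z / of_nat i)) \<le> (\<Prod>i=1..m. exp (Re z * (1 / real i) + (norm z)\<^sup>2 / 2 * (1 / (real i)\<^sup>2)))"
    by (intro prod_mono conjI norm_ge_zero norm_one_plus_div_nat_le)
  also have "\<dots> = exp (\<Sum>i=1..m. Re z * (1 / real i) + (norm z)\<^sup>2 / 2 * (1 / (real i)\<^sup>2))"
    by (rule exp_sum[symmetric]) simp
  also have "(\<Sum>i=1..m. Re z * (1 / real i) + (norm z)\<^sup>2 / 2 * (1 / (real i)\<^sup>2)) = Re z * harm m + (norm z)\<^sup>2 / 2 * (\<Sum>i=1..m. 1 / (real i)\<^sup>2)"
    unfolding sum.distrib sum_distrib_left harm_def by (simp only: inverse_eq_divide of_nat_id)
  finally show ?thesis .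
qed

lemma norm_pochhammer_div_fact_le:
  "norm (pochhammer (1 + z) m / fact m) \<le> exp (norm z + (norm z)\<^sup>2) * (real m + 1) powr Re z" for z :: complex
proof -
  have "norm (pochhammer (1 + z) m / fact m) = (\<Prod>i=1..m. norm (1 + z / of_nat i))"
    unfolding pochhammer_div_fact_eq_prod by (rule prod_norm[symmetric])
  also have "\<dots> \<le> exp (Re z * harm m + (norm z)\<^sup>2 / 2 * (\<Sum>i=1..m. 1 / (real i)\<^sup>2))"
    by (rule prod_norm_one_plus_le)
  also have "\<dots> \<le> exp ((norm z + Re z * ln (real m + 1)) + (norm z)\<^sup>2 / 2 * 2)"
    unfolding exp_le_cancel_iff
    by (intro add_mono Re_mult_harm_le mult_left_mono sum_inverse_squares_le) simp
  also have "\<dots> = exp (norm z + (norm z)\<^sup>2) * (real m + 1) powr Re z"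
    by (simp add: powr_def exp_add mult_ac)
  finally show ?thesis .
qed

definition bound_const :: "real \<Rightarrow> real" where
  "bound_const R = exp ((R + 1) + (R + 1)\<^sup>2)"

lemma bound_const_pos: "bound_const R > 0" by (simp add: bound_const_def)

lemma norm_pochhammer_div_fact_le':
  assumes "norm z \<le> R + 1"
  shows "norm (pochhammer (1 + z) m / fact m :: complex) \<le> bound_const R * (real m + 1) powr Re z"
proof -
  have "exp (norm z + (norm z)\<^sup>2) \<le> bound_const R"
    unfolding bound_const_def using assms by (intro exp_le_cancel_iff[THEN iffD2] add_mono power_mono) auto
  thus ?thesis
    using norm_pochhammer_div_fact_le[of z m] by (meson mult_right_mono order_trans powr_ge_zero)
qed

lemma norm_pow_coef_le:
  assumes "norm a \<le> R"
  shows "norm (pow_coef a m) \<le> bound_const R * (real m + 1) powr (Re a - 1)"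
  using norm_pochhammer_div_fact_le'[of "a - 1" R m] assms norm_triangle_ineq4[of a 1]
  by (simp add: pow_coef_def)

lemma norm_hyp_coef_le:
  assumes "norm a \<le> R"
  shows "norm (hyp_coef a j) \<le> (bound_const R)\<^sup>2 * (real j + 1) powr (- 2 * Re a - 2)"
proof -
  have "norm (1 + a) \<le> R + 1" using norm_triangle_ineq[of 1 a] assms by simp
  hence "norm (- a - 1) \<le> R + 1" by (metis minus_diff_eq norm_minus_cancel diff_minus_eq_add add.commute uminus_add_conv_diff)
  from norm_pochhammer_div_fact_le'[OF this, of j]
  have 1: "norm (pochhammer (- a) j / fact j) \<le> bound_const R * (real j + 1) powr (- Re a - 1)" by simp
  have 2: "norm (pochhammer (1 - a) j / fact j) \<le> bound_const R * (real j + 1) powr (- Re a)"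
    using norm_pochhammer_div_fact_le'[of "- a" R j] assms by simp
  have "hyp_coef a j = (pochhammer (- a) j / fact j) * (pochhammer (1 - a) j / fact j) * (1 / of_nat (Suc j))"
    by (simp add: hyp_coef_def)
  hence "norm (hyp_coef a j) = norm (pochhammer (- a) j / fact j) * norm (pochhammer (1 - a) j / fact j) * (real j + 1) powr (- 1)"
    by (simp add: norm_mult norm_divide powr_minus_divide add.commute del: of_nat_Suc)
  also have "\<dots> \<le> (bound_const R * (real j + 1) powr (- Re a - 1)) * (bound_const R * (real j + 1) powr (- Re a)) * (real j + 1) powr (- 1)"
    using bound_const_pos[of R] by (intro mult_mono 1 2) auto
  also have "\<dots> = (bound_const R)\<^sup>2 * ((real j + 1) powr (- Re a - 1) * (real j + 1) powr (- Re a) * (real j + 1) powr (- 1))"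
    by (simp add: power2_eq_square mult_ac)
  also have "(real j + 1) powr (- Re a - 1) * (real j + 1) powr (- Re a) * (real j + 1) powr (- 1) = (real j + 1) powr (- 2 * Re a - 2)"
    by (simp only: powr_add[symmetric]) (rule arg_cong[of _ _ "(powr) _"], simp)
  finally show ?thesis .
qed

lemma product_ge_Suc: "j \<le> n \<Longrightarrow> real n + 1 \<le> (real j + 1) * (real (n - j) + 1)"
  by (simp add: of_nat_diff algebra_simps) (metis mult_left_mono of_nat_0_le_iff of_nat_mono)

text \<open>
  From \<open>n + 1 \<le> (j + 1) (n - j + 1)\<close>, replacing \<open>n - j + 1\<close> by \<open>n + 1\<close> costs at most a factor \<open>j + 1\<close>, which the
  decay of the hypergeometric coefficients can afford.
\<close>

lemma norm_conv_term_le: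
  assumes R: "norm a \<le> R" and r: "0 \<le> r" "r \<le> Re a" and j: "j \<le> n"
  shows "norm (hyp_coef a j * pow_coef a (n - j)) \<le> bound_const R ^ 3 * (real n + 1) powr (Re a - 1) * (real j + 1) powr (- 1 - 2 * r)"
proof -
  have "(real (n - j) + 1) powr (Re a - 1) \<le> (real n + 1) powr (Re a - 1) * (real j + 1)"
  proof (cases "Re a \<ge> 1")
    case True
    have "(real (n - j) + 1) powr (Re a - 1) \<le> (real n + 1) powr (Re a - 1)"
      using True by (intro powr_mono2) auto
    also have "\<dots> \<le> (real n + 1) powr (Re a - 1) * (real j + 1)"
      by (simp add: mult_le_cancel_left1)
    finally show ?thesis .
  next
    case False
    have "(real n + 1) powr (1 - Re a) \<le> ((real j + 1) * (real (n - j) + 1)) powr (1 - Re a)"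
      using False product_ge_Suc[OF j] by (intro powr_mono2) auto
    also have "\<dots> = (real j + 1) powr (1 - Re a) * (real (n - j) + 1) powr (1 - Re a)"
      by (simp add: powr_mult)
    also have "\<dots> \<le> (real j + 1) powr 1 * (real (n - j) + 1) powr (1 - Re a)"
      using r by (intro mult_right_mono powr_mono) auto
    finally have *: "(real n + 1) powr (1 - Re a) \<le> (real j + 1) * (real (n - j) + 1) powr (1 - Re a)" by simp
    have e: "x powr (Re a - 1) = 1 / x powr (1 - Re a)" if "x > 0" for x
      using that powr_minus_divide[of x "1 - Re a"] by simp
    show ?thesis using * by (simp add: e divide_simps mult.commute)
  qed
  hence "norm (hyp_coef a j) * norm (pow_coef a (n - j)) \<le>
      ((bound_const R)\<^sup>2 * (real j + 1) powr (- 2 * Re a - 2)) * (bound_const R * ((real n + 1) powr (Re a - 1) * (real j + 1)))"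
    using bound_const_pos[of R]
    by (intro mult_mono norm_hyp_coef_le[OF R] order_trans[OF norm_pow_coef_le[OF R]]) auto
  also have "\<dots> = bound_const R ^ 3 * (real n + 1) powr (Re a - 1) * ((real j + 1) powr (- 2 * Re a - 2) * (real j + 1) powr 1)"
    by (simp add: power2_eq_square power3_eq_cube mult_ac)
  also have "(real j + 1) powr (- 2 * Re a - 2) * (real j + 1) powr 1 = (real j + 1) powr (- 2 * Re a - 1)"
    by (simp only: powr_add[symmetric]) (rule arg_cong[of _ _ "(powr) _"], simp)
  also have "bound_const R ^ 3 * (real n + 1) powr (Re a - 1) * (real j + 1) powr (- 2 * Re a - 1) \<le>
      bound_const R ^ 3 * (real n + 1) powr (Re a - 1) * (real j + 1) powr (- 1 - 2 * r)"
    using r bound_const_pos[of R] by (intro mult_left_mono powr_mono) auto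
  finally show ?thesis by (simp add: norm_mult)
qed

lemma summable_Suc_powr: "r > 0 \<Longrightarrow> summable (\<lambda>j. (real j + 1) powr (- 1 - 2 * r))"
  using summable_real_powr_iff[of "- 1 - 2 * r"] summable_Suc_iff[of "\<lambda>j. real j powr (- 1 - 2 * r)"]
  by (simp add: add.commute)

lemma norm_conv_coef_le_near:
  assumes r: "r > 0"
  shows "\<exists>C>0. \<forall>a n. norm a \<le> R \<longrightarrow> r \<le> Re a \<longrightarrow> norm (conv_coef a n) \<le> C * (real n + 1) powr (Re a - 1)"
proof (intro exI[of _ "bound_const R ^ 3 * (1 + (\<Sum>j. (real j + 1) powr (- 1 - 2 * r)))"] conjI allI impI)
  let ?S = "\<Sum>j. (real j + 1) powr (- 1 - 2 * r)"
  have S: "?S \<ge> 0" by (intro suminf_nonneg summable_Suc_powr r) auto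
  thus "bound_const R ^ 3 * (1 + ?S) > 0" using bound_const_pos[of R] by (intro mult_pos_pos) auto
  fix a n assume a: "norm a \<le> R" "r \<le> Re a"
  have "norm (conv_coef a n) \<le> (\<Sum>j\<le>n. norm (hyp_coef a j * pow_coef a (n - j)))"
    unfolding conv_coef_def by (rule norm_sum)
  also have "\<dots> \<le> (\<Sum>j\<le>n. bound_const R ^ 3 * (real n + 1) powr (Re a - 1) * (real j + 1) powr (- 1 - 2 * r))"
    using a r by (intro sum_mono norm_conv_term_le) auto
  also have "\<dots> = bound_const R ^ 3 * (real n + 1) powr (Re a - 1) * (\<Sum>j\<le>n. (real j + 1) powr (- 1 - 2 * r))"
    by (simp add: sum_distrib_left)
  also have "\<dots> \<le> bound_const R ^ 3 * (real n + 1) powr (Re a - 1) * (1 + ?S)"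
  proof (intro mult_left_mono)
    have "(\<Sum>j\<le>n. (real j + 1) powr (- 1 - 2 * r)) \<le> ?S"
      by (intro sum_le_suminf summable_Suc_powr r) auto
    thus "(\<Sum>j\<le>n. (real j + 1) powr (- 1 - 2 * r)) \<le> 1 + ?S" by simp
  qed (use bound_const_pos[of R] in auto)
  finally show "norm (conv_coef a n) \<le> bound_const R ^ 3 * (1 + ?S) * (real n + 1) powr (Re a - 1)"
    by (simp add: mult_ac)
qed

text \<open>
  For small real part the hypergeometric coefficients are only known to decay like \<open>1 / (j + 1)\<close>. Partial
  fractions for \<open>1 / ((j + 1) (n - j + 1))\<close> then produce a harmonic number, which is absorbed by an additional
  power \<open>r\<close>.
\<close>

lemma norm_conv_coef_le_far:
  assumes r: "r > 0"
  shows "\<exists>C>0. \<forall>a n. norm a \<le> R \<longrightarrow> - 1 / 2 \<le> Re a \<longrightarrow> Re a \<le> r \<longrightarrow> norm (conv_coef a n) \<le> C * (real n + 1) powr (2 * r - 1)"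
proof (intro exI[of _ "bound_const R ^ 3 * (2 * (2 + 1 / r))"] conjI allI impI)
  show "bound_const R ^ 3 * (2 * (2 + 1 / r)) > 0" using bound_const_pos[of R] r by (intro mult_pos_pos add_pos_pos) auto
  fix a n assume a: "norm a \<le> R" "- 1 / 2 \<le> Re a" "Re a \<le> r"
  define N where "N = real n + 1"
  have N: "N \<ge> 1" by (simp add: N_def)
  have "norm (conv_coef a n) \<le> (\<Sum>j\<le>n. norm (hyp_coef a j * pow_coef a (n - j)))"
    unfolding conv_coef_def by (rule norm_sum)
  also have "\<dots> \<le> (\<Sum>j\<le>n. bound_const R ^ 3 * (N powr (r - 1) * (1 / (real j + 1) + 1 / (real (n - j) + 1))))"
  proof (intro sum_mono)
    fix j assume "j \<in> {..n}"
    hence j: "j \<le> n" by simp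
    define m where "m = n - j"
    have jm: "real j + 1 + (real m + 1) = N + 1" using j by (simp add: m_def N_def of_nat_diff)
    have 1: "(real j + 1) powr (- 2 * Re a - 2) \<le> (real j + 1) powr (- 1)"
      using a by (intro powr_mono) auto
    have 2: "(real m + 1) powr (Re a - 1) \<le> (real m + 1) powr (r - 1)"
      using a by (intro powr_mono) auto
    have 3: "(real m + 1) powr (r - 1) = (real m + 1) powr r / (real m + 1)" by (simp add: powr_diff)
    have 4: "(real m + 1) powr r \<le> N powr r" using r jm by (intro powr_mono2) auto
    have "norm (hyp_coef a j) * norm (pow_coef a m) \<le>
        ((bound_const R)\<^sup>2 * (real j + 1) powr (- 1)) * (bound_const R * ((real m + 1) powr (r - 1)))"
      using bound_const_pos[of R] 1 2
      by (intro mult_mono order_trans[OF norm_hyp_coef_le[OF a(1)]] order_trans[OF norm_pow_coef_le[OF a(1)]]) auto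
    also have "\<dots> = bound_const R ^ 3 * ((real m + 1) powr r * (1 / ((real j + 1) * (real m + 1))))"
      by (simp add: 3 power2_eq_square power3_eq_cube powr_minus_divide)
    also have "\<dots> \<le> bound_const R ^ 3 * (N powr r * (1 / ((real j + 1) * (real m + 1))))"
      using 4 bound_const_pos[of R] by (intro mult_left_mono mult_right_mono) auto
    also have "1 / ((real j + 1) * (real m + 1)) = (1 / (real j + 1) + 1 / (real m + 1)) / (N + 1)"
      unfolding jm[symmetric] by (simp add: divide_simps)
    also have "bound_const R ^ 3 * (N powr r * ((1 / (real j + 1) + 1 / (real m + 1)) / (N + 1))) \<le>
       bound_const R ^ 3 * (N powr r * ((1 / (real j + 1) + 1 / (real m + 1)) / N))"
      using bound_const_pos[of R] N by (intro mult_left_mono divide_left_mono) auto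
    also have "N powr r * ((1 / (real j + 1) + 1 / (real m + 1)) / N) = N powr (r - 1) * (1 / (real j + 1) + 1 / (real m + 1))"
      using N by (simp add: powr_diff)
    finally show "norm (hyp_coef a j * pow_coef a (n - j)) \<le> bound_const R ^ 3 * (N powr (r - 1) * (1 / (real j + 1) + 1 / (real (n - j) + 1)))"
      by (simp add: norm_mult m_def)
  qed
  also have "\<dots> = bound_const R ^ 3 * (N powr (r - 1) * (\<Sum>j\<le>n. 1 / (real j + 1) + 1 / (real (n - j) + 1)))"
    by (simp add: sum_distrib_left)
  also have "(\<Sum>j\<le>n. 1 / (real j + 1) + 1 / (real (n - j) + 1)) = 2 * harm (Suc n)"
  proof -
    have "(\<Sum>j\<le>n. 1 / (real (n - j) + 1)) = (\<Sum>j\<le>n. 1 / (real j + 1))"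
      by (rule sum.reindex_bij_witness[of _ "\<lambda>j. n - j" "\<lambda>j. n - j"]) auto
    moreover have "(\<Sum>j\<le>n. 1 / (real j + 1)) = harm (Suc n)"
      by (simp add: harm_altdef lessThan_Suc_atMost inverse_eq_divide add.commute)
    ultimately show ?thesis by (simp add: sum.distrib)
  qed
  also have "bound_const R ^ 3 * (N powr (r - 1) * (2 * harm (Suc n))) \<le> bound_const R ^ 3 * (N powr (r - 1) * (2 * ((2 + 1 / r) * N powr r)))"
  proof (intro mult_left_mono)
    have "harm (Suc n) \<le> 1 + ln N" using harm_le_ln[of "Suc n"] by (simp add: N_def add.commute)
    also have "ln N \<le> N powr r / r" using N r by (intro ln_powr_bound) auto
    also have "1 \<le> N powr r" using N r by (simp add: ge_one_powr_ge_zero)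
    also have "N powr r + N powr r / r \<le> (2 + 1 / r) * N powr r" using N r by (simp add: algebra_simps)
    finally show "harm (Suc n) \<le> (2 + 1 / r) * N powr r" by simp
  qed (use bound_const_pos[of R] in auto)
  also have "\<dots> = bound_const R ^ 3 * (2 * (2 + 1 / r)) * (N powr (r - 1) * N powr r)" by (simp add: mult_ac)
  also have "N powr (r - 1) * N powr r = N powr (2 * r - 1)" by (simp add: powr_add[symmetric])
  finally show "norm (conv_coef a n) \<le> bound_const R ^ 3 * (2 * (2 + 1 / r)) * (real n + 1) powr (2 * r - 1)"
    by (simp add: N_def)
qed

section \<open>The hypergeometric series at 1\<close>

text \<open>
  The coefficients \<open>hyp_coef \<alpha> j\<close> with a variable lower parameter \<open>c\<close>.
\<close>

definition hyp_term :: "real \<Rightarrow> real \<Rightarrow> nat \<Rightarrow> real" where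
  "hyp_term \<alpha> c j = pochhammer (- \<alpha>) j * pochhammer (1 - \<alpha>) j / (fact j * pochhammer c j)"

lemma pochhammer_of_real: "pochhammer (of_real x) n = (of_real (pochhammer x n) :: complex)"
  by (simp add: pochhammer_prod)

lemma hyp_coef_of_real: "hyp_coef (of_real \<alpha>) j = of_real (hyp_term \<alpha> 2 j)"
proof -
  have "pochhammer 2 j = (fact (Suc j) :: real)"
    using pochhammer_rec[of "1 :: real" j] by (simp add: pochhammer_fact del: fact_Suc)
  thus ?thesis
    by (simp add: hyp_coef_def hyp_term_def pochhammer_of_real[symmetric] del: fact_Suc)
qed

lemma hyp_term_0 [simp]: "hyp_term \<alpha> c 0 = 1"
  by (simp add: hyp_term_def)

lemma abs_hyp_term_le:
  assumes c: "c \<ge> 2" and \<alpha>: "\<alpha> > 0"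
  shows "\<bar>hyp_term \<alpha> c j\<bar> \<le> (bound_const \<alpha>)\<^sup>2 * (real j + 1) powr (- 2 * \<alpha> - 2)"
proof -
  have "pochhammer 2 j \<le> pochhammer c j"
    unfolding pochhammer_prod using c by (intro prod_mono) auto
  moreover have "pochhammer (2::real) j > 0" by (rule pochhammer_pos) simp
  ultimately have "\<bar>hyp_term \<alpha> c j\<bar> \<le> \<bar>hyp_term \<alpha> 2 j\<bar>"
    unfolding hyp_term_def abs_mult abs_divide by (intro divide_left_mono mult_left_mono mult_pos_pos) auto
  also have "\<dots> = norm (hyp_coef (of_real \<alpha>) j)" by (simp add: hyp_coef_of_real)
  also have "\<dots> \<le> (bound_const \<alpha>)\<^sup>2 * (real j + 1) powr (- 2 * \<alpha> - 2)"
    using norm_hyp_coef_le[of "of_real \<alpha>" \<alpha> j] \<alpha> by simp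
  finally show ?thesis .
qed

lemma summable_hyp_term_bound: "\<alpha> > 0 \<Longrightarrow> summable (\<lambda>j. C * (real j + 1) powr (- 2 * \<alpha> - 2))"
proof (intro summable_mult)
  assume "\<alpha> > 0"
  moreover have "- 2 * \<alpha> - 2 = - 1 - 2 * (\<alpha> + 1 / 2)" by simp
  ultimately show "summable (\<lambda>j. (real j + 1) powr (- 2 * \<alpha> - 2))"
    using summable_Suc_powr[of "\<alpha> + 1 / 2"] by (simp only:)
qed

lemma summable_hyp_term: "c \<ge> 2 \<Longrightarrow> \<alpha> > 0 \<Longrightarrow> summable (hyp_term \<alpha> c)"
  using abs_hyp_term_le by (intro summable_comparison_test'[OF summable_hyp_term_bound[of \<alpha> "(bound_const \<alpha>)\<^sup>2"], of 0]) auto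

lemma hyp_term_tends_0:
  assumes "c \<ge> 2" "\<alpha> > 0"
  shows "(\<lambda>j. real j * hyp_term \<alpha> c j) \<longlonglongrightarrow> 0"
proof (rule Lim_null_comparison)
  show "(\<lambda>j. (bound_const \<alpha>)\<^sup>2 * (real j + 1) powr (- 2 * \<alpha> - 1)) \<longlonglongrightarrow> 0"
    using assms by real_asymp
  show "\<forall>\<^sub>F j in sequentially. norm (real j * hyp_term \<alpha> c j) \<le> (bound_const \<alpha>)\<^sup>2 * (real j + 1) powr (- 2 * \<alpha> - 1)"
  proof (intro always_eventually allI)
    fix j
    have "norm (real j * hyp_term \<alpha> c j) \<le> (real j + 1) * ((bound_const \<alpha>)\<^sup>2 * (real j + 1) powr (- 2 * \<alpha> - 2))"
      unfolding norm_mult using abs_hyp_term_le[OF assms] by (intro mult_mono) auto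
    also have "\<dots> = (bound_const \<alpha>)\<^sup>2 * ((real j + 1) powr 1 * (real j + 1) powr (- 2 * \<alpha> - 2))" by simp
    also have "(real j + 1) powr 1 * (real j + 1) powr (- 2 * \<alpha> - 2) = (real j + 1) powr (- 2 * \<alpha> - 1)"
      by (simp only: powr_add[symmetric]) (rule arg_cong[of _ _ "(powr) _"], simp)
    finally show "norm (real j * hyp_term \<alpha> c j) \<le> (bound_const \<alpha>)\<^sup>2 * (real j + 1) powr (- 2 * \<alpha> - 1)" .
  qed
qed

text \<open>
  The contiguous relation in the lower parameter that underlies Gauss's summation formula; the right-hand side
  telescopes.
\<close>

lemma hyp_term_telescope:
  assumes c: "c > 0"
  shows "c * (c - 1 + 2 * \<alpha>) * hyp_term \<alpha> c j - (c + \<alpha>) * (c - 1 + \<alpha>) * hyp_term \<alpha> (c + 1) j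
     = c * (real j * hyp_term \<alpha> c j - real (Suc j) * hyp_term \<alpha> c (Suc j))"
proof -
  define u where "u = hyp_term \<alpha> c j"
  have pc: "pochhammer c j > 0" "pochhammer (c + 1) j > 0" using c by (auto intro: pochhammer_pos)
  have "c * pochhammer (c + 1) j = pochhammer c j * (c + real j)"
    using pochhammer_rec[of c j] pochhammer_rec'[of c j] by (simp add: mult.commute)
  hence 1: "hyp_term \<alpha> (c + 1) j = u * c / (c + real j)"
    using c pc by (auto simp: hyp_term_def u_def divide_simps mult_ac)
  have 2: "real (Suc j) * hyp_term \<alpha> c (Suc j) = u * (real j - \<alpha>) * (1 - \<alpha> + real j) / (c + real j)"
    using c pc by (simp add: hyp_term_def u_def pochhammer_rec' divide_simps)
  have cj: "c + real j \<noteq> 0" using c by (metis add_pos_nonneg of_nat_0_le_iff less_irrefl)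
  show ?thesis unfolding 1 2 u_def[symmetric] using cj
    by (simp add: divide_simps) (simp add: algebra_simps)
qed

lemma suminf_hyp_term_Suc:
  assumes c: "c \<ge> 2" and \<alpha>: "\<alpha> > 0"
  shows "c * (c - 1 + 2 * \<alpha>) * suminf (hyp_term \<alpha> c) = (c + \<alpha>) * (c - 1 + \<alpha>) * suminf (hyp_term \<alpha> (c + 1))"
proof -
  have "(\<lambda>j. c * (real j * hyp_term \<alpha> c j - real (Suc j) * hyp_term \<alpha> c (Suc j))) sums (c * (real 0 * hyp_term \<alpha> c 0 - 0))"
    by (intro sums_mult telescope_sums' hyp_term_tends_0 assms)
  hence "(\<lambda>j. c * (c - 1 + 2 * \<alpha>) * hyp_term \<alpha> c j - (c + \<alpha>) * (c - 1 + \<alpha>) * hyp_term \<alpha> (c + 1) j) sums 0"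
    using c by (subst hyp_term_telescope) auto
  moreover have "(\<lambda>j. c * (c - 1 + 2 * \<alpha>) * hyp_term \<alpha> c j - (c + \<alpha>) * (c - 1 + \<alpha>) * hyp_term \<alpha> (c + 1) j) sums
      (c * (c - 1 + 2 * \<alpha>) * suminf (hyp_term \<alpha> c) - (c + \<alpha>) * (c - 1 + \<alpha>) * suminf (hyp_term \<alpha> (c + 1)))"
    using c \<alpha> by (intro sums_diff sums_mult summable_sums summable_hyp_term) auto
  ultimately show ?thesis using sums_unique2 by fastforce
qed

lemma suminf_hyp_term_shift:
  assumes \<alpha>: "\<alpha> > 0"
  shows "pochhammer 2 n * pochhammer (1 + 2 * \<alpha>) n * suminf (hyp_term \<alpha> 2) =
         pochhammer (2 + \<alpha>) n * pochhammer (1 + \<alpha>) n * suminf (hyp_term \<alpha> (2 + real n))"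
proof (induction n)
  case (Suc n)
  let ?c = "2 + real n"
  have "pochhammer 2 (Suc n) * pochhammer (1 + 2 * \<alpha>) (Suc n) * suminf (hyp_term \<alpha> 2) =
      ?c * (?c - 1 + 2 * \<alpha>) * (pochhammer 2 n * pochhammer (1 + 2 * \<alpha>) n * suminf (hyp_term \<alpha> 2))"
    by (simp add: pochhammer_rec' algebra_simps)
  also have "\<dots> = pochhammer (2 + \<alpha>) n * pochhammer (1 + \<alpha>) n * (?c * (?c - 1 + 2 * \<alpha>) * suminf (hyp_term \<alpha> ?c))"
    unfolding Suc.IH by (simp only: mult_ac)
  also have "?c * (?c - 1 + 2 * \<alpha>) * suminf (hyp_term \<alpha> ?c) = (?c + \<alpha>) * (?c - 1 + \<alpha>) * suminf (hyp_term \<alpha> (?c + 1))"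
    using \<alpha> by (intro suminf_hyp_term_Suc) auto
  also have "pochhammer (2 + \<alpha>) n * pochhammer (1 + \<alpha>) n * \<dots> = ((2 + \<alpha> + real n) * pochhammer (2 + \<alpha>) n) * ((1 + \<alpha> + real n) * pochhammer (1 + \<alpha>) n) * suminf (hyp_term \<alpha> (?c + 1))"
    by (simp add: algebra_simps)
  also have "\<dots> = pochhammer (2 + \<alpha>) (Suc n) * pochhammer (1 + \<alpha>) (Suc n) * suminf (hyp_term \<alpha> (2 + real (Suc n)))"
    by (simp add: pochhammer_rec' add_ac)
  finally show ?case .
qed simp

lemma suminf_hyp_term_tends_1:
  assumes \<alpha>: "\<alpha> > 0"
  shows "(\<lambda>n. suminf (hyp_term \<alpha> (2 + real n))) \<longlonglongrightarrow> 1"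
proof -
  have lim: "(\<lambda>n. hyp_term \<alpha> (2 + real n) k) \<longlonglongrightarrow> (if k = 0 then 1 else 0)" for k
  proof (cases "k = 0")
    case False
    have "filterlim (\<lambda>n. pochhammer (2 + real n) k) at_top sequentially"
    proof (rule filterlim_at_top_mono[OF filterlim_real_sequentially])
      obtain k' where k': "k = Suc k'" using False not0_implies_Suc by blast
      have "real n \<le> pochhammer (2 + real n) k" for n
      proof -
        have "(\<Prod>i<k'. 1) \<le> (\<Prod>i<k'. 2 + real n + 1 + real i)" by (intro prod_mono) auto
        hence "1 \<le> pochhammer (2 + real n + 1) k'" by (simp add: pochhammer_prod lessThan_atLeast0)
        hence "(2 + real n) * 1 \<le> (2 + real n) * pochhammer (2 + real n + 1) k'" by (intro mult_left_mono) auto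
        moreover have "real n \<le> (2 + real n) * 1" by simp
        ultimately show ?thesis unfolding k' pochhammer_rec by (rule order_trans[rotated])
      qed
      thus "\<forall>\<^sub>F n in sequentially. real n \<le> pochhammer (2 + real n) k" by simp
    qed
    hence "(\<lambda>n. (pochhammer (- \<alpha>) k * pochhammer (1 - \<alpha>) k / fact k) / pochhammer (2 + real n) k) \<longlonglongrightarrow> 0"
      by (intro tendsto_divide_0[OF tendsto_const] filterlim_at_top_imp_at_infinity)
    thus ?thesis using False by (simp add: hyp_term_def)
  qed simp
  have "((\<lambda>n. suminf (\<lambda>k. hyp_term \<alpha> (2 + real n) k)) \<longlongrightarrow> suminf (\<lambda>k::nat. if k = 0 then 1 else 0)) sequentially"
  proof (rule tannerys_theorem[THEN conjunct2, THEN conjunct2, OF lim])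
    show "\<forall>\<^sub>F (k, n) in sequentially \<times>\<^sub>F sequentially. norm (hyp_term \<alpha> (2 + real n) k) \<le> (bound_const \<alpha>)\<^sup>2 * (real k + 1) powr (- 2 * \<alpha> - 2)"
      using abs_hyp_term_le[OF _ \<alpha>] by (intro always_eventually) auto
  qed (use summable_hyp_term_bound[OF \<alpha>] in auto)
  moreover have "suminf (\<lambda>k::nat. if k = 0 then 1 else 0 :: real) = 1"
    using sums_single[of 0 "\<lambda>_. 1 :: real"] by (simp add: sums_iff)
  ultimately show ?thesis by simp
qed

text \<open>
  Gauss's formula in the case at hand. Raising the lower parameter \<open>n\<close> times turns the sum into a series that
  tends to \<open>1\<close>, multiplied by a quotient of Pochhammer symbols, which tends to a quotient of Gamma values.
\<close>

theorem suminf_hyp_term_eq_K: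
  assumes \<alpha>: "\<alpha> > 0"
  shows "suminf (hyp_term \<alpha> 2) = K \<alpha>"
proof -
  have pos: "pochhammer x n > 0" if "x > 0" for x :: real and n using that by (rule pochhammer_pos)
  define q where "q n = Gamma_series 2 n * Gamma_series (1 + 2 * \<alpha>) n / (Gamma_series (2 + \<alpha>) n * Gamma_series (1 + \<alpha>) n)" for n
  have q: "q n = pochhammer (2 + \<alpha>) (Suc n) * pochhammer (1 + \<alpha>) (Suc n) / (pochhammer 2 (Suc n) * pochhammer (1 + 2 * \<alpha>) (Suc n))" if "n > 0" for n
  proof -
    define l where "l = ln (real n)"
    have e: "exp (2 * l) * exp ((1 + 2 * \<alpha>) * l) = exp ((2 + \<alpha>) * l) * exp ((1 + \<alpha>) * l)"
      by (simp add: exp_add[symmetric] algebra_simps)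
    have "q n = (exp (2 * l) * exp ((1 + 2 * \<alpha>) * l)) / (exp ((2 + \<alpha>) * l) * exp ((1 + \<alpha>) * l)) *
       (pochhammer (2 + \<alpha>) (Suc n) * pochhammer (1 + \<alpha>) (Suc n) / (pochhammer 2 (Suc n) * pochhammer (1 + 2 * \<alpha>) (Suc n)))"
      using pos[of 2 "Suc n"] pos[of "2 + \<alpha>" "Suc n"] pos[of "1 + \<alpha>" "Suc n"] pos[of "1 + 2 * \<alpha>" "Suc n"] \<alpha>
      by (simp add: q_def Gamma_series_def l_def divide_simps mult_ac del: fact_Suc)
    thus ?thesis unfolding e by simp
  qed
  have eqn: "suminf (hyp_term \<alpha> 2) = q n * suminf (hyp_term \<alpha> (2 + real (Suc n)))" if "n > 0" for n
    using suminf_hyp_term_shift[OF \<alpha>, of "Suc n"] pos[of 2 "Suc n"] pos[of "1 + 2 * \<alpha>" "Suc n"] \<alpha>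
    unfolding q[OF that] by (simp add: divide_simps mult_ac)
  have "eventually (\<lambda>n. q n * suminf (hyp_term \<alpha> (2 + real (Suc n))) = suminf (hyp_term \<alpha> 2)) sequentially"
    using eventually_gt_at_top[of "0::nat"] by eventually_elim (rule eqn[symmetric])
  hence "(\<lambda>n. q n * suminf (hyp_term \<alpha> (2 + real (Suc n)))) \<longlonglongrightarrow> suminf (hyp_term \<alpha> 2)"
    by (rule tendsto_eventually)
  moreover have "Gamma (2 + \<alpha>) > 0" "Gamma (1 + \<alpha>) > 0"
    using \<alpha> by (intro Gamma_real_pos; simp)+
  hence "Gamma (2 + \<alpha>) \<noteq> 0" "Gamma (1 + \<alpha>) \<noteq> 0" by (metis less_irrefl)+
  hence "(\<lambda>n. q n * suminf (hyp_term \<alpha> (2 + real (Suc n)))) \<longlonglongrightarrow> Gamma 2 * Gamma (1 + 2 * \<alpha>) / (Gamma (2 + \<alpha>) * Gamma (1 + \<alpha>)) * 1"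
    unfolding q_def using \<alpha>
    by (intro tendsto_intros LIMSEQ_Suc[OF suminf_hyp_term_tends_1]) auto
  ultimately have "suminf (hyp_term \<alpha> 2) = Gamma 2 * Gamma (1 + 2 * \<alpha>) / (Gamma (2 + \<alpha>) * Gamma (1 + \<alpha>)) * 1"
    by (rule LIMSEQ_unique)
  moreover have "Gamma (2 :: real) = 1" using Gamma_fact[of 1, where 'a = real] by simp
  ultimately show ?thesis by (simp add: K_def mult.commute)
qed

section \<open>Asymptotics of the generating function\<close>

lemma K_pos: "\<alpha> > 0 \<Longrightarrow> K \<alpha> > 0"
  unfolding K_def by (intro divide_pos_pos mult_pos_pos Gamma_real_pos) auto

text \<open>
  The Gamma series converges locally uniformly, so its argument may vary along with the index.
\<close>

lemma Gamma_series_tendsto_seq: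
  fixes a :: "nat \<Rightarrow> complex"
  assumes a: "a \<longlonglongrightarrow> z" and z: "Re z > 0" and m: "filterlim m at_top sequentially"
  shows "(\<lambda>n. Gamma_series (a n) (m n)) \<longlonglongrightarrow> Gamma z"
proof -
  have notin: "w \<notin> \<int>\<^sub>\<le>\<^sub>0" if "Re w > 0" for w using that by (auto elim!: nonpos_Ints_cases)
  obtain d where d: "d > 0" "uniformly_convergent_on (ball z d) (\<lambda>n z. ln_Gamma_series z n)"
    using ln_Gamma_series_complex_converges'[OF notin[OF z]] by blast
  then obtain l where l: "uniform_limit (ball z d) (\<lambda>n z. ln_Gamma_series z n) l sequentially"
    by (auto simp: uniformly_convergent_on_def)
  define S where "S = ball z d \<inter> {w. Re w > 0}"
  have "open S" unfolding S_def by (intro open_Int open_ball open_halfspace_Re_gt)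
  moreover have "z \<in> S" using d z by (simp add: S_def)
  ultimately have aS: "eventually (\<lambda>n. a n \<in> S) sequentially" by (rule topological_tendstoD[OF a])
  have lS: "l w = ln_Gamma w" if "w \<in> S" for w
    using tendsto_uniform_limitI[OF l, of w] ln_Gamma_complex_LIMSEQ[OF notin, of w] that LIMSEQ_unique
    by (auto simp: S_def)
  have "(\<lambda>n. ln_Gamma_series (a n) (m n) - ln_Gamma (a n)) \<longlonglongrightarrow> 0"
  proof (rule tendstoI)
    fix e :: real assume "e > 0"
    from uniform_limitD[OF l this] have "\<forall>\<^sub>F n in sequentially. \<forall>x\<in>ball z d. dist (ln_Gamma_series x (m n)) (l x) < e"
      using m by (rule eventually_compose_filterlim)
    with aS show "\<forall>\<^sub>F n in sequentially. dist (ln_Gamma_series (a n) (m n) - ln_Gamma (a n)) 0 < e"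
    proof eventually_elim
      case (elim n)
      hence "a n \<in> ball z d" "l (a n) = ln_Gamma (a n)" using lS by (auto simp: S_def)
      with bspec[OF elim(2), of "a n"] show ?case by (simp add: dist_norm)
    qed
  qed
  moreover have "(\<lambda>n. ln_Gamma (a n)) \<longlonglongrightarrow> ln_Gamma z"
    using isCont_ln_Gamma_complex[OF continuous_ident, of z] z
    by (intro isCont_tendsto_compose[OF _ a]) (auto simp: complex_nonpos_Reals_iff)
  ultimately have "(\<lambda>n. (ln_Gamma_series (a n) (m n) - ln_Gamma (a n)) + ln_Gamma (a n)) \<longlonglongrightarrow> 0 + ln_Gamma z"
    by (rule tendsto_add)
  hence "(\<lambda>n. exp (ln_Gamma_series (a n) (m n))) \<longlonglongrightarrow> exp (ln_Gamma z)" by (intro tendsto_exp) simp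
  moreover have "exp (ln_Gamma z) = Gamma z" using notin[OF z] by (simp add: Gamma_complex_altdef)
  moreover have "eventually (\<lambda>n. exp (ln_Gamma_series (a n) (m n)) = Gamma_series (a n) (m n)) sequentially"
    using aS eventually_compose_filterlim[OF eventually_gt_at_top[of 0] m]
    by eventually_elim (auto intro!: exp_ln_Gamma_series_complex notin simp: S_def)
  ultimately show ?thesis by (simp add: tendsto_cong)
qed

lemma pow_coef_eq_Gamma_series:
  assumes "Re a > 0" "m > 0"
  shows "pow_coef a m = exp (a * of_real (ln (real m))) / ((a + of_nat m) * Gamma_series a m)"
proof -
  have ne: "a + of_nat i \<noteq> 0" for i
    using assms by (auto simp: complex_eq_iff)
  have "pochhammer a (Suc m) \<noteq> 0"
  proof
    assume "pochhammer a (Suc m) = 0"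
    then obtain k where "a = - of_nat k" by (auto simp: pochhammer_eq_0_iff)
    hence "a + of_nat k = 0" by simp
    thus False using ne by blast
  qed
  with ne[of m] show ?thesis by (simp add: pow_coef_def Gamma_series_def pochhammer_rec' divide_simps mult_ac)
qed

lemma pow_coef_tendsto:
  fixes a :: "nat \<Rightarrow> complex"
  assumes a: "a \<longlonglongrightarrow> z" and z: "Re z > 0"
  shows "(\<lambda>n. pow_coef (a n) (n - j) * exp ((1 - a n) * of_real (ln (real n + 1)))) \<longlonglongrightarrow> 1 / Gamma z"
proof -
  have m: "filterlim (\<lambda>n. n - j) at_top sequentially" by (rule filterlim_minus_const_nat_at_top)
  have G: "(\<lambda>n. Gamma_series (a n) (n - j)) \<longlonglongrightarrow> Gamma z" by (rule Gamma_series_tendsto_seq[OF a z m])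
  have "Gamma z \<noteq> 0" using z by (auto simp: Gamma_eq_zero_iff elim!: nonpos_Ints_cases)
  have ra: "(\<lambda>n. ln (real n + 1) - ln (real (n - j))) \<longlonglongrightarrow> 0"
  proof -
    have "(\<lambda>n. ln (real n + 1) - ln (real n - real j)) \<longlonglongrightarrow> 0" by real_asymp
    moreover have "eventually (\<lambda>n. ln (real n + 1) - ln (real n - real j) = ln (real n + 1) - ln (real (n - j))) sequentially"
      using eventually_ge_at_top[of j] by eventually_elim (simp add: of_nat_diff)
    ultimately show ?thesis by (simp add: tendsto_cong)
  qed
  have rm: "(\<lambda>n. a n / of_nat (n - j)) \<longlonglongrightarrow> 0"
    by (intro tendsto_divide_0[OF a] filterlim_compose[OF tendsto_of_nat m])
  have "(\<lambda>n. exp ((1 - a n) * of_real (ln (real n + 1) - ln (real (n - j)))) / ((a n / of_nat (n - j) + 1) * Gamma_series (a n) (n - j)))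
      \<longlonglongrightarrow> exp ((1 - z) * of_real 0) / ((0 + 1) * Gamma z)"
    using \<open>Gamma z \<noteq> 0\<close> by (intro tendsto_intros a ra rm G) auto
  moreover have "eventually (\<lambda>n. exp ((1 - a n) * of_real (ln (real n + 1) - ln (real (n - j)))) / ((a n / of_nat (n - j) + 1) * Gamma_series (a n) (n - j))
       = pow_coef (a n) (n - j) * exp ((1 - a n) * of_real (ln (real n + 1)))) sequentially"
  proof -
    have "eventually (\<lambda>n. Re (a n) > 0) sequentially"
      using order_tendstoD(1)[OF tendsto_Re[OF a] z] .
    thus ?thesis using eventually_compose_filterlim[OF eventually_gt_at_top[of 0] m]
    proof eventually_elim
      fix n assume n: "Re (a n) > 0" "0 < n - j"
      define k l where "k = n - j" and "l = complex_of_real (ln (real k))"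
      have k: "k > 0" using n by (simp add: k_def)
      have el: "exp l = of_nat k" using k by (simp add: l_def exp_of_real)
      have "exp ((1 - a n) * of_real (ln (real n + 1) - ln (real k))) = exp ((1 - a n) * of_real (ln (real n + 1))) * (exp (a n * l) / exp l)"
        by (simp add: l_def exp_diff[symmetric] exp_add[symmetric] algebra_simps)
      moreover have "a n / of_nat k + 1 = (a n + of_nat k) / of_nat k" using k by (simp add: field_simps)
      ultimately show "exp ((1 - a n) * of_real (ln (real n + 1) - ln (real (n - j)))) / ((a n / of_nat (n - j) + 1) * Gamma_series (a n) (n - j))
       = pow_coef (a n) (n - j) * exp ((1 - a n) * of_real (ln (real n + 1)))"
        unfolding k_def[symmetric] using k by (subst pow_coef_eq_Gamma_series[OF n(1) k]) (simp add: el l_def[symmetric] mult_ac)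
    qed
  qed
  ultimately show ?thesis by (simp add: tendsto_cong)
qed

lemma hyp_coef_tendsto: "(a \<longlongrightarrow> z) F \<Longrightarrow> ((\<lambda>n. hyp_coef (a n) j) \<longlongrightarrow> hyp_coef z j) F"
  unfolding hyp_coef_def pochhammer_prod by (intro tendsto_intros) (auto simp del: fact_Suc)

text \<open>
  Tannery's theorem: each term of the convolution, divided by \<open>(n + 1) powr (a n - 1)\<close>, converges to the
  hypergeometric coefficient over \<open>Gamma \<alpha>\<close>, and \<open>norm_conv_term_le\<close> provides a summable bound.
\<close>

theorem conv_coef_tendsto:
  fixes a :: "nat \<Rightarrow> complex"
  assumes a: "a \<longlonglongrightarrow> of_real \<alpha>" and \<alpha>: "\<alpha> > 0"
  shows "(\<lambda>n. conv_coef (a n) n * exp ((1 - a n) * of_real (ln (real n + 1)))) \<longlonglongrightarrow> of_real (K \<alpha> / Gamma \<alpha>)"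
proof -
  define s where "s n = exp ((1 - a n) * of_real (ln (real n + 1)))" for n
  define T where "T j n = (if j \<le> n then hyp_coef (a n) j * (pow_coef (a n) (n - j) * s n) else 0)" for j n
  define r R where "r = \<alpha> / 2" and "R = \<alpha> + 1"
  have lim: "(\<lambda>n. T j n) \<longlonglongrightarrow> hyp_coef (of_real \<alpha>) j * (1 / Gamma (of_real \<alpha>))" for j
  proof (rule Lim_transform_eventually)
    show "(\<lambda>n. hyp_coef (a n) j * (pow_coef (a n) (n - j) * s n)) \<longlonglongrightarrow> hyp_coef (of_real \<alpha>) j * (1 / Gamma (of_real \<alpha>))"
      unfolding s_def using \<alpha> by (intro tendsto_mult hyp_coef_tendsto[OF a] pow_coef_tendsto[OF a]) auto
    show "\<forall>\<^sub>F n in sequentially. hyp_coef (a n) j * (pow_coef (a n) (n - j) * s n) = T j n"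
      using eventually_ge_at_top[of j] by eventually_elim (simp add: T_def)
  qed
  have "eventually (\<lambda>n. r < Re (a n)) sequentially"
    using order_tendstoD(1)[OF tendsto_Re[OF a], of r] \<alpha> by (simp add: r_def)
  moreover have "eventually (\<lambda>n. norm (a n) < R) sequentially"
    using order_tendstoD(2)[OF tendsto_norm[OF a], of R] \<alpha> by (simp add: R_def)
  ultimately have ev: "eventually (\<lambda>n. \<forall>j. norm (T j n) \<le> bound_const R ^ 3 * (real j + 1) powr (- 1 - 2 * r)) sequentially"
  proof eventually_elim
    fix n assume n: "r < Re (a n)" "norm (a n) < R"
    show "\<forall>j. norm (T j n) \<le> bound_const R ^ 3 * (real j + 1) powr (- 1 - 2 * r)"
    proof
      fix j
      show "norm (T j n) \<le> bound_const R ^ 3 * (real j + 1) powr (- 1 - 2 * r)"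
      proof (cases "j \<le> n")
        case True
        have ns: "norm (s n) = (real n + 1) powr (1 - Re (a n))" by (simp add: s_def powr_def)
        have "norm (T j n) = norm (hyp_coef (a n) j * pow_coef (a n) (n - j)) * (real n + 1) powr (1 - Re (a n))"
          using True by (simp add: T_def norm_mult ns)
        also have "\<dots> \<le> (bound_const R ^ 3 * (real n + 1) powr (Re (a n) - 1) * (real j + 1) powr (- 1 - 2 * r)) * (real n + 1) powr (1 - Re (a n))"
          using n \<alpha> True by (intro mult_right_mono norm_conv_term_le) (auto simp: r_def)
        also have "\<dots> = bound_const R ^ 3 * (real j + 1) powr (- 1 - 2 * r) * ((real n + 1) powr (Re (a n) - 1) * (real n + 1) powr (1 - Re (a n)))"
          by (simp only: mult_ac)
        also have "(real n + 1) powr (Re (a n) - 1) * (real n + 1) powr (1 - Re (a n)) = 1"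
          by (simp add: powr_add[symmetric])
        finally show ?thesis by simp
      qed (use bound_const_pos[of R] in \<open>auto simp: T_def\<close>)
    qed
  qed
  have "((\<lambda>n. suminf (\<lambda>j. T j n)) \<longlongrightarrow> suminf (\<lambda>j. hyp_coef (of_real \<alpha>) j * (1 / Gamma (of_real \<alpha>)))) sequentially"
  proof (rule tannerys_theorem[THEN conjunct2, THEN conjunct2, OF lim])
    have "eventually (\<lambda>(k::nat, n). \<forall>j. norm (T j n) \<le> bound_const R ^ 3 * (real j + 1) powr (- 1 - 2 * r)) (sequentially \<times>\<^sub>F sequentially)"
      using ev by (subst eventually_prod2) auto
    thus "\<forall>\<^sub>F (k, n) in sequentially \<times>\<^sub>F sequentially. norm (T k n) \<le> bound_const R ^ 3 * (real k + 1) powr (- 1 - 2 * r)"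
      by eventually_elim auto
    show "summable (\<lambda>k. bound_const R ^ 3 * (real k + 1) powr (- 1 - 2 * r))"
      using \<alpha> by (intro summable_mult summable_Suc_powr) (simp add: r_def)
  qed auto
  moreover have "suminf (\<lambda>j. T j n) = conv_coef (a n) n * s n" for n
  proof -
    have "suminf (\<lambda>j. T j n) = (\<Sum>j\<le>n. T j n)" by (rule suminf_finite) (auto simp: T_def)
    also have "\<dots> = (\<Sum>j\<le>n. hyp_coef (a n) j * pow_coef (a n) (n - j) * s n)" by (rule sum.cong) (auto simp: T_def)
    finally show ?thesis by (simp add: conv_coef_def sum_distrib_right)
  qed
  moreover have "suminf (\<lambda>j. hyp_coef (of_real \<alpha>) j * (1 / Gamma (of_real \<alpha>))) = of_real (K \<alpha> / Gamma \<alpha>)"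
  proof -
    have "(\<lambda>j. complex_of_real (hyp_term \<alpha> 2 j)) sums of_real (K \<alpha>)"
      using summable_sums[OF summable_hyp_term[of 2 \<alpha>]] \<alpha> by (simp add: suminf_hyp_term_eq_K sums_of_real)
    hence "(\<lambda>j. hyp_coef (of_real \<alpha>) j * (1 / Gamma (of_real \<alpha>))) sums (of_real (K \<alpha>) * (1 / Gamma (of_real \<alpha>)))"
      unfolding hyp_coef_of_real by (rule sums_mult2)
    thus ?thesis by (simp add: sums_iff Gamma_complex_of_real)
  qed
  ultimately show ?thesis by (simp add: s_def)
qed

section \<open>The saddle point\<close>

text \<open>
  After halving the angle the Taylor polynomial of degree 4 is precise enough on the whole range.
\<close>

lemma one_minus_cos_ge:
  assumes "\<bar>\<theta>\<bar> \<le> pi"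
  shows "\<theta>\<^sup>2 / 6 \<le> 1 - cos \<theta>"
proof -
  define x where "x = \<theta> / 2"
  have x: "\<bar>x\<bar> \<le> 2" using assms pi_less_4 by (simp add: x_def)
  have "cos x \<ge> 0" using assms by (intro cos_ge_zero) (auto simp: x_def)
  obtain u where "cos x = (\<Sum>m<4. cos_coeff m * x ^ m) + (cos (u + 1 / 2 * real 4 * pi) / fact 4) * x ^ 4"
    using Maclaurin_cos_expansion[of x 4] by blast
  moreover have "(\<Sum>m<4. cos_coeff m * x ^ m) = 1 - x\<^sup>2 / 2"
  proof -
    have "cos_coeff 0 = 1" "cos_coeff 1 = 0" "cos_coeff 2 = - 1 / 2" "cos_coeff 3 = 0"
      by (simp_all add: cos_coeff_def)
    moreover have "{..<4::nat} = {0, 1, 2, 3}" by auto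
    ultimately show ?thesis by simp
  qed
  moreover have "fact 4 = (24 :: real)" by (simp add: fact_numeral)
  moreover have "1 / 2 * real 4 * pi = 2 * pi" by simp
  ultimately have "cos x = 1 - x\<^sup>2 / 2 + cos (u + 2 * pi) / 24 * x ^ 4" by (simp only:)
  also have "cos (u + 2 * pi) / 24 * x ^ 4 \<le> 1 / 24 * x ^ 4"
    by (intro mult_right_mono) auto
  also have "x ^ 4 = x\<^sup>2 * x\<^sup>2" by (simp add: power4_eq_xxxx power2_eq_square)
  also have "1 / 24 * (x\<^sup>2 * x\<^sup>2) \<le> 1 / 24 * (x\<^sup>2 * 4)"
    using power_mono[OF x, of 2] by (intro mult_left_mono) auto
  finally have c: "x\<^sup>2 / 3 \<le> 1 - cos x" by simp
  have "\<theta>\<^sup>2 / 6 = 2 * (x\<^sup>2 / 3)" by (simp add: x_def power_divide)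
  also have "\<dots> \<le> 2 * ((1 - cos x) * (1 + cos x))"
  proof -
    have "(1 - cos x) * 1 \<le> (1 - cos x) * (1 + cos x)"
      using \<open>cos x \<ge> 0\<close> cos_le_one[of x] by (intro mult_left_mono) auto
    thus ?thesis unfolding mult_1_right by (intro mult_left_mono order_trans[OF c]) auto
  qed
  also have "\<dots> = 1 - cos (2 * x)" unfolding cos_double_cos by (simp add: power2_eq_square algebra_simps)
  finally show ?thesis by (simp add: x_def)
qed

lemma exp_i_second_order:
  "((\<lambda>\<theta>. (iexp \<theta> - 1 - \<i> * of_real \<theta>) / of_real (\<theta>\<^sup>2)) \<longlongrightarrow> - 1 / 2) (at (0::real))"
proof (rule Lim_transform[OF tendsto_const])
  let ?f = "\<lambda>\<theta>::real. (iexp \<theta> - 1 - \<i> * of_real \<theta>) / of_real (\<theta>\<^sup>2)"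
  show "((\<lambda>\<theta>. ?f \<theta> - (- 1 / 2)) \<longlongrightarrow> 0) (at (0::real))"
  proof (rule Lim_null_comparison)
    show "((\<lambda>\<theta>::real. \<bar>\<theta>\<bar> / 6) \<longlongrightarrow> 0) (at 0)" by (auto intro!: tendsto_eq_intros)
    have "norm (?f \<theta> - (- 1 / 2)) \<le> \<bar>\<theta>\<bar> / 6" if "\<theta> \<noteq> 0" for \<theta> :: real
    proof -
      have "?f \<theta> - (- 1 / 2) =
          (iexp \<theta> - (\<Sum>k\<le>2. (\<i> * of_real \<theta>) ^ k / fact k)) / of_real (\<theta>\<^sup>2)"
        using that by (simp add: numeral_2_eq_2 power2_eq_square field_simps)
      also have "norm \<dots> = norm (iexp \<theta> - (\<Sum>k\<le>2. (\<i> * of_real \<theta>) ^ k / fact k)) / \<theta>\<^sup>2"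
        by (simp add: norm_divide norm_power)
      also have "\<dots> \<le> (\<bar>\<theta>\<bar> ^ Suc 2 / fact (Suc 2)) / \<theta>\<^sup>2"
        by (intro divide_right_mono iexp_approx1) simp
      also have "\<dots> = \<bar>\<theta>\<bar> / 6" using that by (simp add: power2_eq_square fact_numeral numeral_2_eq_2 divide_simps abs_if)
      finally show ?thesis .
    qed
    thus "\<forall>\<^sub>F \<theta> in at (0::real). norm (?f \<theta> - (- 1 / 2)) \<le> \<bar>\<theta>\<bar> / 6"
      by (simp add: eventually_at_filter)
  qed
qed

lemma exp_i_first_order:
  "((\<lambda>\<theta>. (iexp \<theta> - 1) / of_real \<theta>) \<longlongrightarrow> \<i>) (at (0::real))"
proof -
  have "((\<lambda>\<theta>. (iexp \<theta> - 1 - \<i> * of_real \<theta>) / of_real (\<theta>\<^sup>2) * of_real \<theta> + \<i>) \<longlongrightarrow> - 1 / 2 * of_real 0 + \<i>) (at (0::real))"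
    by (intro tendsto_intros exp_i_second_order)
  moreover have "\<forall>\<^sub>F \<theta> in at (0::real). (iexp \<theta> - 1 - \<i> * of_real \<theta>) / of_real (\<theta>\<^sup>2) * of_real \<theta> + \<i> = (iexp \<theta> - 1) / of_real \<theta>"
    by (simp add: eventually_at_filter) (simp add: power2_eq_square field_simps)
  ultimately show ?thesis by (simp add: tendsto_cong)
qed

text \<open>
  The solution \<open>a\<close> of \<open>a (a + 1) = 2 t e^(\<i>\<theta>)\<close> whose real part is at least \<open>- 1 / 2\<close>.
\<close>

definition saddle_root :: "real \<Rightarrow> real \<Rightarrow> complex" where
  "saddle_root t \<theta> = csqrt (1 / 4 + 2 * of_real t * iexp \<theta>) - 1 / 2"

lemma saddle_root_eq: "saddle_root t \<theta> * (saddle_root t \<theta> + 1) = 2 * (of_real t * iexp \<theta>)"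
proof -
  have "saddle_root t \<theta> * (saddle_root t \<theta> + 1) = (saddle_root t \<theta> + 1 / 2)\<^sup>2 - 1 / 4"
    by (simp add: power2_eq_square algebra_simps)
  also have "(saddle_root t \<theta> + 1 / 2)\<^sup>2 = 1 / 4 + 2 * of_real t * iexp \<theta>"
    by (simp add: saddle_root_def)
  finally show ?thesis by simp
qed

text \<open>
  The parameter \<open>\<alpha>\<close> is the exponent at the saddle point \<open>t\<close>, and \<open>c\<close> is the logarithmic derivative
  \<open>t \<alpha>'(t)\<close> of the exponent as a function of \<open>t\<close>.
\<close>

locale saddle =
  fixes \<alpha> t c :: real
  assumes \<alpha>: "\<alpha> > 0" and t: "t = \<alpha> * (\<alpha> + 1) / 2" and c: "c = \<alpha> * (\<alpha> + 1) / (2 * \<alpha> + 1)"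
begin

lemma t_pos: "t > 0" using \<alpha> by (simp add: t)
lemma t_quarter: "1 / 4 + 2 * t = (\<alpha> + 1 / 2)\<^sup>2" by (simp add: t power2_eq_square algebra_simps)

lemma saddle_root_0: "saddle_root t 0 = of_real \<alpha>"
proof -
  have "1 / 4 + 2 * complex_of_real t = of_real (1 / 4 + 2 * t)" by simp
  also have "\<dots> = of_real ((\<alpha> + 1 / 2)\<^sup>2)" by (simp only: t_quarter)
  also have "csqrt \<dots> = of_real (sqrt ((\<alpha> + 1 / 2)\<^sup>2))" by (rule csqrt_of_real) simp
  also have "sqrt ((\<alpha> + 1 / 2)\<^sup>2) = \<alpha> + 1 / 2" using \<alpha> by simp
  finally show ?thesis by (simp add: saddle_root_def)
qed

lemma saddle_root_tendsto: "(saddle_root t \<longlongrightarrow> of_real \<alpha>) (at 0)"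
proof -
  have "1 / 4 + 2 * complex_of_real t * exp (\<i> * of_real 0) = of_real (1 / 4 + 2 * t)" by simp
  moreover have "1 / 4 + 2 * t > 0" using t_pos by simp
  ultimately have "1 / 4 + 2 * complex_of_real t * exp (\<i> * of_real 0) \<notin> \<real>\<^sub>\<le>\<^sub>0"
    by (simp only: complex_nonpos_Reals_iff) (simp add: not_le)
  hence "(saddle_root t \<longlongrightarrow> saddle_root t 0) (at 0)"
    unfolding saddle_root_def by (intro isCont_tendsto_compose[OF continuous_at_csqrt] tendsto_intros) auto
  thus ?thesis by (simp add: saddle_root_0)
qed

lemma norm_saddle_root_le: "norm (saddle_root t \<theta>) \<le> \<alpha> + 1"
proof -
  have "norm (csqrt (1 / 4 + 2 * of_real t * iexp \<theta>)) = sqrt (norm (1 / 4 + 2 * of_real t * iexp \<theta>))"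
    by simp
  also have "norm (1 / 4 + 2 * of_real t * iexp \<theta>) \<le> 1 / 4 + 2 * t"
    using norm_triangle_ineq[of "1 / 4" "2 * of_real t * iexp \<theta>"] t_pos
    by (simp add: norm_mult)
  hence "sqrt (norm (1 / 4 + 2 * of_real t * iexp \<theta>)) \<le> sqrt ((\<alpha> + 1 / 2)\<^sup>2)"
    unfolding t_quarter[symmetric] by (rule real_sqrt_le_mono)
  also have "\<dots> = \<alpha> + 1 / 2" using \<alpha> by simp
  finally show ?thesis
    using norm_triangle_ineq4[of "csqrt (1 / 4 + 2 * of_real t * iexp \<theta>)" "1 / 2"]
    by (simp add: saddle_root_def)
qed

lemma Re_saddle_root_ge: "- 1 / 2 \<le> Re (saddle_root t \<theta>)"
  using Re_csqrt[of "1 / 4 + 2 * of_real t * iexp \<theta>"] by (simp add: saddle_root_def)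

text \<open>
  For \<open>w = a + 1 / 2\<close> the identity \<open>2 (Re w)\<^sup>2 = |w\<^sup>2| + Re (w\<^sup>2)\<close> reduces the claim to the explicit number \<open>w\<^sup>2\<close>,
  whose modulus is at most \<open>1 / 4 + 2 t\<close> and whose real part is \<open>1 / 4 + 2 t cos \<theta>\<close>.
\<close>

lemma Re_saddle_root_le:
  assumes "\<bar>\<theta>\<bar> \<le> pi"
  shows "Re (saddle_root t \<theta>) \<le> \<alpha> - t / (12 * \<alpha> + 6) * \<theta>\<^sup>2"
proof -
  define z where "z = 1 / 4 + 2 * of_real t * iexp \<theta>"
  define w where "w = csqrt z"
  define \<beta> where "\<beta> = \<alpha> + 1 / 2"
  define m where "m = 1 - cos \<theta>"
  have \<beta>: "\<beta> > 0" "1 / 4 + 2 * t = \<beta>\<^sup>2" using \<alpha> t_quarter by (auto simp: \<beta>_def)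
  have m: "0 \<le> m" "m \<le> 2" "\<theta>\<^sup>2 / 6 \<le> m"
    using one_minus_cos_ge[OF assms] cos_ge_minus_one[of \<theta>] cos_le_one[of \<theta>] by (auto simp: m_def)
  have "norm z \<le> 1 / 4 + 2 * t"
    using norm_triangle_ineq[of "1 / 4" "2 * of_real t * iexp \<theta>"] t_pos
    by (simp add: norm_mult z_def)
  hence nz: "norm z \<le> \<beta>\<^sup>2" by (simp only: \<beta>)
  have "Re (iexp \<theta>) = cos \<theta>" by (simp add: Re_exp)
  hence "Re z = 1 / 4 + 2 * t * cos \<theta>" by (simp add: z_def)
  also have "\<dots> = (1 / 4 + 2 * t) - 2 * t * m" by (simp add: m_def algebra_simps)
  finally have rz: "Re z = \<beta>\<^sup>2 - 2 * t * m" by (simp only: \<beta>)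
  have "w\<^sup>2 = z" by (simp add: w_def)
  hence "Re (w\<^sup>2) = Re z" "(norm w)\<^sup>2 = norm z" by (auto simp: norm_power[symmetric])
  hence "2 * (Re w)\<^sup>2 = norm z + Re z"
    by (simp add: cmod_power2) (simp add: power2_eq_square)
  hence "(Re w)\<^sup>2 \<le> \<beta>\<^sup>2 - t * m" using nz rz by simp
  also have "\<dots> \<le> (\<beta> - t * m / (2 * \<beta>))\<^sup>2"
  proof -
    have "(\<beta> - t * m / (2 * \<beta>))\<^sup>2 = \<beta>\<^sup>2 - t * m + (t * m / (2 * \<beta>))\<^sup>2"
      using \<beta>(1) by (simp add: power2_diff)
    thus ?thesis by simp
  qed
  finally have sq: "(Re w)\<^sup>2 \<le> (\<beta> - t * m / (2 * \<beta>))\<^sup>2" .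
  have "Re w \<le> \<beta> - t * m / (2 * \<beta>)"
  proof (rule power2_le_imp_le[OF sq])
    have "t * m \<le> t * 2" using m t_pos by (intro mult_left_mono) auto
    also have "\<dots> \<le> 2 * \<beta>\<^sup>2" using \<beta> t_pos by simp
    finally show "0 \<le> \<beta> - t * m / (2 * \<beta>)" using \<beta>(1) by (simp add: field_simps power2_eq_square)
  qed
  moreover have "t / (12 * \<beta>) * \<theta>\<^sup>2 \<le> t * m / (2 * \<beta>)"
  proof -
    have "t / (12 * \<beta>) * \<theta>\<^sup>2 = t / (2 * \<beta>) * (\<theta>\<^sup>2 / 6)" by simp
    also have "\<dots> \<le> t / (2 * \<beta>) * m" using m t_pos \<beta> by (intro mult_left_mono) auto
    finally show ?thesis by simp
  qed
  moreover have "12 * \<beta> = 12 * \<alpha> + 6" by (simp add: \<beta>_def)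
  ultimately show ?thesis by (simp add: saddle_root_def w_def z_def \<beta>_def)
qed

lemma chain_gf_saddle_root: "chain_gf n (of_real t * iexp \<theta>) = conv_coef (saddle_root t \<theta>) n"
  by (rule chain_gf_eq_conv_coef[OF saddle_root_eq])

text \<open>
  Where the root has real part at least \<open>\<alpha> / 4\<close>, the sharp bound applies. On the remaining arc the crude bound
  suffices: its exponent \<open>\<alpha> / 2 - 1\<close> is smaller than \<open>\<alpha> - 1\<close> by a fixed amount.
\<close>

lemma norm_chain_gf_le:
  obtains C \<kappa> where "C > 0" "\<kappa> > 0"
    "\<And>n \<theta>. \<bar>\<theta>\<bar> \<le> pi \<Longrightarrow> norm (chain_gf n (of_real t * iexp \<theta>)) \<le> C * (real n + 1) powr (\<alpha> - 1 - \<kappa> * \<theta>\<^sup>2)"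
proof -
  define r where "r = \<alpha> / 4"
  have r: "r > 0" using \<alpha> by (simp add: r_def)
  obtain C1 where C1: "C1 > 0" "\<And>a n. norm a \<le> \<alpha> + 1 \<Longrightarrow> r \<le> Re a \<Longrightarrow> norm (conv_coef a n) \<le> C1 * (real n + 1) powr (Re a - 1)"
    using norm_conv_coef_le_near[OF r, of "\<alpha> + 1"] by blast
  obtain C2 where C2: "C2 > 0" "\<And>a n. norm a \<le> \<alpha> + 1 \<Longrightarrow> - 1 / 2 \<le> Re a \<Longrightarrow> Re a \<le> r \<Longrightarrow> norm (conv_coef a n) \<le> C2 * (real n + 1) powr (2 * r - 1)"
    using norm_conv_coef_le_far[OF r, of "\<alpha> + 1"] by blast
  \<comment> \<open>by the second argument \<open>\<alpha> - \<kappa> * \<theta>\<^sup>2\<close> is at least \<open>\<alpha> / 2\<close> on the whole circle\<close>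
  define \<kappa> where "\<kappa> = min (t / (12 * \<alpha> + 6)) (\<alpha> / (2 * pi\<^sup>2))"
  show thesis
  proof (rule that[of "C1 + C2" \<kappa>])
    show "C1 + C2 > 0" using C1 C2 by simp
    show "\<kappa> > 0" using \<alpha> t_pos by (simp add: \<kappa>_def)
    fix n :: nat and \<theta> :: real assume \<theta>: "\<bar>\<theta>\<bar> \<le> pi"
    have \<theta>2: "\<theta>\<^sup>2 \<le> pi\<^sup>2" using power_mono[OF \<theta>, of 2] by simp
    have k1: "\<kappa> * \<theta>\<^sup>2 \<le> t / (12 * \<alpha> + 6) * \<theta>\<^sup>2" by (intro mult_right_mono) (auto simp: \<kappa>_def)
    have "\<kappa> * \<theta>\<^sup>2 \<le> \<alpha> / (2 * pi\<^sup>2) * pi\<^sup>2" using \<theta>2 \<alpha> by (intro mult_mono) (auto simp: \<kappa>_def)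
    hence k2: "\<kappa> * \<theta>\<^sup>2 \<le> \<alpha> / 2" by simp
    have "norm (conv_coef (saddle_root t \<theta>) n) \<le> (C1 + C2) * (real n + 1) powr (\<alpha> - 1 - \<kappa> * \<theta>\<^sup>2)"
    proof (cases "r \<le> Re (saddle_root t \<theta>)")
      case True
      have "norm (conv_coef (saddle_root t \<theta>) n) \<le> C1 * (real n + 1) powr (Re (saddle_root t \<theta>) - 1)"
        by (rule C1(2)[OF norm_saddle_root_le True])
      also have "\<dots> \<le> (C1 + C2) * (real n + 1) powr (\<alpha> - 1 - \<kappa> * \<theta>\<^sup>2)"
        using C1(1) C2(1) Re_saddle_root_le[OF \<theta>] k1 by (intro mult_mono powr_mono) auto
      finally show ?thesis .
    next
      case False
      have "norm (conv_coef (saddle_root t \<theta>) n) \<le> C2 * (real n + 1) powr (2 * r - 1)"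
        using False by (intro C2(2) norm_saddle_root_le Re_saddle_root_ge) auto
      also have "\<dots> \<le> (C1 + C2) * (real n + 1) powr (\<alpha> - 1 - \<kappa> * \<theta>\<^sup>2)"
        using C1(1) C2(1) k2 by (intro mult_mono powr_mono) (auto simp: r_def)
      finally show ?thesis .
    qed
    thus "norm (chain_gf n (of_real t * iexp \<theta>)) \<le> (C1 + C2) * (real n + 1) powr (\<alpha> - 1 - \<kappa> * \<theta>\<^sup>2)"
      by (simp only: chain_gf_saddle_root)
  qed
qed

text \<open>
  Minus the second derivative at \<open>0\<close> of the root as a function of the angle; it determines the
  width of the Gaussian to which the integrand converges.
\<close>

definition variance_rate :: real where "variance_rate = 2 * (t - c\<^sup>2) / (2 * \<alpha> + 1)"

lemma c_eq: "c * (2 * \<alpha> + 1) = 2 * t" using \<alpha> by (simp add: c t)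
lemma c_pos: "c > 0" using \<alpha> by (simp add: c)

lemma saddle_root_first_order: "((\<lambda>\<theta>. (saddle_root t \<theta> - of_real \<alpha>) / of_real \<theta>) \<longlongrightarrow> \<i> * of_real c) (at 0)"
proof -
  let ?q = "\<lambda>\<theta>. 2 * of_real t * ((iexp \<theta> - 1) / of_real \<theta>) / (2 * of_real \<alpha> + 1 + (saddle_root t \<theta> - of_real \<alpha>))"
  have ne: "2 * of_real \<alpha> + 1 + (saddle_root t \<theta> - of_real \<alpha>) \<noteq> 0" for \<theta>
  proof -
    have "Re (2 * of_real \<alpha> + 1 + (saddle_root t \<theta> - of_real \<alpha>)) > 0" using Re_saddle_root_ge[of \<theta>] \<alpha> by simp
    thus ?thesis by (metis less_irrefl zero_complex.sel(1))
  qed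
  have "2 * complex_of_real \<alpha> + 1 \<noteq> 0"
  proof -
    have "Re (2 * complex_of_real \<alpha> + 1) > 0" using \<alpha> by simp
    thus ?thesis by (metis less_irrefl zero_complex.sel(1))
  qed
  hence "((\<lambda>\<theta>. ?q \<theta>)
     \<longlongrightarrow> 2 * of_real t * \<i> / (2 * of_real \<alpha> + 1 + (of_real \<alpha> - of_real \<alpha>))) (at 0)"
    by (intro tendsto_intros exp_i_first_order saddle_root_tendsto) auto
  also have "2 * of_real t * \<i> / (2 * of_real \<alpha> + 1 + (of_real \<alpha> - of_real \<alpha>)) = \<i> * of_real c"
  proof -
    have "2 * of_real t = of_real c * (2 * complex_of_real \<alpha> + 1)"
      using arg_cong[OF c_eq, of complex_of_real] by simp
    thus ?thesis using \<open>2 * complex_of_real \<alpha> + 1 \<noteq> 0\<close> by simp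
  qed
  also have "(\<lambda>\<theta>. ?q \<theta>) =
      (\<lambda>\<theta>. (saddle_root t \<theta> - of_real \<alpha>) / of_real \<theta>)"
  proof
    fix \<theta>
    have "(saddle_root t \<theta> - of_real \<alpha>) * (2 * of_real \<alpha> + 1 + (saddle_root t \<theta> - of_real \<alpha>)) = saddle_root t \<theta> * (saddle_root t \<theta> + 1) - of_real \<alpha> * (of_real \<alpha> + 1)"
      by (simp add: algebra_simps)
    also have "of_real \<alpha> * (of_real \<alpha> + 1) = 2 * complex_of_real t" by (simp add: t)
    also have "saddle_root t \<theta> * (saddle_root t \<theta> + 1) - 2 * of_real t = 2 * of_real t * (iexp \<theta> - 1)"
      unfolding saddle_root_eq by (simp add: algebra_simps)
    finally have "2 * of_real t * (iexp \<theta> - 1) / (2 * of_real \<alpha> + 1 + (saddle_root t \<theta> - of_real \<alpha>)) = saddle_root t \<theta> - of_real \<alpha>"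
      using ne[of \<theta>] by (simp add: divide_eq_eq)
    thus "?q \<theta> = (saddle_root t \<theta> - of_real \<alpha>) / of_real \<theta>"
      by (metis (no_types, lifting) divide_divide_eq_left divide_divide_eq_left' times_divide_eq_right)
  qed
  finally show ?thesis .
qed

text \<open>
  With \<open>\<delta> = a(\<theta>) - \<alpha>\<close> the quadratic equation for \<open>a(\<theta>)\<close> becomes
  \<open>(2 \<alpha> + 1) (\<delta> - \<i> c \<theta>) = 2 t (e^(\<i>\<theta>) - 1 - \<i> \<theta>) - \<delta>\<^sup>2\<close>, where \<open>\<delta>\<close> may be replaced by \<open>\<i> c \<theta>\<close> on the right.
\<close>

lemma saddle_root_second_order:
  "((\<lambda>\<theta>. (saddle_root t \<theta> - of_real \<alpha> - \<i> * of_real (c * \<theta>)) / of_real (\<theta>\<^sup>2)) \<longlongrightarrow> - of_real (variance_rate / 2)) (at 0)"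
proof -
  let ?b = "2 * complex_of_real \<alpha> + 1"
  let ?q = "\<lambda>\<theta>. (2 * of_real t * ((iexp \<theta> - 1 - \<i> * of_real \<theta>) / of_real (\<theta>\<^sup>2)) - ((saddle_root t \<theta> - of_real \<alpha>) / of_real \<theta>)\<^sup>2) / ?b"
  have b0: "?b \<noteq> 0"
  proof -
    have "Re ?b > 0" using \<alpha> by simp
    thus ?thesis by (metis less_irrefl zero_complex.sel(1))
  qed
  have cb: "2 * complex_of_real t = of_real c * ?b"
    using arg_cong[OF c_eq, of complex_of_real] by simp
  have "((\<lambda>\<theta>. ?q \<theta>)
     \<longlongrightarrow> (2 * of_real t * (- 1 / 2) - (\<i> * of_real c)\<^sup>2) / ?b) (at 0)"
    using b0 by (intro tendsto_intros exp_i_second_order saddle_root_first_order)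
  also have "(2 * of_real t * (- 1 / 2) - (\<i> * of_real c)\<^sup>2) / ?b = - of_real (variance_rate / 2)"
  proof -
    have "- (variance_rate / 2) = (c\<^sup>2 - t) / (2 * \<alpha> + 1)"
      using \<alpha> by (simp add: variance_rate_def field_simps)
    hence "- of_real (variance_rate / 2) = complex_of_real ((c\<^sup>2 - t) / (2 * \<alpha> + 1))"
      by (metis of_real_minus)
    hence "- of_real (variance_rate / 2) = (of_real (c\<^sup>2 - t) :: complex) / ?b" by simp
    thus ?thesis by (simp add: power_mult_distrib)
  qed
  finally have lim: "((\<lambda>\<theta>. ?q \<theta>)
     \<longlongrightarrow> - of_real (variance_rate / 2)) (at 0)" .
  have "?q \<theta> =
       (saddle_root t \<theta> - of_real \<alpha> - \<i> * of_real (c * \<theta>)) / of_real (\<theta>\<^sup>2)" if "\<theta> \<noteq> 0" for \<theta>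
  proof -
    define \<delta> where "\<delta> = saddle_root t \<theta> - of_real \<alpha>"
    define e where "e = exp (\<i> * complex_of_real \<theta>)"
    have "\<delta> * (?b + \<delta>) = saddle_root t \<theta> * (saddle_root t \<theta> + 1) - of_real \<alpha> * (of_real \<alpha> + 1)"
      by (simp add: \<delta>_def algebra_simps)
    also have "of_real \<alpha> * (of_real \<alpha> + 1) = 2 * complex_of_real t" by (simp add: t)
    also have "saddle_root t \<theta> * (saddle_root t \<theta> + 1) - 2 * of_real t = 2 * of_real t * (e - 1)"
      unfolding saddle_root_eq by (simp add: e_def algebra_simps)
    finally have "2 * of_real t * (e - 1 - \<i> * of_real \<theta>) - \<delta>\<^sup>2 = \<delta> * ?b - \<i> * of_real \<theta> * (2 * of_real t)"
      by (simp add: power2_eq_square algebra_simps)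
    also have "\<dots> = (\<delta> - \<i> * of_real (c * \<theta>)) * ?b" unfolding cb by (simp add: algebra_simps)
    finally have "(2 * of_real t * (e - 1 - \<i> * of_real \<theta>) - \<delta>\<^sup>2) / ?b = \<delta> - \<i> * of_real (c * \<theta>)"
      using b0 by (simp add: divide_eq_eq)
    moreover have "(2 * of_real t * ((e - 1 - \<i> * of_real \<theta>) / of_real (\<theta>\<^sup>2)) - (\<delta> / of_real \<theta>)\<^sup>2) / ?b =
        (2 * of_real t * (e - 1 - \<i> * of_real \<theta>) - \<delta>\<^sup>2) / ?b / of_real (\<theta>\<^sup>2)"
    proof -
      have "(y * (x / q) - d / q) / b = (y * x - d) / b / q" for x y q d b :: complex
        by (simp add: diff_divide_distrib mult.commute)
      thus ?thesis by (simp only: power_divide of_real_power)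
    qed
    ultimately show ?thesis by (simp add: \<delta>_def e_def)
  qed
  hence "\<forall>\<^sub>F \<theta> in at 0. ?q \<theta> =
       (saddle_root t \<theta> - of_real \<alpha> - \<i> * of_real (c * \<theta>)) / of_real (\<theta>\<^sup>2)"
    by (simp add: eventually_at_filter)
  from Lim_transform_eventually[OF lim this] show ?thesis .
qed

lemma variance_rate_eq: "variance_rate = \<alpha> * (\<alpha> + 1) * (2 * \<alpha> * (\<alpha> + 1) + 1) / (2 * \<alpha> + 1) ^ 3"
  unfolding variance_rate_def unfolding t c
  using \<alpha> by (simp add: divide_simps power2_eq_square power3_eq_cube) (simp add: algebra_simps)

lemma variance_rate_pos: "variance_rate > 0"
  unfolding variance_rate_eq using \<alpha> by (intro divide_pos_pos mult_pos_pos add_pos_pos) auto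

end

section \<open>The local limit theorem\<close>

lemma exp_i_int_pi: "exp (\<i> * of_int m * of_real pi) = exp (\<i> * of_int m * of_real (- pi))"
proof -
  have "\<i> * of_int m * of_real pi = \<i> * of_int m * of_real (- pi) + (2 * complex_of_int m * of_real pi) * \<i>"
    by (simp add: algebra_simps)
  moreover have "exp ((2 * complex_of_int m * of_real pi) * \<i>) = 1"
    using exp_integer_2pi[of "of_int m"] by (simp add: mult_ac)
  ultimately show ?thesis by (simp only: exp_add mult_1_right)
qed

lemma has_integral_exp_i_int:
  "has_bochner_integral lborel (\<lambda>\<theta>. indicator {- pi..pi} \<theta> *\<^sub>R exp (\<i> * of_int m * of_real \<theta>)) (if m = 0 then 2 * of_real pi else 0)"
proof (cases "m = 0")
  case True
  have "has_bochner_integral lborel (\<lambda>\<theta>. indicator {- pi..pi} \<theta> *\<^sub>R (1::complex)) (of_real pi - of_real (- pi))"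
    by (rule has_bochner_integral_FTC_Icc) (auto intro!: derivative_eq_intros simp: has_vector_derivative_of_real)
  thus ?thesis using True by simp
next
  case False
  let ?F = "\<lambda>\<theta>. exp (\<i> * of_int m * of_real \<theta>) / (\<i> * of_int m)"
  have "has_bochner_integral lborel (\<lambda>\<theta>. indicator {- pi..pi} \<theta> *\<^sub>R exp (\<i> * of_int m * of_real \<theta>)) (?F pi - ?F (- pi))"
  proof (rule has_bochner_integral_FTC_Icc)
    fix \<theta> :: real
    have "((\<lambda>z. exp (\<i> * of_int m * z) / (\<i> * of_int m)) has_field_derivative exp (\<i> * of_int m * of_real \<theta>)) (at (of_real \<theta>))"
      using False by (auto intro!: derivative_eq_intros)
    thus "(?F has_vector_derivative exp (\<i> * of_int m * of_real \<theta>)) (at \<theta> within {- pi..pi})"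
      by (rule has_vector_derivative_real_field)
  qed (auto intro!: continuous_intros)
  thus ?thesis using False exp_i_int_pi[of m] by simp
qed

lemma chain_prob_fourier:
  "(\<integral>\<theta>. indicator {- pi..pi} \<theta> *\<^sub>R (chain_gf n (of_real t * iexp \<theta>) * exp (- (\<i> * of_nat k * of_real \<theta>))) \<partial>lborel)
     = of_real (2 * pi * (chain_prob k n * t ^ k))"
proof -
  let ?I = "\<lambda>j \<theta>. indicator {- pi..pi} \<theta> *\<^sub>R exp (\<i> * of_int (int j - int k) * of_real \<theta>)"
  let ?p = "\<lambda>j. complex_of_real (chain_prob j n) * of_real t ^ j"
  have "indicator {- pi..pi} \<theta> *\<^sub>R (chain_gf n (of_real t * iexp \<theta>) * exp (- (\<i> * of_nat k * of_real \<theta>))) =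
      (\<Sum>j\<le>n. ?p j * ?I j \<theta>)" for \<theta>
  proof -
    have "iexp \<theta> ^ j * exp (- (\<i> * of_nat k * of_real \<theta>)) = exp (\<i> * of_int (int j - int k) * of_real \<theta>)" for j
      by (simp add: exp_of_nat_mult[symmetric] exp_add[symmetric] algebra_simps)
    hence "chain_gf n (of_real t * iexp \<theta>) * exp (- (\<i> * of_nat k * of_real \<theta>)) = (\<Sum>j\<le>n. ?p j * exp (\<i> * of_int (int j - int k) * of_real \<theta>))"
      unfolding chain_gf_def sum_distrib_right power_mult_distrib by (simp only: mult.assoc)
    thus ?thesis by (simp only: scaleR_sum_right mult_scaleR_right)
  qed
  moreover have "has_bochner_integral lborel (\<lambda>\<theta>. \<Sum>j\<le>n. ?p j * ?I j \<theta>) (\<Sum>j\<le>n. ?p j * (if int j - int k = 0 then 2 * of_real pi else 0))"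
    by (intro has_bochner_integral_sum has_bochner_integral_mult_right has_integral_exp_i_int)
  ultimately have "(\<integral>\<theta>. indicator {- pi..pi} \<theta> *\<^sub>R (chain_gf n (of_real t * iexp \<theta>) * exp (- (\<i> * of_nat k * of_real \<theta>))) \<partial>lborel)
      = (\<Sum>j\<le>n. ?p j * (if int j - int k = 0 then 2 * of_real pi else 0))"
    by (simp only: has_bochner_integral_integral_eq)
  also have "\<dots> = (\<Sum>j\<le>n. if j = k then ?p k * (2 * of_real pi) else 0)" by (intro sum.cong) auto
  also have "\<dots> = of_real (2 * pi * (chain_prob k n * t ^ k))"
    by (simp add: chain_prob_eq_0 not_le)
  finally show ?thesis .
qed

lemma integral_gaussian:
  assumes "v > 0"
  shows "integrable lborel (\<lambda>x::real. exp (- (v * x\<^sup>2)))" "(\<integral>x. exp (- (v * x\<^sup>2)) \<partial>lborel) = sqrt (pi / v)"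
proof -
  define s where "s = 1 / sqrt (2 * v)"
  have s: "s > 0" "s\<^sup>2 = 1 / (2 * v)" using assms by (simp_all add: s_def power_divide)
  have eq: "exp (- (v * x\<^sup>2)) = sqrt (pi / v) * normal_density 0 s x" for x
    using assms by (simp add: normal_density_def s real_sqrt_divide)
  show "integrable lborel (\<lambda>x::real. exp (- (v * x\<^sup>2)))"
    unfolding eq using s by (intro integrable_mult_right integrable_normal_density)
  show "(\<integral>x. exp (- (v * x\<^sup>2)) \<partial>lborel) = sqrt (pi / v)"
    unfolding eq using s by simp
qed

context saddle
begin

text \<open>
  Dominated convergence in the Fourier integral for \<open>chain_prob (k n) n * t ^ k n\<close>, rescaled by the square root of
  \<open>ln (n + 1)\<close>: the expansion of the root turns the integrand into \<open>exp (- v \<phi>\<^sup>2 / 2)\<close>, with \<open>v = variance_rate\<close>,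
  times \<open>K \<alpha> / Gamma \<alpha>\<close>, the hypothesis on \<open>k\<close> removes the phase, and \<open>norm_chain_gf_le\<close> gives a Gaussian majorant.
\<close>

theorem chain_prob_local_limit:
  fixes k :: "nat \<Rightarrow> nat"
  assumes k: "(\<lambda>n. (c * ln (real n + 1) - real (k n)) / sqrt (ln (real n + 1))) \<longlonglongrightarrow> 0"
  shows "(\<lambda>n. sqrt (ln (real n + 1)) * (real n + 1) powr (1 - \<alpha>) * (chain_prob (k n) n * t ^ k n))
            \<longlonglongrightarrow> K \<alpha> / Gamma \<alpha> / sqrt (2 * pi * variance_rate)"
proof -
  define L where "L n = ln (real n + 1)" for n :: nat
  let ?P = "\<lambda>n. sqrt (L n) * (real n + 1) powr (1 - \<alpha>) * (chain_prob (k n) n * t ^ k n)"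
  have Lpos: "L n > 0" if "n > 0" for n using that by (simp add: L_def)
  have Linf: "filterlim L at_top sequentially" unfolding L_def by real_asymp
  define g where "g n \<theta> = indicator {- pi..pi} \<theta> *\<^sub>R (chain_gf n (of_real t * iexp \<theta>) * exp (- (\<i> * of_nat (k n) * of_real \<theta>)))"
    for n and \<theta> :: real
  \<comment> \<open>the integrand on the scale \<open>\<theta> = \<phi> / sqrt (L n)\<close>, which degenerates for \<open>n = 0\<close> because \<open>L 0 = 0\<close>\<close>
  define S where "S n \<phi> = (if n = 0 then 0 else of_real ((real n + 1) powr (1 - \<alpha>)) * g n (\<phi> / sqrt (L n)))" for n and \<phi> :: real
  define f where "f \<phi> = complex_of_real (K \<alpha> / Gamma \<alpha> * exp (- (variance_rate / 2 * \<phi>\<^sup>2)))" for \<phi> :: real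
  obtain C \<kappa> where C: "C > 0" "\<kappa> > 0"
    and bound: "\<And>n \<theta>. \<bar>\<theta>\<bar> \<le> pi \<Longrightarrow> norm (chain_gf n (of_real t * iexp \<theta>)) \<le> C * (real n + 1) powr (\<alpha> - 1 - \<kappa> * \<theta>\<^sup>2)"
    by (rule norm_chain_gf_le) blast

  have int_S: "integral\<^sup>L lborel (S n) = of_real (2 * pi * (?P n))" if n: "n > 0" for n
  proof -
    have sL: "sqrt (L n) > 0" using Lpos[OF n] by simp
    have "of_real (2 * pi * (chain_prob (k n) n * t ^ k n)) = integral\<^sup>L lborel (g n)"
      unfolding g_def by (rule chain_prob_fourier[symmetric])
    also have "\<dots> = \<bar>1 / sqrt (L n)\<bar> *\<^sub>R (\<integral>\<phi>. g n (0 + 1 / sqrt (L n) * \<phi>) \<partial>lborel)"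
      using sL by (intro lborel_integral_real_affine) auto
    finally have "(\<integral>\<phi>. g n (\<phi> / sqrt (L n)) \<partial>lborel) = of_real (sqrt (L n)) * of_real (2 * pi * (chain_prob (k n) n * t ^ k n))"
      using sL by (simp add: scaleR_conv_of_real field_simps)
    moreover have "S n = (\<lambda>\<phi>. of_real ((real n + 1) powr (1 - \<alpha>)) * g n (\<phi> / sqrt (L n)))"
      using n by (auto simp: S_def)
    ultimately show ?thesis by (simp add: mult_ac)
  qed

  have "(\<lambda>n. integral\<^sup>L lborel (S n)) \<longlonglongrightarrow> integral\<^sup>L lborel f"
  proof (rule integral_dominated_convergence)
    show "f \<in> borel_measurable lborel" unfolding f_def by measurable
    show "S n \<in> borel_measurable lborel" for n
    proof -
      have "(\<lambda>\<theta>. chain_gf n (of_real t * iexp \<theta>) * exp (- (\<i> * of_nat (k n) * of_real \<theta>))) \<in> borel_measurable borel"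
        unfolding chain_gf_def by (intro borel_measurable_continuous_onI continuous_intros)
      hence "g n \<in> borel_measurable borel" unfolding g_def by measurable
      hence "(\<lambda>\<phi>. g n (\<phi> / sqrt (L n))) \<in> borel_measurable borel" by measurable
      thus ?thesis unfolding S_def by measurable
    qed
    show "integrable lborel (\<lambda>\<phi>. C * exp (- (\<kappa> * \<phi>\<^sup>2)))"
      by (intro integrable_mult_right integral_gaussian C)
    show "AE \<phi> in lborel. norm (S n \<phi>) \<le> C * exp (- (\<kappa> * \<phi>\<^sup>2))" for n
    proof (rule AE_I2)
      fix \<phi> :: real
      show "norm (S n \<phi>) \<le> C * exp (- (\<kappa> * \<phi>\<^sup>2))"
      proof (cases "n > 0 \<and> \<phi> / sqrt (L n) \<in> {- pi..pi}")
        case False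
        thus ?thesis using C by (auto simp: S_def g_def)
      next
        case True
        define \<theta> where "\<theta> = \<phi> / sqrt (L n)"
        have n: "n > 0" and \<theta>: "\<bar>\<theta>\<bar> \<le> pi" using True by (auto simp: \<theta>_def)
        have \<theta>2: "\<theta>\<^sup>2 * L n = \<phi>\<^sup>2" using Lpos[OF n] by (simp add: \<theta>_def power_divide)
        have "norm (S n \<phi>) = (real n + 1) powr (1 - \<alpha>) * norm (chain_gf n (of_real t * iexp \<theta>))"
          using n True by (simp add: S_def g_def \<theta>_def norm_mult)
        also have "\<dots> \<le> (real n + 1) powr (1 - \<alpha>) * (C * (real n + 1) powr (\<alpha> - 1 - \<kappa> * \<theta>\<^sup>2))"
          by (intro mult_left_mono bound \<theta>) auto
        also have "\<dots> = C * ((real n + 1) powr (1 - \<alpha>) * (real n + 1) powr (\<alpha> - 1 - \<kappa> * \<theta>\<^sup>2))" by simp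
        also have "(real n + 1) powr (1 - \<alpha>) * (real n + 1) powr (\<alpha> - 1 - \<kappa> * \<theta>\<^sup>2) = (real n + 1) powr (- (\<kappa> * \<theta>\<^sup>2))"
          by (simp add: powr_add[symmetric])
        also have "\<dots> = exp (- (\<kappa> * (\<theta>\<^sup>2 * L n)))" by (simp add: powr_def L_def mult_ac)
        finally show ?thesis by (simp add: \<theta>2)
      qed
    qed
    have "AE \<phi> in lborel. \<phi> \<noteq> (0::real)" by (rule AE_lborel_singleton)
    thus "AE \<phi> in lborel. (\<lambda>n. S n \<phi>) \<longlonglongrightarrow> f \<phi>"
    proof eventually_elim
      fix \<phi> :: real assume \<phi>: "\<phi> \<noteq> 0"
      define \<theta> where "\<theta> n = \<phi> / sqrt (L n)" for n
      have \<theta>0: "\<theta> \<longlonglongrightarrow> 0" unfolding \<theta>_def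
        by (intro tendsto_divide_0[OF tendsto_const] filterlim_at_top_imp_at_infinity filterlim_compose[OF sqrt_at_top Linf])
      have ev0: "eventually (\<lambda>n. n > 0) sequentially" by (rule eventually_gt_at_top)
      have \<theta>ne: "\<theta> n \<noteq> 0" if "n > 0" for n using Lpos[OF that] \<phi> by (simp add: \<theta>_def)
      have at0: "filterlim \<theta> (at 0) sequentially"
        using eventually_mono[OF ev0 \<theta>ne] by (intro filterlim_atI \<theta>0)
      define A where "A n = saddle_root t (\<theta> n)" for n
      let ?B = "\<lambda>n. conv_coef (A n) n * exp ((1 - A n) * of_real (L n))"
      let ?E = "\<lambda>n. (A n - of_real \<alpha>) * of_real (L n) - \<i> * of_nat (k n) * of_real (\<theta> n)"
      let ?Q = "\<lambda>n. (A n - of_real \<alpha> - \<i> * of_real (c * \<theta> n)) / of_real ((\<theta> n)\<^sup>2) * of_real (\<phi>\<^sup>2) + \<i> * of_real ((c * L n - real (k n)) / sqrt (L n) * \<phi>)"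
      let ?l = "- of_real (variance_rate / 2) * of_real (\<phi>\<^sup>2) + \<i> * of_real (0 * \<phi>)"
      have A: "A \<longlonglongrightarrow> of_real \<alpha>" unfolding A_def by (rule filterlim_compose[OF saddle_root_tendsto at0])
      have lim1: "(\<lambda>n. conv_coef (A n) n * exp ((1 - A n) * of_real (L n))) \<longlonglongrightarrow> of_real (K \<alpha> / Gamma \<alpha>)"
        unfolding L_def by (rule conv_coef_tendsto[OF A \<alpha>])
      have "(\<lambda>n. ?Q n)
          \<longlonglongrightarrow> ?l"
        unfolding A_def by (intro tendsto_intros filterlim_compose[OF saddle_root_second_order at0] k[folded L_def])
      moreover have "eventually (\<lambda>n. ?Q n
          = ?E n) sequentially"
        using ev0
      proof eventually_elim
        fix n :: nat assume n: "n > 0"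
        have s: "\<phi> = \<theta> n * sqrt (L n)" using Lpos[OF n] by (simp add: \<theta>_def)
        have 1: "of_real (\<phi>\<^sup>2) = complex_of_real ((\<theta> n)\<^sup>2) * of_real (L n)"
          using Lpos[OF n] by (simp add: s power_mult_distrib flip: of_real_mult of_real_power)
        have 2: "(c * L n - real (k n)) / sqrt (L n) * \<phi> = (c * L n - real (k n)) * \<theta> n"
          using Lpos[OF n] by (simp add: s)
        have "x / q * (q * l) + \<i> * of_real ((c * L n - real (k n)) * \<theta> n) = x * l + \<i> * of_real ((c * L n - real (k n)) * \<theta> n)"
          if "q \<noteq> 0" for x q l :: complex using that by simp
        hence "?Q n
          = (A n - of_real \<alpha> - \<i> * of_real (c * \<theta> n)) * of_real (L n) + \<i> * of_real ((c * L n - real (k n)) * \<theta> n)"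
          unfolding 1 2 using \<theta>ne[OF n] by simp
        thus "?Q n
          = ?E n"
          by (simp add: algebra_simps)
      qed
      ultimately have "(\<lambda>n. ?E n) \<longlonglongrightarrow> ?l"
        by (rule Lim_transform_eventually)
      hence "(\<lambda>n. ?B n * exp (?E n))
          \<longlonglongrightarrow> of_real (K \<alpha> / Gamma \<alpha>) * exp (?l)"
        by (intro tendsto_mult lim1 tendsto_exp)
      also have "of_real (K \<alpha> / Gamma \<alpha>) * exp (?l) = f \<phi>"
      proof -
        have "?l = complex_of_real (- (variance_rate / 2 * \<phi>\<^sup>2))" by simp
        thus ?thesis unfolding f_def by (simp only: exp_of_real of_real_mult)
      qed
      finally have lim: "(\<lambda>n. ?B n * exp (?E n))
          \<longlonglongrightarrow> f \<phi>" .
      have "eventually (\<lambda>n. \<bar>\<theta> n\<bar> < pi) sequentially"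
        using order_tendstoD(2)[OF tendsto_rabs_zero[OF \<theta>0], of pi] by simp
      with ev0 have "eventually (\<lambda>n. ?B n * exp (?E n) = S n \<phi>) sequentially"
      proof eventually_elim
        fix n :: nat assume n: "n > 0" "\<bar>\<theta> n\<bar> < pi"
        have "of_real ((real n + 1) powr (1 - \<alpha>)) = exp ((1 - of_real \<alpha>) * complex_of_real (L n))"
          by (simp add: powr_def L_def exp_of_real[symmetric])
        moreover have "exp ((1 - A n) * of_real (L n)) * exp (?E n) =
            exp ((1 - of_real \<alpha>) * complex_of_real (L n)) * exp (- (\<i> * of_nat (k n) * of_real (\<theta> n)))"
          by (simp add: exp_add[symmetric] algebra_simps)
        moreover have "\<theta> n \<in> {- pi..pi}" using n by auto
        ultimately show "?B n * exp (?E n) = S n \<phi>"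
          using n by (simp add: S_def g_def \<theta>_def[symmetric] chain_gf_saddle_root A_def mult_ac)
      qed
      from Lim_transform_eventually[OF lim this] show "(\<lambda>n. S n \<phi>) \<longlonglongrightarrow> f \<phi>" .
    qed
  qed
  moreover have "integral\<^sup>L lborel f = of_real (K \<alpha> / Gamma \<alpha> * sqrt (2 * pi / variance_rate))"
  proof -
    have "variance_rate / 2 > 0" using variance_rate_pos by simp
    have "integral\<^sup>L lborel f = of_real (\<integral>\<phi>. K \<alpha> / Gamma \<alpha> * exp (- (variance_rate / 2 * \<phi>\<^sup>2)) \<partial>lborel)"
      unfolding f_def by (rule integral_complex_of_real)
    also have "(\<integral>\<phi>. K \<alpha> / Gamma \<alpha> * exp (- (variance_rate / 2 * \<phi>\<^sup>2)) \<partial>lborel) = K \<alpha> / Gamma \<alpha> * sqrt (pi / (variance_rate / 2))"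
      by (subst integral_mult_right_zero, subst integral_gaussian(2)[OF \<open>variance_rate / 2 > 0\<close>]) simp
    finally show ?thesis by (simp add: mult.commute)
  qed
  ultimately have "(\<lambda>n. integral\<^sup>L lborel (S n)) \<longlonglongrightarrow> of_real (K \<alpha> / Gamma \<alpha> * sqrt (2 * pi / variance_rate))" by simp
  moreover have "eventually (\<lambda>n. integral\<^sup>L lborel (S n) = of_real (2 * pi * (?P n))) sequentially"
    using eventually_gt_at_top[of 0] by eventually_elim (rule int_S)
  ultimately have "(\<lambda>n. complex_of_real (2 * pi * (?P n))) \<longlonglongrightarrow> of_real (K \<alpha> / Gamma \<alpha> * sqrt (2 * pi / variance_rate))"
    by (rule Lim_transform_eventually)
  hence "(\<lambda>n. 2 * pi * (?P n)) \<longlonglongrightarrow> K \<alpha> / Gamma \<alpha> * sqrt (2 * pi / variance_rate)"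
    by (simp only: tendsto_of_real_iff)
  hence "(\<lambda>n. 2 * pi * (?P n) / (2 * pi)) \<longlonglongrightarrow> K \<alpha> / Gamma \<alpha> * sqrt (2 * pi / variance_rate) / (2 * pi)"
    by (intro tendsto_divide tendsto_const) auto
  moreover have "K \<alpha> / Gamma \<alpha> * sqrt (2 * pi / variance_rate) / (2 * pi) = K \<alpha> / Gamma \<alpha> / sqrt (2 * pi * variance_rate)"
  proof -
    have "sqrt (2 * pi / variance_rate) / (2 * pi) = 1 / sqrt (2 * pi * variance_rate)"
    proof -
      define x where "x = sqrt (2 * pi)"
      have "x > 0" "2 * pi = x * x" by (simp_all add: x_def)
      moreover have "sqrt (2 * pi / variance_rate) = x / sqrt variance_rate" "sqrt (2 * pi * variance_rate) = x * sqrt variance_rate"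
        by (simp_all only: x_def real_sqrt_divide real_sqrt_mult)
      moreover have "x / y / (x * x) = 1 / (x * y)" if "x > 0" for x y :: real using that by simp
      ultimately show ?thesis by (simp only:)
    qed
    thus ?thesis by (metis times_divide_eq_right mult.right_neutral)
  qed
  ultimately show ?thesis by (simp add: L_def)
qed

end


lemma alpha_star_pos: "0 < c \<Longrightarrow> alpha_star c > 0"
proof -
  assume c: "0 < c"
  have "1 < sqrt (4 * c\<^sup>2 + 1)" using c by simp
  thus ?thesis unfolding alpha_star_def using c by linarith
qed

lemma saddle_alpha_star:
  assumes c: "0 < c"
  shows "saddle (alpha_star c) (alpha_star c * (alpha_star c + 1) / 2) c"
proof
  show "alpha_star c > 0" using alpha_star_pos[OF c] .
  define s where "s = sqrt (4 * c\<^sup>2 + 1)"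
  have s2: "s * s = 4 * c\<^sup>2 + 1" unfolding s_def by (simp add: add_nonneg_nonneg)
  have a: "alpha_star c = c - 1 / 2 + s / 2" by (simp add: alpha_star_def s_def)
  have "alpha_star c * (alpha_star c + 1) = ((2 * alpha_star c + 1) * (2 * alpha_star c + 1) - 1) / 4" by (simp add: algebra_simps)
  also have "2 * alpha_star c + 1 = 2 * c + s" by (simp add: a)
  also have "((2 * c + s) * (2 * c + s) - 1) / 4 = (4 * c\<^sup>2 + 4 * c * s + s * s - 1) / 4"
    by (simp add: power2_eq_square algebra_simps)
  also have "\<dots> = c * (2 * c + s)" unfolding s2 by (simp add: power2_eq_square algebra_simps)
  also have "2 * c + s = 2 * alpha_star c + 1" by (simp add: a)
  finally show "c = alpha_star c * (alpha_star c + 1) / (2 * alpha_star c + 1)"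
    using alpha_star_pos[OF c] by (simp add: field_simps)
qed simp

lemma (in saddle) variance_rate_sigma_star: "sigma_star \<alpha> > 0" "1 / sqrt variance_rate = sigma_star \<alpha> / (c * sqrt c)"
proof -
  define q where "q = 1 / \<alpha>\<^sup>2 + 1 / (\<alpha> + 1)\<^sup>2"
  have q: "q > 0" using \<alpha> by (simp add: q_def add_pos_pos)
  have s: "sigma_star \<alpha> = 1 / sqrt q"
    using q by (simp add: sigma_star_def q_def[symmetric] powr_minus_divide powr_half_sqrt)
  thus "sigma_star \<alpha> > 0" using q by simp
  have "variance_rate = c ^ 3 * q"
  proof -
    have "c ^ 3 = (\<alpha> * (\<alpha> + 1)) ^ 3 / (2 * \<alpha> + 1) ^ 3" unfolding c by (rule power_divide)
    moreover have "q = (2 * \<alpha> * (\<alpha> + 1) + 1) / (\<alpha> * (\<alpha> + 1))\<^sup>2"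
      using \<alpha> by (simp add: q_def divide_simps power2_eq_square) (simp add: algebra_simps)
    moreover have "u ^ 3 / b * (w / u\<^sup>2) = u * w / b" if "u > 0" for u b w :: real
      using that by (simp add: power2_eq_square power3_eq_cube)
    ultimately show ?thesis unfolding variance_rate_eq using \<alpha> by simp
  qed
  hence "sqrt variance_rate = c * sqrt c * sqrt q"
    using c_pos by (simp add: power3_eq_cube real_sqrt_mult)
  thus "1 / sqrt variance_rate = sigma_star \<alpha> / (c * sqrt c)" by (simp add: s)
qed

text \<open>
  Rounding and the passage from \<open>ln n\<close> to \<open>ln (n + 1)\<close> both cost a bounded amount, which is negligible on the
  scale of the standard deviation.
\<close>

lemma floor_log_deviation:
  assumes c: "c > 0"
  shows "(\<lambda>n. (c * ln (real n + 1) - real (nat \<lfloor>c * ln (real n)\<rfloor>)) / sqrt (ln (real n + 1))) \<longlonglongrightarrow> 0"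
proof (rule Lim_null_comparison)
  show "(\<lambda>n. (c + 1) / sqrt (ln (real n + 1))) \<longlonglongrightarrow> 0" by real_asymp
  show "\<forall>\<^sub>F n in sequentially. norm ((c * ln (real n + 1) - real (nat \<lfloor>c * ln (real n)\<rfloor>)) / sqrt (ln (real n + 1))) \<le> (c + 1) / sqrt (ln (real n + 1))"
    using eventually_gt_at_top[of 0]
  proof eventually_elim
    fix n :: nat assume n: "0 < n"
    have l0: "0 \<le> c * ln (real n)" using n c by simp
    have "real (nat \<lfloor>c * ln (real n)\<rfloor>) = of_int \<lfloor>c * ln (real n)\<rfloor>" using l0 by simp
    hence fl: "real (nat \<lfloor>c * ln (real n)\<rfloor>) \<le> c * ln (real n)" "c * ln (real n) - 1 \<le> real (nat \<lfloor>c * ln (real n)\<rfloor>)" by linarith+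
    have "1 + 1 / real n = (real n + 1) / real n" using n by (simp add: field_simps)
    hence "ln (real n + 1) - ln (real n) = ln (1 + 1 / real n)" using n by (simp add: ln_div)
    also have "\<dots> \<le> 1 / real n" by (rule ln_add_one_self_le_self) simp
    also have "\<dots> \<le> 1" using n by simp
    finally have "c * (ln (real n + 1) - ln (real n)) \<le> c * 1" using c by (intro mult_left_mono) auto
    moreover have "c * ln (real n) \<le> c * ln (real n + 1)" using n c by (intro mult_left_mono) auto
    ultimately have "\<bar>c * ln (real n + 1) - real (nat \<lfloor>c * ln (real n)\<rfloor>)\<bar> \<le> c + 1"
      using fl unfolding right_diff_distrib abs_le_iff by linarith
    thus "norm ((c * ln (real n + 1) - real (nat \<lfloor>c * ln (real n)\<rfloor>)) / sqrt (ln (real n + 1))) \<le> (c + 1) / sqrt (ln (real n + 1))"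
      by (simp add: divide_right_mono)
  qed
qed

lemma (in saddle) chain_prob_asymp_equiv:
  fixes k :: "nat \<Rightarrow> nat"
  assumes k: "\<And>n. k n = nat \<lfloor>c * ln (real n)\<rfloor>"
  shows "(\<lambda>n. chain_prob (k n) n) \<sim>[at_top]
    (\<lambda>n. sigma_star \<alpha> / sqrt (2 * pi) * (1 / \<alpha> + 1 / (\<alpha> + 1)) * (K \<alpha> / Gamma \<alpha>)
       * ((\<alpha> + 1) gchoose 2) powi (- int (k n)) * (real n powr (\<alpha> - 1) / sqrt (real (k n))))"
proof (rule asymp_equivI')
  define W where "W = sigma_star \<alpha> / sqrt (2 * pi) * (1 / \<alpha> + 1 / (\<alpha> + 1)) * (K \<alpha> / Gamma \<alpha>)"
  define L where "L n = ln (real n + 1)" for n :: nat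
  let ?l = "\<lambda>n. sqrt (L n) * (real n + 1) powr (1 - \<alpha>) * (chain_prob (k n) n * t ^ k n) * (real n / (real n + 1)) powr (1 - \<alpha>) * sqrt (real (k n) / L n) / W"
  let ?r = "\<lambda>n. chain_prob (k n) n / (W * ((\<alpha> + 1) gchoose 2) powi (- int (k n)) * (real n powr (\<alpha> - 1) / sqrt (real (k n))))"
  have KG: "K \<alpha> > 0" "Gamma \<alpha> > 0" using K_pos[OF \<alpha>] Gamma_real_pos[OF \<alpha>] by auto
  have dev: "(\<lambda>n. (c * L n - real (k n)) / sqrt (L n)) \<longlonglongrightarrow> 0"
    unfolding L_def k by (rule floor_log_deviation[OF c_pos])
  have W_eq: "W = K \<alpha> / Gamma \<alpha> / sqrt (2 * pi * variance_rate) * sqrt c"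
  proof -
    have "1 / \<alpha> + 1 / (\<alpha> + 1) = 1 / c" using \<alpha> by (simp add: c divide_simps)
    moreover have "K \<alpha> / Gamma \<alpha> / sqrt (2 * pi * variance_rate) * sqrt c = K \<alpha> / Gamma \<alpha> / sqrt (2 * pi) * (1 / sqrt variance_rate) * sqrt c"
      by (simp add: real_sqrt_mult)
    ultimately show ?thesis unfolding W_def variance_rate_sigma_star(2) using c_pos by (simp add: mult_ac)
  qed
  have W0: "W > 0" unfolding W_eq using KG variance_rate_pos c_pos by (intro mult_pos_pos divide_pos_pos) auto
  have kL: "(\<lambda>n. real (k n) / L n) \<longlonglongrightarrow> c"
  proof -
    have "(\<lambda>n. c - (c * L n - real (k n)) / sqrt (L n) * (1 / sqrt (L n))) \<longlonglongrightarrow> c - 0 * 0"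
    proof (intro tendsto_intros dev)
      show "(\<lambda>n. 1 / sqrt (L n)) \<longlonglongrightarrow> 0" unfolding L_def by real_asymp
    qed
    moreover have "eventually (\<lambda>n. c - (c * L n - real (k n)) / sqrt (L n) * (1 / sqrt (L n)) = real (k n) / L n) sequentially"
      using eventually_gt_at_top[of 0]
    proof eventually_elim
      fix n :: nat assume "n > 0"
      hence "L n > 0" by (simp add: L_def)
      thus "c - (c * L n - real (k n)) / sqrt (L n) * (1 / sqrt (L n)) = real (k n) / L n" by (simp add: field_simps)
    qed
    ultimately show ?thesis by (simp add: tendsto_cong)
  qed
  have "(\<lambda>n. ?l n)
      \<longlonglongrightarrow> K \<alpha> / Gamma \<alpha> / sqrt (2 * pi * variance_rate) * 1 * sqrt c / W"
  proof (intro tendsto_mult tendsto_divide tendsto_const tendsto_real_sqrt kL)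
    show "(\<lambda>n. sqrt (L n) * (real n + 1) powr (1 - \<alpha>) * (chain_prob (k n) n * t ^ k n)) \<longlonglongrightarrow> K \<alpha> / Gamma \<alpha> / sqrt (2 * pi * variance_rate)"
      using chain_prob_local_limit[of k] dev by (simp add: L_def)
    show "(\<lambda>n. (real n / (real n + 1)) powr (1 - \<alpha>)) \<longlonglongrightarrow> 1" by real_asymp
  qed (use W0 in auto)
  also have "K \<alpha> / Gamma \<alpha> / sqrt (2 * pi * variance_rate) * 1 * sqrt c / W = 1"
    unfolding W_eq using KG c_pos variance_rate_pos by simp
  finally have lim: "(\<lambda>n. ?l n) \<longlonglongrightarrow> 1" .
  have "eventually (\<lambda>n. real (k n) / L n > 0) sequentially"
    using order_tendstoD(1)[OF kL c_pos] .
  hence "eventually (\<lambda>n. ?l n =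
      ?r n) sequentially"
    using eventually_gt_at_top[of 0]
  proof eventually_elim
    fix n :: nat assume kn: "0 < real (k n) / L n" and n: "0 < n"
    have L: "L n > 0" using n by (simp add: L_def)
    hence kp: "real (k n) > 0" using kn by (simp add: zero_less_divide_iff)
    have g: "((\<alpha> + 1) gchoose 2) powi (- int (k n)) = 1 / t ^ k n"
      by (simp add: gchoose_two t power_int_minus inverse_eq_divide)
    have "(real n + 1) powr (1 - \<alpha>) * (real n / (real n + 1)) powr (1 - \<alpha>) = real n powr (1 - \<alpha>)"
      using n by (simp add: powr_divide)
    moreover have "real n powr (\<alpha> - 1) = 1 / real n powr (1 - \<alpha>)"
      using powr_minus_divide[of "real n" "1 - \<alpha>"] by simp
    moreover have "sqrt (L n) * sqrt (real (k n) / L n) = sqrt (real (k n))" using L by (simp add: real_sqrt_mult[symmetric])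
    moreover have "s * x * (p * T) * y * z / W = p / (W * (1 / T) * (1 / m / r))" if "x * y = m" "s * z = r" "T > 0" "m > 0" "r > 0" for s x p T y z m r
      using that W0 by (simp flip: that(1) that(2))
    moreover have "t ^ k n > 0" "real n powr (1 - \<alpha>) > 0" "sqrt (real (k n)) > 0" using t_pos n kp by auto
    ultimately show "?l n =
      ?r n"
      unfolding g by (simp only:)
  qed
  from Lim_transform_eventually[OF lim this]
  show "(\<lambda>n. chain_prob (k n) n / (sigma_star \<alpha> / sqrt (2 * pi) * (1 / \<alpha> + 1 / (\<alpha> + 1)) * (K \<alpha> / Gamma \<alpha>)
       * ((\<alpha> + 1) gchoose 2) powi (- int (k n)) * (real n powr (\<alpha> - 1) / sqrt (real (k n))))) \<longlonglongrightarrow> 1"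
    unfolding W_def .
qed

theorem theorem3p15:
  fixes M :: "nat \<Rightarrow> 'a measure"
    and X :: "nat \<Rightarrow> nat \<Rightarrow> 'a \<Rightarrow> real \<times> real"
    and c :: real
    and k :: "nat \<Rightarrow> nat"
  assumes "\<And>n. iid_uniform_points (M n) (X n) n"
    and "0 < c" and "c < 3 / 4"
    and "\<And>n. k n = nat \<lfloor>c * ln (real n)\<rfloor>"
  shows "alpha_star c > 0 \<and> sigma_star (alpha_star c) > 0 \<and>
    (\<lambda>n. vertex_prob (M n) (X n) n (k n)) \<sim>[at_top]
    (\<lambda>n. sigma_star (alpha_star c) / sqrt (2 * pi)
          * (1 / alpha_star c + 1 / (alpha_star c + 1))
          * (K (alpha_star c) / Gamma (alpha_star c))
          * ((alpha_star c + 1) gchoose 2) powi (- int (k n))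
          * (real n powr (alpha_star c - 1) / sqrt (real (k n))))"
proof -
  interpret saddle "alpha_star c" "alpha_star c * (alpha_star c + 1) / 2" c
    by (rule saddle_alpha_star[OF assms(2)])
  have "eventually (\<lambda>n. vertex_prob (M n) (X n) n (k n) = chain_prob (k n) n) at_top"
    using eventually_gt_at_top[of 0]
    by eventually_elim (rule vertex_prob_eq_chain_prob[OF assms(1)])
  hence eq: "(\<lambda>n. vertex_prob (M n) (X n) n (k n)) \<sim>[at_top] g \<longleftrightarrow> (\<lambda>n. chain_prob (k n) n) \<sim>[at_top] g" for g
    by (rule asymp_equiv_cong) simp
  show ?thesis
    unfolding eq using chain_prob_asymp_equiv[OF assms(4)] variance_rate_sigma_star(1) \<alpha> by blast
qed

end
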